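(* Let $k\ge 1$, let $G$ be a group with finite symmetric generating set $X$, and let $\Lambda$ be a finite set of symbols such that $(G,X,\Lambda)$ is $\mathscr S_k$-graph automatic with quasigeodesic normal form $L\subseteq\Lambda^*$. Moreover, assume we are given $p\in X^*$ and $q\in L$ with $p=_G\overline{q}$. Then there is an algorithm that, on input a word $w=x_1\dots x_n\in X^*$, computes $u\in L$ with $\overline{u}=_G w$, and which runs in time $O(n^{2k+2})$.
   Context: A generating set is symmetric if it is closed under inverses. A normal form for $(G,X,\Lambda)$ is a set of words $L\subseteq\Lambda^*$ in bijection with $G$; the image of $u\in L$ under the bijection is denoted $\overline u$. $|u|_\Lambda$ denotes the number of letters of $u\in\Lambda^*$. The normal form $L$ is quasigeodesic if there is a constant $D$ such that $|u|_\Lambda\le D(\|u\|_X+1)$ for each $u\in L$, where $\|u\|_X$ is the length of a shortest word in $X^*$ representing $\overline u$. $=_G$ means equality as elements of $G$. Convolution: let $\diamond\notin\Lambda$ and $\Lambda_\diamond=\Lambda\cup\{\diamond\}$. For $u,v\in\Lambda^*$, $\otimes(u,v)$ is the word of length $\max(|u|_\Lambda,|v|_\Lambda)$ over $(\Lambda_\diamond)^2$ whose $i$th letter is $\binom{\lambda_1}{\lambda_2}$, where $\lambda_1$ is the $i$th letter of $u$ if $i\le|u|_\Lambda$ and $\diamond$ otherwise, and $\lambda_2$ is defined likewise from $v$. For a class $\mathcal C$ of formal languages, $(G,X,\Lambda)$ is $\mathcal C$-graph automatic (with normal form $L$) if $L\subseteq\Lambda^*$ is a normal form in $\mathcal C$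 such that for each $x\in X$ the language $L_x=\{\otimes(u,v)\mid u,v\in L,\ \overline v=_G\overline u x\}$ is in $\mathcal C$. Counter automata: a non-blind $k$-counter automaton is a finite state automaton augmented with $k$ integer counters, all initialized to zero, which can be incremented, decremented, compared to zero and set to zero during operation; it accepts a word exactly if it reaches an accepting state with all counters equal to zero. It is non-deterministic if from each state there can be multiple transitions labeled by the same input letter, and transitions labeled by $\epsilon$ that read no input letter. It runs in quasi-realtime if there is a bound on the number of consecutive $\epsilon$ transitions allowed. $\mathscr S_k$ is the class of languages accepted by non-blind non-deterministic $k$-counter automata running in quasi-realtime. *)

theory Defs
  imports "HOL-Algebra.Generated_Groups" "HOL-Library.Landau_Symbols"
begin

section \<open>Words, norms and normal forms\<close>

definition word_val :: "('g, 'b) monoid_scheme \<Rightarrow> 'g list \<Rightarrow> 'g" where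
  "word_val G w = foldr (\<lambda>x y. x \<otimes>\<^bsub>G\<^esub> y) w \<one>\<^bsub>G\<^esub>"

definition symmetric_generating_set :: "('g, 'b) monoid_scheme \<Rightarrow> 'g set \<Rightarrow> bool" where
  "symmetric_generating_set G X \<longleftrightarrow>
     X \<subseteq> carrier G \<and> (\<forall>x\<in>X. inv\<^bsub>G\<^esub> x \<in> X) \<and> generate G X = carrier G"

definition word_norm :: "('g, 'b) monoid_scheme \<Rightarrow> 'g set \<Rightarrow> 'g \<Rightarrow> nat" where
  "word_norm G X g = (LEAST n. \<exists>w\<in>lists X. word_val G w = g \<and> length w = n)"

text \<open>The map \<open>bar\<close> is the bijection from the language onto the group.\<close>

definition normal_form ::
  "('g, 'b) monoid_scheme \<Rightarrow> 'l set \<Rightarrow> 'l list set \<Rightarrow> ('l list \<Rightarrow> 'g) \<Rightarrow> bool" where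
  "normal_form G \<Lambda> L bar \<longleftrightarrow> L \<subseteq> lists \<Lambda> \<and> bij_betw bar L (carrier G)"

definition quasigeodesic ::
  "('g, 'b) monoid_scheme \<Rightarrow> 'g set \<Rightarrow> 'l list set \<Rightarrow> ('l list \<Rightarrow> 'g) \<Rightarrow> bool" where
  "quasigeodesic G X L bar \<longleftrightarrow>
     (\<exists>D::real. \<forall>u\<in>L. real (length u) \<le> D * (real (word_norm G X (bar u)) + 1))"


section \<open>Convolution\<close>

text \<open>The padding symbol is \<^const>\<open>None\<close>; a letter \<open>a\<close> of the alphabet is \<open>Some a\<close>.\<close>

definition padded :: "'l set \<Rightarrow> 'l option set" where
  "padded \<Lambda> = insert None (Some ` \<Lambda>)"

definition conv :: "'l list \<Rightarrow> 'l list \<Rightarrow> ('l option \<times> 'l option) list" where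
  "conv u v =
     map (\<lambda>i. (if i < length u then Some (u ! i) else None,
               if i < length v then Some (v ! i) else None))
       [0..<max (length u) (length v)]"

definition mult_language ::
  "('g, 'b) monoid_scheme \<Rightarrow> 'l list set \<Rightarrow> ('l list \<Rightarrow> 'g) \<Rightarrow> 'g \<Rightarrow>
   ('l option \<times> 'l option) list set" where
  "mult_language G L bar x = {conv u v |u v. u \<in> L \<and> v \<in> L \<and> bar v = bar u \<otimes>\<^bsub>G\<^esub> x}"


section \<open>Non-blind counter automata\<close>

datatype counter_test = No_Test | Is_Zero | Is_Nonzero | Is_Pos | Is_Neg

fun passes :: "counter_test \<Rightarrow> int \<Rightarrow> bool" where
  "passes No_Test c = True"
| "passes Is_Zero c = (c = 0)"
| "passes Is_Nonzero c = (c \<noteq> 0)"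
| "passes Is_Pos c = (c > 0)"
| "passes Is_Neg c = (c < 0)"

datatype counter_op = Keep | Incr | Decr | Reset

fun apply_op :: "counter_op \<Rightarrow> int \<Rightarrow> int" where
  "apply_op Keep c = c"
| "apply_op Incr c = c + 1"
| "apply_op Decr c = c - 1"
| "apply_op Reset c = 0"

text \<open>
  A transition consists of a source state, a label (\<^const>\<open>None\<close> for an \<open>\<epsilon>\<close>-transition), one test
  and one operation for each counter, and a target state. All tests are made before the operations.
\<close>

type_synonym 'a transition =
  "nat \<times> 'a option \<times> counter_test list \<times> counter_op list \<times> nat"

record 'a counter_automaton =
  ca_states :: "nat set"
  ca_start :: nat
  ca_accept :: "nat set"
  ca_trans :: "'a transition set"

definition is_counter_automaton :: "nat \<Rightarrow> 'a set \<Rightarrow> 'a counter_automaton \<Rightarrow> bool" where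
  "is_counter_automaton k \<Sigma> M \<longleftrightarrow>
     finite (ca_states M) \<and> ca_start M \<in> ca_states M \<and> ca_accept M \<subseteq> ca_states M \<and>
     finite (ca_trans M) \<and>
     (\<forall>(p, a, tests, ops, q)\<in>ca_trans M.
        p \<in> ca_states M \<and> q \<in> ca_states M \<and> set_option a \<subseteq> \<Sigma> \<and>
        length tests = k \<and> length ops = k)"

type_synonym config = "nat \<times> int list"

inductive ca_step :: "'a counter_automaton \<Rightarrow> config \<Rightarrow> 'a option \<Rightarrow> config \<Rightarrow> bool"
  for M where
  "(p, a, tests, ops, q) \<in> ca_trans M \<Longrightarrow> list_all2 passes tests cs \<Longrightarrow>
   ca_step M (p, cs) a (q, map2 apply_op ops cs)"

inductive ca_path :: "'a counter_automaton \<Rightarrow> config \<Rightarrow> 'a option list \<Rightarrow> config \<Rightarrow> bool"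
  for M where
  ca_path_Nil: "ca_path M c [] c"
| ca_path_Cons: "ca_step M c a c' \<Longrightarrow> ca_path M c' as c'' \<Longrightarrow> ca_path M c (a # as) c''"

definition ca_init :: "nat \<Rightarrow> 'a counter_automaton \<Rightarrow> config" where
  "ca_init k M = (ca_start M, replicate k 0)"

definition ca_language :: "nat \<Rightarrow> 'a counter_automaton \<Rightarrow> 'a list set" where
  "ca_language k M =
     {List.map_filter id as |as f. f \<in> ca_accept M \<and> ca_path M (ca_init k M) as (f, replicate k 0)}"

text \<open>The bound concerns every computation from the initial configuration, accepting or not.\<close>

definition quasi_realtime :: "nat \<Rightarrow> 'a counter_automaton \<Rightarrow> bool" where
  "quasi_realtime k M \<longleftrightarrow>
     (\<exists>B. \<forall>as c m c'.
        ca_path M (ca_init k M) as c \<longrightarrow> ca_path M c (replicate m None) c' \<longrightarrow> m \<le> B)"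

definition counter_languages :: "nat \<Rightarrow> 'a set \<Rightarrow> 'a list set set" where
  "counter_languages k \<Sigma> =
     {ca_language k M |M. is_counter_automaton k \<Sigma> M \<and> quasi_realtime k M}"


section \<open>Graph automatic groups for the class of counter languages\<close>

definition counter_graph_automatic ::
  "nat \<Rightarrow> ('g, 'b) monoid_scheme \<Rightarrow> 'g set \<Rightarrow> 'l set \<Rightarrow> 'l list set \<Rightarrow> ('l list \<Rightarrow> 'g) \<Rightarrow> bool" where
  "counter_graph_automatic k G X \<Lambda> L bar \<longleftrightarrow>
     normal_form G \<Lambda> L bar \<and> L \<in> counter_languages k \<Lambda> \<and>
     (\<forall>x\<in>X. mult_language G L bar x \<in> counter_languages k (padded \<Lambda> \<times> padded \<Lambda>))"


section \<open>Random access machines\<close>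

text \<open>
  Programs for a random access machine with unbounded memory of natural numbers, indirect
  addressing, a one-way input tape and a one-way output tape, under the unit cost criterion.
  The only arithmetic is successor and predecessor. Hence numbers grow by at most one per time
  step, so that unit cost does not hide arithmetic on large numbers, and a time bound in this model
  remains valid in unit cost models with more instructions. Control flow is given by structured
  statements instead of jumps, which changes running times by at most a constant factor.
\<close>

datatype ram =
    Skip
  | Const nat nat
  | Copy nat nat
  | Inc nat
  | Dec nat
  | Load nat nat
  | Store nat nat
  | Read nat
  | Print nat
  | Seq ram ram
  | IfNZ nat ram ram
  | WhileNZ nat ram

text \<open>A state consists of the memory, the unread input and the output produced so far.\<close>

type_synonym ram_state = "(nat \<Rightarrow> nat) \<times> nat list \<times> nat list"

text \<open>\<open>ram_exec P s t s'\<close>: started in \<open>s\<close>, the program \<open>P\<close> halts after \<open>t\<close> time steps in \<open>s'\<close>.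
  Reading beyond the end of the input yields \<open>0\<close>, which is not the code of any letter.\<close>

inductive ram_exec :: "ram \<Rightarrow> ram_state \<Rightarrow> nat \<Rightarrow> ram_state \<Rightarrow> bool" where
  exec_Skip: "ram_exec Skip s 1 s"
| exec_Const: "ram_exec (Const r n) (m, i, os) 1 (m(r := n), i, os)"
| exec_Copy: "ram_exec (Copy r a) (m, i, os) 1 (m(r := m a), i, os)"
| exec_Inc: "ram_exec (Inc r) (m, i, os) 1 (m(r := m r + 1), i, os)"
| exec_Dec: "ram_exec (Dec r) (m, i, os) 1 (m(r := m r - 1), i, os)"
| exec_Load: "ram_exec (Load r a) (m, i, os) 1 (m(r := m (m a)), i, os)"
| exec_Store: "ram_exec (Store r a) (m, i, os) 1 (m(m r := m a), i, os)"
| exec_Read_end: "ram_exec (Read r) (m, [], os) 1 (m(r := 0), [], os)"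
| exec_Read: "ram_exec (Read r) (m, x # i, os) 1 (m(r := x), i, os)"
| exec_Print: "ram_exec (Print r) (m, i, os) 1 (m, i, os @ [m r])"
| exec_Seq: "ram_exec P s t s' \<Longrightarrow> ram_exec Q s' t' s'' \<Longrightarrow> ram_exec (Seq P Q) s (t + t') s''"
| exec_If_nonzero: "fst s r \<noteq> 0 \<Longrightarrow> ram_exec P s t s' \<Longrightarrow> ram_exec (IfNZ r P Q) s (1 + t) s'"
| exec_If_zero: "fst s r = 0 \<Longrightarrow> ram_exec Q s t s' \<Longrightarrow> ram_exec (IfNZ r P Q) s (1 + t) s'"
| exec_While_zero: "fst s r = 0 \<Longrightarrow> ram_exec (WhileNZ r P) s 1 s"
| exec_While_nonzero: "fst s r \<noteq> 0 \<Longrightarrow> ram_exec P s t s' \<Longrightarrow> ram_exec (WhileNZ r P) s' t' s'' \<Longrightarrow>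
    ram_exec (WhileNZ r P) s (1 + t + t') s''"

inductive_cases ram_exec_SkipE: "ram_exec Skip s t s'"
inductive_cases ram_exec_ConstE: "ram_exec (Const r n) s t s'"
inductive_cases ram_exec_CopyE: "ram_exec (Copy r a) s t s'"
inductive_cases ram_exec_IncE: "ram_exec (Inc r) s t s'"
inductive_cases ram_exec_DecE: "ram_exec (Dec r) s t s'"
inductive_cases ram_exec_LoadE: "ram_exec (Load r a) s t s'"
inductive_cases ram_exec_StoreE: "ram_exec (Store r a) s t s'"
inductive_cases ram_exec_ReadE: "ram_exec (Read r) s t s'"
inductive_cases ram_exec_PrintE: "ram_exec (Print r) s t s'"
inductive_cases ram_exec_SeqE: "ram_exec (Seq P Q) s t s'"
inductive_cases ram_exec_IfNZE: "ram_exec (IfNZ r P Q) s t s'"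
inductive_cases ram_exec_WhileNZE: "ram_exec (WhileNZ r P) s t s'"

lemma ram_exec_deterministic:
  "ram_exec P s t s' \<Longrightarrow> ram_exec P s t' s'' \<Longrightarrow> t = t' \<and> s' = s''"
proof (induction arbitrary: t' s'' rule: ram_exec.induct)
  case (exec_Seq P s t s1 Q u s2)
  from exec_Seq.prems obtain a x b where "ram_exec P s a x" "ram_exec Q x b s''" "t' = a + b"
    by (rule ram_exec_SeqE)
  with exec_Seq.IH show ?case by metis
next
  case (exec_If_nonzero s r P t s1 Q)
  from exec_If_nonzero.prems exec_If_nonzero.hyps obtain a where
    "ram_exec P s a s''" "t' = 1 + a"
    by - (erule ram_exec_IfNZE, auto)
  with exec_If_nonzero.IH show ?case by metis
next
  case (exec_If_zero s r Q t s1 P)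
  from exec_If_zero.prems exec_If_zero.hyps obtain a where
    "ram_exec Q s a s''" "t' = 1 + a"
    by - (erule ram_exec_IfNZE, auto)
  with exec_If_zero.IH show ?case by metis
next
  case (exec_While_zero s r P)
  from exec_While_zero.prems show ?case
    by (rule ram_exec_WhileNZE) (use exec_While_zero.hyps in auto)
next
  case (exec_While_nonzero s r P t s1 u s2)
  from exec_While_nonzero.prems exec_While_nonzero.hyps obtain a x b where
    "ram_exec P s a x" "ram_exec (WhileNZ r P) x b s''" "t' = 1 + a + b"
    by - (erule ram_exec_WhileNZE, auto)
  with exec_While_nonzero.IH show ?case by metis
qed (erule ram_exec_SkipE ram_exec_ConstE ram_exec_CopyE ram_exec_IncE ram_exec_DecE
       ram_exec_LoadE ram_exec_StoreE ram_exec_ReadE ram_exec_PrintE; simp)+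

definition letter_code :: "'a set \<Rightarrow> ('a \<Rightarrow> nat) \<Rightarrow> bool" where
  "letter_code A c \<longleftrightarrow> inj_on c A \<and> 0 \<notin> c ` A"

text \<open>
  For every coding of the letters by positive numbers there is a program that halts on every word
  \<open>w\<close> over \<open>A\<close>, outputs a word \<open>u\<close> over \<open>B\<close> with \<open>R w u\<close>, and runs in time \<open>O(f)\<close> in the length
  of \<open>w\<close>.
\<close>

definition computable_in_time ::
  "'a set \<Rightarrow> 'b set \<Rightarrow> ('a list \<Rightarrow> 'b list \<Rightarrow> bool) \<Rightarrow> (nat \<Rightarrow> real) \<Rightarrow> bool" where
  "computable_in_time A B R f \<longleftrightarrow>
     (\<forall>cA cB. letter_code A cA \<longrightarrow> letter_code B cB \<longrightarrow>
        (\<exists>P T. (\<lambda>n. real (T n)) \<in> O(f) \<and>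
           (\<forall>w\<in>lists A. \<exists>u\<in>lists B. R w u \<and>
              (\<exists>t m i. t \<le> T (length w) \<and>
                 ram_exec P (\<lambda>_. 0, map cA w, []) t (m, i, map cB u)))))"

end

theory Submission
  imports Defs
begin

text \<open>
  The normal form of \<open>x\<^sub>1 \<dots> x\<^sub>n\<close> is computed letter by letter. If \<open>u\<close> is the normal form
  of \<open>g\<close>, then the normal form of \<open>g x\<close> is the only \<open>v\<close> for which the counter automaton \<open>M\<close> for \<open>x\<close>
  accepts \<open>conv u v\<close>. The first components of the input of \<open>M\<close> are thus known and the second ones
  have to be guessed. This is done by a breadth-first search in the configurations of \<open>M\<close>: layer \<open>j\<close>
  consists of the configurations that \<open>M\<close> can reach by reading \<open>j\<close> letters whose first components
  spell the first \<open>j\<close> symbols of \<open>u\<close>, continued by padding symbols. Every configuration is stored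
  with the history that led to it. As soon as \<open>u\<close> is used up and an accepting configuration with
  all counters zero occurs, the second components along its history spell \<open>v\<close>, because a convolution
  determines both of its arguments (\<open>final_trace\<close>).
  
  Since \<open>M\<close> runs in quasi-realtime, at most \<open>B\<close> consecutive \<open>\<epsilon>\<close>-moves occur, so that a layer is
  obtained from the previous one by one round of letter moves and \<open>B\<close> rounds of optional \<open>\<epsilon>\<close>-moves
  (\<open>layer_complete\<close>). After \<open>s\<close> moves all counters lie between \<open>-s\<close> and \<open>s\<close>, hence a layer without
  repetitions has \<open>O(s\<^sup>k)\<close> members (\<open>length_le_width\<close>). As the normal form is quasigeodesic, \<open>u\<close> and
  \<open>v\<close> have length \<open>O(n)\<close>, and the search succeeds within \<open>O(n)\<close> layers.
  
  Layers are plain lists, and every new configuration is compared with all members of the new layer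
  to avoid repetitions. So one layer costs \<open>O(n\<^sup>2\<^sup>k)\<close> steps, one letter of the input costs
  \<open>O(n\<^sup>2\<^sup>k\<^sup>+\<^sup>1)\<close> (\<open>search_prog_runs\<close> and \<open>search_cost_bound\<close>), and the word costs \<open>O(n\<^sup>2\<^sup>k\<^sup>+\<^sup>2)\<close>. This count
  needs counters to be compared in constant time, although the machine has no comparison
  instruction. The comparison uses indirect addressing: numbers are represented by odd addresses, all
  other data live at even addresses, and two odd addresses are equal iff writing \<open>0\<close> to the first and
  then \<open>1\<close> to the second changes what is read at the first.
  
  On the machine, programs act on finitely many variables that hold immutable binary trees in a heap
  that only grows. Therefore no step destroys earlier data, histories share their tails, and programs can
  be verified on trees instead of memory contents.
\<close>

section \<open>Machine programs on trees\<close>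

text \<open>
  \<open>Raw n\<close> is a number that is stored as it is; it serves for letter codes, truth values and, as
  \<open>Raw 0\<close>, for the empty list. \<open>Num n\<close> is a number in the form that can be compared in constant time;
  it serves for automaton states and counters. \<open>Branch\<close> is a heap cell.
\<close>

datatype val = is_Raw: Raw (raw: nat) | is_Num: Num (num: nat) | is_Branch: Branch (left: val) (right: val)

datatype var = Word | Rest | Sym | Flag | Old | New | Node | Cfg | Tmp | Cand | Letter | Ok
  | First | Second | Zero | Scan | Found | Lhs | Rhs | Same | Item | Acc | Inp

abbreviation (input) reg_zero :: nat where "reg_zero \<equiv> 0"
abbreviation (input) reg_one :: nat where "reg_one \<equiv> 2"
abbreviation (input) reg_free :: nat where "reg_free \<equiv> 4"
abbreviation (input) reg_aux :: nat where "reg_aux \<equiv> 6"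
abbreviation (input) heap_base :: nat where "heap_base \<equiv> 100"

text \<open>
  Registers and heap use even addresses only. The odd addresses are left to \<open>if_same\<close> as scratch space.
\<close>

fun reg :: "var \<Rightarrow> nat" where
  "reg Word = 10" | "reg Rest = 12" | "reg Sym = 14" | "reg Flag = 16" | "reg Old = 18"
| "reg New = 20" | "reg Node = 22" | "reg Cfg = 24" | "reg Tmp = 26" | "reg Cand = 28"
| "reg Letter = 30" | "reg Ok = 32" | "reg First = 34" | "reg Second = 36" | "reg Zero = 38"
| "reg Scan = 40" | "reg Found = 42" | "reg Lhs = 44" | "reg Rhs = 46" | "reg Same = 48"
| "reg Item = 50" | "reg Acc = 52" | "reg Inp = 54"

lemma reg_bounds: "10 \<le> reg x" "reg x < heap_base" "even (reg x)"
  by (cases x; simp)+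

lemma inj_reg: "inj reg"
proof (rule injI)
  fix x y assume "reg x = reg y" then show "x = y" by (cases x; cases y; simp)
qed

text \<open>
  The number \<open>a\<close> represents a tree in memory \<open>m\<close> whose first free heap address is \<open>h\<close>. A branch has to lie
  completely below \<open>h\<close>, so that later allocations cannot touch it.
\<close>

fun rep :: "(nat \<Rightarrow> nat) \<Rightarrow> nat \<Rightarrow> val \<Rightarrow> nat \<Rightarrow> bool" where
  "rep m h (Raw n) a \<longleftrightarrow> a = n"
| "rep m h (Num n) a \<longleftrightarrow> a = 2 * n + 1"
| "rep m h (Branch v w) a \<longleftrightarrow>
     even a \<and> heap_base \<le> a \<and> a + 4 \<le> h \<and> rep m h v (m a) \<and> rep m h w (m (a + 2))"

declare reg.simps [simp del]

type_synonym store = "var \<Rightarrow> val"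

definition represents :: "(nat \<Rightarrow> nat) \<Rightarrow> store \<Rightarrow> bool" where
  "represents m \<sigma> \<longleftrightarrow> m reg_zero = 0 \<and> m reg_one = 1 \<and> even (m reg_free) \<and>
     heap_base \<le> m reg_free \<and> (\<forall>x. rep m (m reg_free) (\<sigma> x) (m (reg x)))"

text \<open>
  Occupied cells are never overwritten; this is why a tree keeps its representation for ever and may
  be shared.
\<close>

lemma rep_frame:
  assumes "rep m h v a" "h \<le> h'" "\<And>b. even b \<Longrightarrow> heap_base \<le> b \<Longrightarrow> b < h \<Longrightarrow> m' b = m b"
  shows "rep m' h' v a"
  using assms by (induction v arbitrary: a) auto

lemma represents_frame:
  assumes "represents m \<sigma>" "m' reg_zero = 0" "m' reg_one = 1" "m' reg_free = m reg_free"
    "\<And>b. even b \<Longrightarrow> heap_base \<le> b \<Longrightarrow> m' b = m b"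
    "\<And>x. rep m (m reg_free) (\<sigma>' x) (m' (reg x))"
  shows "represents m' \<sigma>'"
  using assms unfolding represents_def by (auto intro: rep_frame)

lemma represents_set:
  assumes "represents m \<sigma>" "rep m (m reg_free) v a"
  shows "represents (m(reg x := a)) (\<sigma>(x := v))"
proof (rule represents_frame[OF assms(1)])
  show "rep m (m reg_free) ((\<sigma>(x := v)) y) ((m(reg x := a)) (reg y))" for y
    using assms injD[OF inj_reg] by (auto simp: represents_def)
qed (use assms reg_bounds[of x] in \<open>auto simp: represents_def\<close>)

lemma represents_aux:
  assumes "represents m \<sigma>"
  shows "represents (m(reg_aux := a)) \<sigma>"
proof (rule represents_frame[OF assms])
  show "rep m (m reg_free) (\<sigma> y) ((m(reg_aux := a)) (reg y))" for y
    using assms reg_bounds(1)[of y] by (auto simp: represents_def)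
qed (use assms in \<open>auto simp: represents_def\<close>)

text \<open>
  Representations mention even addresses only, which is why comparisons do no damage.
\<close>

lemma represents_scratch:
  assumes "represents m \<sigma>" "odd b"
  shows "represents (m(b := a)) \<sigma>"
proof (rule represents_frame[OF assms(1)])
  have "reg y \<noteq> b" for y using reg_bounds(3)[of y] assms(2) by metis
  then show "rep m (m reg_free) (\<sigma> y) ((m(b := a)) (reg y))" for y
    using assms by (auto simp: represents_def)
  show "(m(b := a)) reg_zero = 0" "(m(b := a)) reg_one = 1" "(m(b := a)) reg_free = m reg_free"
    using assms by (auto simp: represents_def)
qed (use assms in auto)

text \<open>
  Total correctness with running times. The postcondition \<open>Q\<close> also receives the elapsed time; by
  nesting postconditions, as in \<open>runs_io_Seq\<close>, times add up while a program is executed symbolically.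
\<close>

definition runs_io :: "ram \<Rightarrow> store \<Rightarrow> nat list \<Rightarrow> nat list \<Rightarrow>
    (nat \<Rightarrow> store \<Rightarrow> nat list \<Rightarrow> nat list \<Rightarrow> bool) \<Rightarrow> bool" where
  "runs_io P \<sigma> i os Q \<longleftrightarrow> (\<forall>m. represents m \<sigma> \<longrightarrow>
     (\<exists>t m' \<sigma>' i' os'. ram_exec P (m, i, os) t (m', i', os') \<and> represents m' \<sigma>' \<and> Q t \<sigma>' i' os'))"

definition runs :: "ram \<Rightarrow> store \<Rightarrow> (nat \<Rightarrow> store \<Rightarrow> bool) \<Rightarrow> bool" where
  "runs P \<sigma> Q \<longleftrightarrow> (\<forall>i os. runs_io P \<sigma> i os (\<lambda>t \<sigma>' i' os'. i' = i \<and> os' = os \<and> Q t \<sigma>'))"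

fun nonzero :: "val \<Rightarrow> bool" where
  "nonzero (Raw n) \<longleftrightarrow> n \<noteq> 0"
| "nonzero (Num n) \<longleftrightarrow> True"
| "nonzero (Branch v w) \<longleftrightarrow> True"

lemma nonzero_rep: "rep m h v a \<Longrightarrow> nonzero v \<longleftrightarrow> a \<noteq> 0"
  by (cases v) auto

lemma nonzero_represents: "represents m \<sigma> \<Longrightarrow> nonzero (\<sigma> x) \<longleftrightarrow> m (reg x) \<noteq> 0"
  unfolding represents_def using nonzero_rep by blast

subsection \<open>Control flow\<close>

lemma runs_io_conseq:
  assumes "runs_io P \<sigma> i os Q" "\<And>t \<sigma>' i' os'. Q t \<sigma>' i' os' \<Longrightarrow> Q' t \<sigma>' i' os'"
  shows "runs_io P \<sigma> i os Q'"
  using assms unfolding runs_io_def by blast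

lemma runs_io_lift:
  assumes "runs P \<sigma> Q" "\<And>t \<sigma>'. Q t \<sigma>' \<Longrightarrow> Q' t \<sigma>' i os"
  shows "runs_io P \<sigma> i os Q'"
  using assms unfolding runs_def by (blast intro: runs_io_conseq)

lemma runs_conseq:
  assumes "runs P \<sigma> Q" "\<And>t \<sigma>'. Q t \<sigma>' \<Longrightarrow> Q' t \<sigma>'"
  shows "runs P \<sigma> Q'"
  using assms unfolding runs_def by (blast intro: runs_io_conseq)

lemma runs_io_Seq:
  assumes "runs_io P \<sigma> i os (\<lambda>t \<sigma>' i' os'. runs_io P' \<sigma>' i' os' (\<lambda>t'. Q (t + t')))"
  shows "runs_io (Seq P P') \<sigma> i os Q"
  using assms unfolding runs_io_def by (blast intro: exec_Seq)

lemma runs_io_While_zero: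
  assumes "\<not> nonzero (\<sigma> x)" "Q 1 \<sigma> i os"
  shows "runs_io (WhileNZ (reg x) P) \<sigma> i os Q"
  unfolding runs_io_def
proof (intro allI impI)
  fix m assume m: "represents m \<sigma>"
  then have "ram_exec (WhileNZ (reg x) P) (m, i, os) 1 (m, i, os)"
    using assms(1) nonzero_represents by (intro exec_While_zero) auto
  then show "\<exists>t m' \<sigma>' i' os'. ram_exec (WhileNZ (reg x) P) (m, i, os) t (m', i', os') \<and>
      represents m' \<sigma>' \<and> Q t \<sigma>' i' os'"
    using m assms(2) by blast
qed

lemma runs_io_While_nonzero:
  assumes "nonzero (\<sigma> x)"
    "runs_io P \<sigma> i os (\<lambda>t \<sigma>' i' os'.
       runs_io (WhileNZ (reg x) P) \<sigma>' i' os' (\<lambda>t'. Q (1 + t + t')))"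
  shows "runs_io (WhileNZ (reg x) P) \<sigma> i os Q"
  unfolding runs_io_def
proof (intro allI impI)
  fix m assume m: "represents m \<sigma>"
  then have nz: "fst (m, i, os) (reg x) \<noteq> 0" using assms(1) nonzero_represents by auto
  show "\<exists>t m' \<sigma>' i' os'. ram_exec (WhileNZ (reg x) P) (m, i, os) t (m', i', os') \<and>
      represents m' \<sigma>' \<and> Q t \<sigma>' i' os'"
    using assms(2) m exec_While_nonzero[OF nz] unfolding runs_io_def by blast
qed

lemma runs_Seq:
  assumes "runs P \<sigma> (\<lambda>t \<sigma>'. runs P' \<sigma>' (\<lambda>t'. Q (t + t')))"
  shows "runs (Seq P P') \<sigma> Q"
  using assms unfolding runs_def by (blast intro: runs_io_Seq runs_io_conseq)

lemma runs_While_zero: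
  assumes "\<not> nonzero (\<sigma> x)" "Q 1 \<sigma>"
  shows "runs (WhileNZ (reg x) P) \<sigma> Q"
  using assms unfolding runs_def by (blast intro: runs_io_While_zero)

lemma runs_While_nonzero:
  assumes "nonzero (\<sigma> x)"
    "runs P \<sigma> (\<lambda>t \<sigma>'. runs (WhileNZ (reg x) P) \<sigma>' (\<lambda>t'. Q (1 + t + t')))"
  shows "runs (WhileNZ (reg x) P) \<sigma> Q"
  using assms unfolding runs_def by (blast intro: runs_io_While_nonzero runs_io_conseq)

lemma runs_If:
  assumes "nonzero (\<sigma> x) \<Longrightarrow> runs P \<sigma> (\<lambda>t. Q (1 + t))"
    "\<not> nonzero (\<sigma> x) \<Longrightarrow> runs P' \<sigma> (\<lambda>t. Q (1 + t))"
  shows "runs (IfNZ (reg x) P P') \<sigma> Q"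
  unfolding runs_def runs_io_def
proof (intro allI impI)
  fix i os m assume m: "represents m \<sigma>"
  show "\<exists>t m' \<sigma>' i' os'. ram_exec (IfNZ (reg x) P P') (m, i, os) t (m', i', os') \<and>
      represents m' \<sigma>' \<and> i' = i \<and> os' = os \<and> Q t \<sigma>'"
  proof (cases "m (reg x) = 0")
    case True
    then show ?thesis
      using assms(2) m nonzero_represents[OF m] exec_If_zero[of "(m, i, os)" "reg x"]
      unfolding runs_def runs_io_def by auto blast
  next
    case False
    then show ?thesis
      using assms(1) m nonzero_represents[OF m] exec_If_nonzero[of "(m, i, os)" "reg x"]
      unfolding runs_def runs_io_def by auto blast
  qed
qed

lemma runs_Skip: "Q 1 \<sigma> \<Longrightarrow> runs Skip \<sigma> Q"
  unfolding runs_def runs_io_def by (blast intro: exec_Skip)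

subsection \<open>Primitive operations\<close>

lemma runsI:
  assumes "\<And>m i os. represents m \<sigma> \<Longrightarrow>
    \<exists>m'. ram_exec P (m, i, os) t (m', i, os) \<and> represents m' \<sigma>'" "Q t \<sigma>'"
  shows "runs P \<sigma> Q"
  using assms unfolding runs_def runs_io_def by blast

definition "set_raw x n = Const (reg x) n"
definition "set_num x n = Const (reg x) (2 * n + 1)"
definition "move x y = Copy (reg x) (reg y)"
definition "inc_num x = Seq (Inc (reg x)) (Inc (reg x))"
definition "dec_num x = Seq (Dec (reg x)) (Dec (reg x))"
definition "head x y = Load (reg x) (reg y)"
definition "tail x y =
  Seq (Copy reg_aux (reg y)) (Seq (Inc reg_aux) (Seq (Inc reg_aux) (Load (reg x) reg_aux)))"
definition "new_branch x y z =
  Seq (Copy reg_aux reg_free) (Seq (Store reg_free (reg y))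
  (Seq (Inc reg_free) (Seq (Inc reg_free) (Seq (Store reg_free (reg z))
  (Seq (Inc reg_free) (Seq (Inc reg_free) (Copy (reg x) reg_aux)))))))"

text \<open>
  The registers \<open>x\<close> and \<open>y\<close> contain odd addresses. After \<open>0\<close> has been stored at the first and \<open>1\<close>
  at the second address, the first contains \<open>1\<close> iff the addresses agree.
\<close>

definition "if_same x y P P' =
  Seq (Store (reg x) reg_zero) (Seq (Store (reg y) reg_one) (Seq (Load reg_aux (reg x))
  (IfNZ reg_aux P P')))"

text \<open>
  Compares the auxiliary register with a constant by counting it down.
\<close>

fun if_aux :: "nat \<Rightarrow> ram \<Rightarrow> ram \<Rightarrow> ram" where
  "if_aux 0 P P' = IfNZ reg_aux P' P"
| "if_aux (Suc n) P P' = IfNZ reg_aux (Seq (Dec reg_aux) (if_aux n P P')) P'"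

definition "if_raw x n P P' = Seq (Copy reg_aux (reg x)) (if_aux n P P')"

lemma runs_set_raw:
  assumes "Q 1 (\<sigma>(x := Raw n))"
  shows "runs (set_raw x n) \<sigma> Q"
  unfolding set_raw_def
proof (rule runsI[where Q = Q, OF _ assms])
  fix m i os assume "represents m \<sigma>"
  then have "represents (m(reg x := n)) (\<sigma>(x := Raw n))" by (rule represents_set) simp
  then show "\<exists>m'. ram_exec (Const (reg x) n) (m, i, os) 1 (m', i, os) \<and>
      represents m' (\<sigma>(x := Raw n))"
    by (blast intro: exec_Const)
qed

lemma runs_set_num:
  assumes "Q 1 (\<sigma>(x := Num n))"
  shows "runs (set_num x n) \<sigma> Q"
  unfolding set_num_def
proof (rule runsI[where Q = Q, OF _ assms])
  fix m i os assume "represents m \<sigma>"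
  then have "represents (m(reg x := 2 * n + 1)) (\<sigma>(x := Num n))" by (rule represents_set) simp
  then show "\<exists>m'. ram_exec (Const (reg x) (2 * n + 1)) (m, i, os) 1 (m', i, os) \<and>
      represents m' (\<sigma>(x := Num n))"
    by (blast intro: exec_Const)
qed

lemma represents_rep: "represents m \<sigma> \<Longrightarrow> rep m (m reg_free) (\<sigma> x) (m (reg x))"
  by (auto simp: represents_def)

lemma represents_Raw: "represents m \<sigma> \<Longrightarrow> \<sigma> x = Raw n \<Longrightarrow> m (reg x) = n"
  by (drule represents_rep[of _ _ x]) simp

lemma represents_Num: "represents m \<sigma> \<Longrightarrow> \<sigma> x = Num n \<Longrightarrow> m (reg x) = 2 * n + 1"
  by (drule represents_rep[of _ _ x]) simp

lemma runs_move:
  assumes "Q 1 (\<sigma>(x := \<sigma> y))"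
  shows "runs (move x y) \<sigma> Q"
  unfolding move_def
proof (rule runsI[where Q = Q, OF _ assms])
  fix m i os assume m: "represents m \<sigma>"
  then have "represents (m(reg x := m (reg y))) (\<sigma>(x := \<sigma> y))"
    by (rule represents_set) (rule represents_rep[OF m])
  then show "\<exists>m'. ram_exec (Copy (reg x) (reg y)) (m, i, os) 1 (m', i, os) \<and>
      represents m' (\<sigma>(x := \<sigma> y))"
    by (blast intro: exec_Copy)
qed

lemma runs_inc_num:
  assumes "is_Num (\<sigma> x)" "Q 2 (\<sigma>(x := Num (Suc (num (\<sigma> x)))))"
  shows "runs (inc_num x) \<sigma> Q"
proof (rule runsI[where Q = Q, OF _ assms(2)])
  fix m i os assume m: "represents m \<sigma>"
  define n where "n = num (\<sigma> x)"
  then have n: "\<sigma> x = Num n" using assms(1) by simp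
  define m1 where "m1 = m(reg x := m (reg x) + 1)"
  have "ram_exec (inc_num x) (m, i, os) (1 + 1) (m1(reg x := m1 (reg x) + 1), i, os)"
    unfolding inc_num_def m1_def by (rule exec_Seq exec_Inc)+
  moreover have "m1(reg x := m1 (reg x) + 1) = m(reg x := 2 * Suc n + 1)"
    using represents_Num[OF m n] by (simp add: m1_def)
  moreover have "represents (m(reg x := 2 * Suc n + 1)) (\<sigma>(x := Num (Suc n)))"
    using m by (rule represents_set) simp
  ultimately show "\<exists>m'. ram_exec (inc_num x) (m, i, os) 2 (m', i, os) \<and>
      represents m' (\<sigma>(x := Num (Suc (num (\<sigma> x)))))"
    unfolding n_def by (metis one_add_one)
qed

lemma runs_dec_num:
  assumes "is_Num (\<sigma> x)" "num (\<sigma> x) \<noteq> 0" "Q 2 (\<sigma>(x := Num (num (\<sigma> x) - 1)))"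
  shows "runs (dec_num x) \<sigma> Q"
proof (rule runsI[where Q = Q, OF _ assms(3)])
  fix m i os assume m: "represents m \<sigma>"
  define n where "n = num (\<sigma> x) - 1"
  then have n: "\<sigma> x = Num (Suc n)" using assms(1,2) by (cases "\<sigma> x") auto
  define m1 where "m1 = m(reg x := m (reg x) - 1)"
  have "ram_exec (dec_num x) (m, i, os) (1 + 1) (m1(reg x := m1 (reg x) - 1), i, os)"
    unfolding dec_num_def m1_def by (rule exec_Seq exec_Dec)+
  moreover have "m1(reg x := m1 (reg x) - 1) = m(reg x := 2 * n + 1)"
    using represents_Num[OF m n] by (simp add: m1_def)
  moreover have "represents (m(reg x := 2 * n + 1)) (\<sigma>(x := Num n))"
    using m by (rule represents_set) simp
  ultimately show "\<exists>m'. ram_exec (dec_num x) (m, i, os) 2 (m', i, os) \<and>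
      represents m' (\<sigma>(x := Num (num (\<sigma> x) - 1)))"
    unfolding n_def by (metis one_add_one)
qed

lemma represents_Branch:
  assumes "represents m \<sigma>" "\<sigma> x = Branch v w"
  shows "rep m (m reg_free) v (m (m (reg x)))" "rep m (m reg_free) w (m (m (reg x) + 2))"
    "heap_base \<le> m (reg x)"
  using represents_rep[OF assms(1), of x] assms(2) by auto

lemma runs_head:
  assumes "is_Branch (\<sigma> y)" "Q 1 (\<sigma>(x := left (\<sigma> y)))"
  shows "runs (head x y) \<sigma> Q"
  unfolding head_def
proof (rule runsI[where Q = Q, OF _ assms(2)])
  fix m i os assume m: "represents m \<sigma>"
  have b: "\<sigma> y = Branch (left (\<sigma> y)) (right (\<sigma> y))" using assms(1) by simp
  from m have "represents (m(reg x := m (m (reg y)))) (\<sigma>(x := left (\<sigma> y)))"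
    by (rule represents_set) (rule represents_Branch(1)[OF m b])
  then show "\<exists>m'. ram_exec (Load (reg x) (reg y)) (m, i, os) 1 (m', i, os) \<and>
      represents m' (\<sigma>(x := left (\<sigma> y)))"
    by (blast intro: exec_Load)
qed

lemma runs_tail:
  assumes "is_Branch (\<sigma> y)" "Q 4 (\<sigma>(x := right (\<sigma> y)))"
  shows "runs (tail x y) \<sigma> Q"
proof (rule runsI[where Q = Q, OF _ assms(2)])
  fix m i os assume m: "represents m \<sigma>"
  have b: "\<sigma> y = Branch (left (\<sigma> y)) (right (\<sigma> y))" using assms(1) by simp
  define m1 where "m1 = m(reg_aux := m (reg y))"
  define m2 where "m2 = m1(reg_aux := m1 reg_aux + 1)"
  define m3 where "m3 = m2(reg_aux := m2 reg_aux + 1)"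
  define m4 where "m4 = m3(reg x := m3 (m3 reg_aux))"
  have "ram_exec (tail x y) (m, i, os) (1 + (1 + (1 + 1))) (m4, i, os)"
    unfolding tail_def m4_def m3_def m2_def m1_def
    by (rule exec_Seq exec_Copy exec_Inc exec_Load)+
  moreover have m3: "m3 = m(reg_aux := m (reg y) + 2)"
    by (simp add: m1_def m2_def m3_def)
  then have "m3 (m3 reg_aux) = m (m (reg y) + 2)"
    using represents_Branch(3)[OF m b] by auto
  moreover have "rep m3 (m3 reg_free) (right (\<sigma> y)) (m (m (reg y) + 2))"
    using represents_Branch(2)[OF m b] unfolding m3 by (auto elim: rep_frame)
  ultimately show "\<exists>m'. ram_exec (tail x y) (m, i, os) 4 (m', i, os) \<and> represents m' (\<sigma>(x := right (\<sigma> y)))"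
    using represents_set[OF represents_aux[OF m]] unfolding m4_def m3
    by (auto simp: numeral_eq_Suc)
qed

lemma runs_new_branch:
  assumes "Q 8 (\<sigma>(x := Branch (\<sigma> y) (\<sigma> z)))"
  shows "runs (new_branch x y z) \<sigma> Q"
proof (rule runsI[where Q = Q, OF _ assms])
  fix m i os assume m: "represents m \<sigma>"
  let ?h = "m reg_free"
  define m1 where "m1 = m(reg_aux := m reg_free)"
  define m2 where "m2 = m1(m1 reg_free := m1 (reg y))"
  define m3 where "m3 = m2(reg_free := m2 reg_free + 1)"
  define m4 where "m4 = m3(reg_free := m3 reg_free + 1)"
  define m5 where "m5 = m4(m4 reg_free := m4 (reg z))"
  define m6 where "m6 = m5(reg_free := m5 reg_free + 1)"
  define m7 where "m7 = m6(reg_free := m6 reg_free + 1)"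
  define m8 where "m8 = m7(reg x := m7 reg_aux)"
  have exec: "ram_exec (new_branch x y z) (m, i, os) (1 + (1 + (1 + (1 + (1 + (1 + (1 + 1)))))))
      (m8, i, os)"
    unfolding new_branch_def m8_def m7_def m6_def m5_def m4_def m3_def m2_def m1_def
    by (rule exec_Seq exec_Copy exec_Inc exec_Store)+
  have h: "even ?h" "100 \<le> ?h" using m by (auto simp: represents_def)
  have m4: "m4 = m(reg_aux := ?h, ?h := m (reg y), reg_free := ?h + 2)"
    using h reg_bounds(1)[of y] by (simp add: m1_def m2_def m3_def m4_def)
  have m7: "m7 = m(reg_aux := ?h, ?h := m (reg y), ?h + 2 := m (reg z), reg_free := ?h + 4)"
    using h reg_bounds[of z] unfolding m7_def m6_def m5_def m4 by (auto simp: fun_eq_iff)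
  have keep: "m7 b = m b" if "even b" "100 \<le> b" "b < ?h" for b
    using that h by (auto simp: m7)
  have regs: "m7 (reg v) = m (reg v)" for v
    using h reg_bounds[of v] by (auto simp: m7)
  have old: "rep m7 (?h + 4) (\<sigma> v) (m (reg v))" for v
    using rep_frame[OF represents_rep[OF m, of v], of "?h + 4" m7] keep by auto
  have "represents m7 \<sigma>"
    using m h old regs by (auto simp: represents_def m7)
  moreover have "rep m7 (m7 reg_free) (Branch (\<sigma> y) (\<sigma> z)) (m7 reg_aux)"
    using h old[of y] old[of z] by (auto simp: m7)
  ultimately have "represents m8 (\<sigma>(x := Branch (\<sigma> y) (\<sigma> z)))"
    unfolding m8_def by (rule represents_set)
  with exec show "\<exists>m'. ram_exec (new_branch x y z) (m, i, os) 8 (m', i, os) \<and>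
      represents m' (\<sigma>(x := Branch (\<sigma> y) (\<sigma> z)))"
    by (auto simp: numeral_eq_Suc)
qed

lemma exec_branch:
  assumes "ram_exec (if m r \<noteq> 0 then P else P') (m, i, os) t s"
  shows "ram_exec (IfNZ r P P') (m, i, os) (1 + t) s"
proof (cases "m r = 0")
  case True
  with assms show ?thesis by (intro exec_If_zero) auto
next
  case False
  with assms show ?thesis by (intro exec_If_nonzero) auto
qed

lemma runs_if_same:
  assumes "is_Num (\<sigma> x)" "is_Num (\<sigma> y)"
    "\<sigma> x = \<sigma> y \<Longrightarrow> runs P \<sigma> (\<lambda>t. Q (4 + t))"
    "\<sigma> x \<noteq> \<sigma> y \<Longrightarrow> runs P' \<sigma> (\<lambda>t. Q (4 + t))"
  shows "runs (if_same x y P P') \<sigma> Q"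
  unfolding runs_def runs_io_def
proof (intro allI impI)
  fix i os m assume m: "represents m \<sigma>"
  obtain a b where xy: "\<sigma> x = Num a" "\<sigma> y = Num b"
    using assms(1,2) by (auto simp: is_Num_def)
  note ab = represents_Num[OF m xy(1)] represents_Num[OF m xy(2)]
  have c: "m reg_zero = 0" "m reg_one = 1" using m by (auto simp: represents_def)
  define m1 where "m1 = m(m (reg x) := m reg_zero)"
  define m2 where "m2 = m1(m1 (reg y) := m1 reg_one)"
  define m3 where "m3 = m2(reg_aux := m2 (m2 (reg x)))"
  have ne: "reg v \<noteq> 2 * n + 1" for v n using reg_bounds(3)[of v] by (metis even_plus_one_iff dvd_triv_left)
  then have ne': "reg v \<noteq> Suc (2 * n)" for v n by simp
  have m2: "m2 = m(2 * a + 1 := 0, 2 * b + 1 := 1)"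
    using ne'[of y] ab c by (simp add: m1_def m2_def)
  have m3: "m3 = m2(reg_aux := if a = b then 1 else 0)"
    using ne'[of x] ab unfolding m3_def m2 by auto
  have "represents m3 \<sigma>"
    unfolding m3 m2 by (intro represents_aux represents_scratch m) auto
  moreover have "runs (if a = b then P else P') \<sigma> (\<lambda>t. Q (4 + t))"
    using assms(3,4) xy by auto
  ultimately obtain t m' \<sigma>' where
    t: "ram_exec (if a = b then P else P') (m3, i, os) t (m', i, os)" "represents m' \<sigma>'" "Q (4 + t) \<sigma>'"
    unfolding runs_def runs_io_def by metis
  have "ram_exec (if m3 reg_aux \<noteq> 0 then P else P') (m3, i, os) t (m', i, os)"
    using t(1) by (cases "a = b") (simp_all add: m3)
  then have "ram_exec (if_same x y P P') (m, i, os) (1 + (1 + (1 + (1 + t)))) (m', i, os)"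
    unfolding if_same_def m3_def m2_def m1_def
    by - (rule exec_Seq exec_Store exec_Load exec_branch | assumption)+
  moreover have "1 + (1 + (1 + (1 + t))) = 4 + t" by simp
  ultimately show "\<exists>t m' \<sigma>' i' os'. ram_exec (if_same x y P P') (m, i, os) t (m', i', os') \<and>
      represents m' \<sigma>' \<and> i' = i \<and> os' = os \<and> Q t \<sigma>'"
    using t(2,3) by metis
qed

text \<open>
  The branches are entered with an unpredictable content of the auxiliary register.
\<close>

lemma exec_if_aux:
  assumes "\<And>b. \<exists>t m'. ram_exec (if m reg_aux = n then P else P') (m(reg_aux := b), i, os) t (m', i, os) \<and> R t m'"
  shows "\<exists>t m' d. ram_exec (if_aux n P P') (m, i, os) (d + t) (m', i, os) \<and> d \<le> 2 * n + 1 \<and> R t m'"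
  using assms
proof (induction n arbitrary: m)
  case 0
  from 0[of "m reg_aux"] obtain t m' where
    *: "ram_exec (if m reg_aux = 0 then P else P') (m, i, os) t (m', i, os)" "R t m'"
    by (auto simp: fun_upd_idem)
  have "ram_exec (if m reg_aux \<noteq> 0 then P' else P) (m, i, os) t (m', i, os)"
    using *(1) by (simp split: if_splits)
  from exec_branch[OF this] have "ram_exec (if_aux 0 P P') (m, i, os) (1 + t) (m', i, os)"
    by simp
  then show ?case using *(2) by (intro exI[of _ t] exI[of _ m'] exI[of _ 1]) auto
next
  case (Suc n)
  show ?case
  proof (cases "m reg_aux")
    case 0
    from Suc.prems[of "m reg_aux"] obtain t m' where
      *: "ram_exec P' (m, i, os) t (m', i, os)" "R t m'"
      using 0 by (auto simp: fun_upd_idem)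
    have "ram_exec (if_aux (Suc n) P P') (m, i, os) (1 + t) (m', i, os)"
      unfolding if_aux.simps by (rule exec_branch) (use * 0 in simp)
    then show ?thesis using *(2) by (intro exI[of _ t] exI[of _ m'] exI[of _ 1]) auto
  next
    case (Suc a)
    let ?m = "m(reg_aux := m reg_aux - 1)"
    obtain t m' d where *: "ram_exec (if_aux n P P') (?m, i, os) (d + t) (m', i, os)"
      "d \<le> 2 * n + 1" "R t m'"
    proof -
      have "\<exists>t m'. ram_exec (if ?m reg_aux = n then P else P') (?m(reg_aux := b), i, os) t (m', i, os)
          \<and> R t m'" for b
        using Suc.prems[of b] Suc unfolding fun_upd_upd by (cases "a = n") (simp_all add: fun_upd_def)
      from Suc.IH[OF this] show ?thesis using that by blast
    qed
    have "ram_exec (if_aux (Suc n) P P') (m, i, os) (1 + (1 + (d + t))) (m', i, os)"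
      unfolding if_aux.simps using exec_Seq[OF exec_Dec *(1)] Suc
      by (intro exec_branch) simp
    moreover have "1 + (1 + (d + t)) = (d + 2) + t" by simp
    ultimately show ?thesis using *(2,3) by (intro exI[of _ t] exI[of _ m'] exI[of _ "d + 2"]) auto
  qed
qed

text \<open>
  How long the comparison takes depends on the number in \<open>x\<close>, so the postcondition has to hold for every delay up
  to a bound.
\<close>

lemma runs_if_raw:
  assumes "is_Raw (\<sigma> x)"
    "\<sigma> x = Raw n \<Longrightarrow> runs P \<sigma> (\<lambda>t \<sigma>'. \<forall>d\<le>2 * n + 2. Q (d + t) \<sigma>')"
    "\<sigma> x \<noteq> Raw n \<Longrightarrow> runs P' \<sigma> (\<lambda>t \<sigma>'. \<forall>d\<le>2 * n + 2. Q (d + t) \<sigma>')"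
  shows "runs (if_raw x n P P') \<sigma> Q"
  unfolding runs_def runs_io_def
proof (intro allI impI)
  fix i os m assume m: "represents m \<sigma>"
  obtain a where a: "\<sigma> x = Raw a" using assms(1) by (auto simp: is_Raw_def)
  let ?m = "m(reg_aux := m (reg x))"
  let ?R = "\<lambda>t m'. \<exists>\<sigma>'. represents m' \<sigma>' \<and> (\<forall>d\<le>2 * n + 2. Q (d + t) \<sigma>')"
  have "runs (if a = n then P else P') \<sigma> (\<lambda>t \<sigma>'. \<forall>d\<le>2 * n + 2. Q (d + t) \<sigma>')"
    using assms(2,3) a by auto
  then have "\<exists>t m'. ram_exec (if a = n then P else P') (m(reg_aux := b), i, os) t (m', i, os) \<and> ?R t m'"
    for b
    using represents_aux[OF m, of b] unfolding runs_def runs_io_def by metis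
  then have "\<exists>t m'. ram_exec (if ?m reg_aux = n then P else P') (?m(reg_aux := b), i, os) t (m', i, os) \<and> ?R t m'"
    for b
    using represents_Raw[OF m a] by simp
  from exec_if_aux[of ?m n P P' i os ?R, OF this]
  obtain t m' d \<sigma>' where *: "ram_exec (if_aux n P P') (?m, i, os) (d + t) (m', i, os)"
      "d \<le> 2 * n + 1" "represents m' \<sigma>'" "\<forall>d\<le>2 * n + 2. Q (d + t) \<sigma>'"
    by blast
  have "ram_exec (if_raw x n P P') (m, i, os) (1 + (d + t)) (m', i, os)"
    unfolding if_raw_def by (rule exec_Seq[OF exec_Copy *(1)])
  moreover have "Q (1 + (d + t)) \<sigma>'" using *(2,4) by (metis add.assoc add.commute add_2_eq_Suc' le_add1 nat_add_left_cancel_le Suc_eq_plus1 add_Suc_right not_less_eq_eq)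
  ultimately show "\<exists>t m' \<sigma>' i' os'. ram_exec (if_raw x n P P') (m, i, os) t (m', i', os') \<and>
      represents m' \<sigma>' \<and> i' = i \<and> os' = os \<and> Q t \<sigma>'"
    using *(3) by blast
qed

lemma runs_io_Read:
  assumes "Q 1 (\<sigma>(x := Raw (case i of [] \<Rightarrow> 0 | a # _ \<Rightarrow> a))) (tl i) os"
  shows "runs_io (Read (reg x)) \<sigma> i os Q"
  unfolding runs_io_def
proof (intro allI impI)
  fix m assume m: "represents m \<sigma>"
  let ?a = "case i of [] \<Rightarrow> 0 | a # _ \<Rightarrow> a"
  have "ram_exec (Read (reg x)) (m, i, os) 1 (m(reg x := ?a), tl i, os)"
    using exec_Read exec_Read_end by (cases i) simp_all
  moreover have "represents (m(reg x := ?a)) (\<sigma>(x := Raw ?a))"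
    by (rule represents_set[OF m]) auto
  ultimately show "\<exists>t m' \<sigma>' i' os'. ram_exec (Read (reg x)) (m, i, os) t (m', i', os') \<and>
      represents m' \<sigma>' \<and> Q t \<sigma>' i' os'"
    using assms by blast
qed

lemma runs_io_Print:
  assumes "\<sigma> x = Raw a" "Q 1 \<sigma> i (os @ [a])"
  shows "runs_io (Print (reg x)) \<sigma> i os Q"
  unfolding runs_io_def
proof (intro allI impI)
  fix m assume m: "represents m \<sigma>"
  then have "m (reg x) = a" using assms(1) by (rule represents_Raw)
  then have "ram_exec (Print (reg x)) (m, i, os) 1 (m, i, os @ [a])"
    using exec_Print[of "reg x" m i os] by simp
  then show "\<exists>t m' \<sigma>' i' os'. ram_exec (Print (reg x)) (m, i, os) t (m', i', os') \<and>
      represents m' \<sigma>' \<and> Q t \<sigma>' i' os'"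
    using assms m by blast
qed

definition "initialize = Seq (Const reg_one 1) (Const reg_free heap_base)"

lemma exec_initialize:
  "\<exists>m. ram_exec initialize (\<lambda>_. 0, i, os) 2 (m, i, os) \<and> represents m (\<lambda>_. Raw 0)"
proof -
  let ?m = "(\<lambda>_. 0)(reg_one := 1, reg_free := heap_base)"
  have "ram_exec initialize (\<lambda>_. 0, i, os) (1 + 1) (?m, i, os)"
    unfolding initialize_def by (rule exec_Seq exec_Const)+
  moreover have "reg x \<noteq> 2" "reg x \<noteq> 4" for x using reg_bounds(1)[of x] by auto
  then have "represents ?m (\<lambda>_. Raw 0)"
    by (auto simp: represents_def)
  ultimately show ?thesis by (auto simp: numeral_2_eq_2)
qed

subsection \<open>Lists\<close>

fun vlist :: "val list \<Rightarrow> val" where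
  "vlist [] = Raw 0"
| "vlist (v # vs) = Branch v (vlist vs)"

definition word_tree :: "('l \<Rightarrow> nat) \<Rightarrow> 'l list \<Rightarrow> val" where
  "word_tree c u = vlist (map (\<lambda>b. Raw (c b)) u)"

text \<open>
  In the invariant \<open>I\<close>, the list argument consists of the elements already processed.
\<close>

lemma runs_foreach:
  assumes body: "\<And>before v after \<sigma>. vs = before @ v # after \<Longrightarrow> I before \<sigma> \<Longrightarrow>
      \<sigma> x = Branch v (vlist after) \<Longrightarrow>
      runs body \<sigma> (\<lambda>t \<sigma>'. t \<le> c \<and> I (before @ [v]) \<sigma>' \<and> \<sigma>' x = vlist after)"
    and "I [] \<sigma>" "\<sigma> x = vlist vs"
  shows "runs (WhileNZ (reg x) body) \<sigma>
    (\<lambda>t \<sigma>'. t \<le> length vs * (c + 1) + 1 \<and> I vs \<sigma>' \<and> \<sigma>' x = Raw 0)"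
proof -
  have "runs (WhileNZ (reg x) body) \<sigma>
      (\<lambda>t \<sigma>'. t \<le> length after * (c + 1) + 1 \<and> I vs \<sigma>' \<and> \<sigma>' x = Raw 0)"
    if "vs = before @ after" "I before \<sigma>" "\<sigma> x = vlist after" for before after \<sigma>
    using that
  proof (induction after arbitrary: before \<sigma>)
    case Nil
    then show ?case by (intro runs_While_zero) auto
  next
    case (Cons v after)
    show ?case
    proof (rule runs_While_nonzero)
      show "runs body \<sigma> (\<lambda>t \<sigma>'. runs (WhileNZ (reg x) body) \<sigma>' (\<lambda>t' \<sigma>''. 1 + t + t' \<le> length (v # after) * (c + 1) + 1 \<and> I vs \<sigma>'' \<and> \<sigma>'' x = Raw 0))"
      proof (rule runs_conseq[OF body[of before v after]])
        fix t \<sigma>' assume *: "t \<le> c \<and> I (before @ [v]) \<sigma>' \<and> \<sigma>' x = vlist after"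
        show "runs (WhileNZ (reg x) body) \<sigma>' (\<lambda>t' \<sigma>''. 1 + t + t' \<le> length (v # after) * (c + 1) + 1 \<and> I vs \<sigma>'' \<and> \<sigma>'' x = Raw 0)"
          by (rule runs_conseq[OF Cons.IH[of "before @ [v]"]]) (use * Cons.prems in auto)
      qed (use Cons.prems in auto)
    qed (use Cons.prems in auto)
  qed
  from this[of "[]" vs \<sigma>] assms(2,3) show ?thesis by auto
qed

lemmas straight_line = runs_Seq runs_Skip runs_set_raw runs_set_num runs_move runs_inc_num
  runs_dec_num runs_head runs_tail runs_new_branch runs_if_same runs_If

section \<open>Looking up and adding configurations\<close>

definition frame :: "var set \<Rightarrow> store \<Rightarrow> store \<Rightarrow> bool" where
  "frame S \<sigma> \<sigma>' \<longleftrightarrow> (\<forall>x. x \<notin> S \<longrightarrow> \<sigma>' x = \<sigma> x)"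

lemma frame_refl: "frame S \<sigma> \<sigma>"
  by (simp add: frame_def)

lemma frame_trans: "frame S \<sigma> \<sigma>' \<Longrightarrow> frame S' \<sigma>' \<sigma>'' \<Longrightarrow> S \<union> S' \<subseteq> S'' \<Longrightarrow> frame S'' \<sigma> \<sigma>''"
  unfolding frame_def by (metis UnCI subsetD)

abbreviation nums :: "nat list \<Rightarrow> val" where
  "nums ns \<equiv> vlist (map Num ns)"

definition "same_loop =
  WhileNZ (reg Lhs) (Seq (head First Lhs) (Seq (head Second Rhs)
    (Seq (if_same First Second Skip (set_raw Same 0))
    (Seq (tail Lhs Lhs) (tail Rhs Rhs)))))"

lemma same_loop_runs:
  assumes "length as = length bs" "\<sigma> Lhs = nums as" "\<sigma> Rhs = nums bs" "\<sigma> Same = Raw s"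
  shows "runs same_loop \<sigma> (\<lambda>t \<sigma>'. t \<le> 20 * length as + 1 \<and>
    \<sigma>' Same = Raw (if as = bs then s else 0) \<and> frame {Lhs, Rhs, Same, First, Second} \<sigma> \<sigma>')"
  using assms
proof (induction as bs arbitrary: \<sigma> s rule: list_induct2)
  case Nil
  then show ?case unfolding same_loop_def by (intro runs_While_zero) (auto simp: frame_refl)
next
  case (Cons a as b bs)
  show ?case
    unfolding same_loop_def
    apply (rule runs_While_nonzero)
    using Cons.prems apply simp
    unfolding same_loop_def[symmetric]
    apply (intro straight_line)
    using Cons.prems apply (simp_all split del: if_split)
    subgoal
      by (rule runs_conseq[OF Cons.IH[where s = s]]) (auto simp: frame_def)
    subgoal
      by (rule runs_conseq[OF Cons.IH[where s = 0]]) (auto simp: frame_def split: if_splits)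
    done
qed

definition "reverse_loop =
  WhileNZ (reg Tmp) (Seq (head First Tmp) (Seq (new_branch Cand First Cand) (tail Tmp Tmp)))"

lemma reverse_loop_runs:
  assumes "\<sigma> Tmp = vlist vs" "\<sigma> Cand = vlist ws"
  shows "runs reverse_loop \<sigma> (\<lambda>t \<sigma>'. t \<le> 14 * length vs + 1 \<and>
    \<sigma>' Cand = vlist (rev vs @ ws) \<and> frame {Tmp, Cand, First} \<sigma> \<sigma>')"
  using assms
proof (induction vs arbitrary: \<sigma> ws)
  case Nil
  then show ?case unfolding reverse_loop_def by (intro runs_While_zero) (auto simp: frame_refl)
next
  case (Cons v vs)
  show ?case
    unfolding reverse_loop_def
    apply (rule runs_While_nonzero)
    using Cons.prems apply simp
    unfolding reverse_loop_def[symmetric]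
    apply (intro straight_line)
    using Cons.prems apply simp_all
    by (rule runs_conseq[OF Cons.IH[where ws = "v # ws"]]) (auto simp: frame_def)
qed

fun build_nums :: "nat list \<Rightarrow> ram" where
  "build_nums [] = set_raw Cand 0"
| "build_nums (n # ns) = Seq (build_nums ns) (Seq (set_num First n) (new_branch Cand First Cand))"

lemma build_nums_runs:
  "runs (build_nums ns) \<sigma> (\<lambda>t \<sigma>'. t \<le> 9 * length ns + 1 \<and> \<sigma>' Cand = nums ns \<and>
    frame {Cand, First} \<sigma> \<sigma>')"
proof (induction ns arbitrary: \<sigma>)
  case Nil
  show ?case by (auto intro!: straight_line simp: frame_def)
next
  case (Cons n ns)
  show ?case
    unfolding build_nums.simps
    apply (rule runs_Seq)
    apply (rule runs_conseq[OF Cons.IH])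
    apply (intro straight_line)
    by (auto simp: frame_def)
qed

subsection \<open>Counters\<close>

text \<open>
  A counter is stored as its positive and its negative part. Then each test is a comparison with zero,
  and increments and decrements never leave the natural numbers.
\<close>

fun encode_counters :: "int list \<Rightarrow> nat list" where
  "encode_counters [] = []"
| "encode_counters (c # cs) = nat c # nat (- c) # encode_counters cs"

fun encode :: "config \<Rightarrow> nat list" where
  "encode (s, cs) = s # encode_counters cs"

lemma length_encode_counters: "length (encode_counters cs) = 2 * length cs"
  by (induction cs) auto

lemma length_encode: "length (encode c) = 2 * length (snd c) + 1"
  by (cases c) (simp add: length_encode_counters)

lemma encode_counters_inject: "encode_counters cs = encode_counters ds \<longleftrightarrow> cs = ds"
proof (induction cs arbitrary: ds)
  case Nil
  then show ?case by (cases ds) auto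
next
  case (Cons c cs)
  have "b = int (nat b) - int (nat (- b))" for b by simp
  then have "nat c = nat d \<and> nat (- c) = nat (- d) \<longleftrightarrow> c = d" for d
    by metis
  with Cons show ?case by (cases ds) (simp_all, metis)
qed

lemma encode_inject: "encode c = encode d \<longleftrightarrow> c = d"
  by (cases c; cases d) (simp add: encode_counters_inject)

abbreviation (input) "reject \<equiv> set_raw Ok 0"

fun test_prog :: "counter_test \<Rightarrow> ram" where
  "test_prog No_Test = Skip"
| "test_prog Is_Zero =
     if_same First Zero (if_same Second Zero Skip reject) reject"
| "test_prog Is_Nonzero =
     if_same First Zero (if_same Second Zero reject Skip) Skip"
| "test_prog Is_Pos = if_same First Zero reject Skip"
| "test_prog Is_Neg = if_same Second Zero reject Skip"

fun op_prog :: "counter_op \<Rightarrow> ram" where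
  "op_prog Keep = Skip"
| "op_prog Incr = if_same Second Zero (inc_num First) (dec_num Second)"
| "op_prog Decr = if_same First Zero (inc_num Second) (dec_num First)"
| "op_prog Reset = Seq (set_num First 0) (set_num Second 0)"

lemma test_prog_runs:
  assumes "\<sigma> First = Num (nat c)" "\<sigma> Second = Num (nat (- c))" "\<sigma> Zero = Num 0" "\<sigma> Ok = Raw b"
  shows "runs (test_prog test) \<sigma> (\<lambda>t \<sigma>'. t \<le> 10 \<and>
    \<sigma>' = \<sigma>(Ok := Raw (if passes test c then b else 0)))"
  using assms by (cases test) (auto intro!: straight_line)

lemma op_prog_runs:
  assumes "\<sigma> First = Num (nat c)" "\<sigma> Second = Num (nat (- c))" "\<sigma> Zero = Num 0"
  shows "runs (op_prog op) \<sigma> (\<lambda>t \<sigma>'. t \<le> 10 \<and>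
    \<sigma>' = \<sigma>(First := Num (nat (apply_op op c)), Second := Num (nat (- apply_op op c))))"
  using assms by (cases op) (auto intro!: straight_line simp: fun_eq_iff nat_add_distrib nat_diff_distrib)

text \<open>
  The new counters are pushed on a stack in \<open>Tmp\<close>, so they end up in reverse order; \<open>reverse_loop\<close> restores it.
\<close>

fun counters_prog :: "counter_test list \<Rightarrow> counter_op list \<Rightarrow> ram" where
  "counters_prog (test # tests) (op # ops) =
     Seq (head First Cfg) (Seq (tail Cfg Cfg) (Seq (head Second Cfg) (Seq (tail Cfg Cfg)
     (Seq (test_prog test) (Seq (op_prog op)
     (Seq (new_branch Tmp First Tmp) (Seq (new_branch Tmp Second Tmp)
     (counters_prog tests ops))))))))"
| "counters_prog _ _ = Skip"

lemma counters_prog_runs: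
  assumes "length tests = length cs" "length cs = length ops"
    "\<sigma> Cfg = nums (encode_counters cs)" "\<sigma> Zero = Num 0" "\<sigma> Ok = Raw b"
    "\<sigma> Tmp = vlist vs"
  shows "runs (counters_prog tests ops) \<sigma> (\<lambda>t \<sigma>'. t \<le> 46 * length cs + 1 \<and>
    \<sigma>' Ok = Raw (if list_all2 passes tests cs then b else 0) \<and>
    \<sigma>' Tmp = vlist (rev (map Num (encode_counters (map2 apply_op ops cs))) @ vs) \<and>
    frame {Ok, Tmp, Cfg, First, Second} \<sigma> \<sigma>')"
  using assms
proof (induction tests cs ops arbitrary: \<sigma> b vs rule: list_induct3)
  case Nil
  then show ?case by (auto intro!: straight_line simp: frame_def)
next
  case (Cons test tests c cs op ops)
  let ?c = "apply_op op c"
  show ?case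
    unfolding counters_prog.simps
    apply (intro straight_line)
    using Cons.prems apply (simp_all split del: if_split)
    apply (rule runs_conseq[OF test_prog_runs[where c = c and b = b]])
        apply (simp_all add: Cons.prems split del: if_split)
    apply (rule runs_Seq)
    apply (rule runs_conseq[OF op_prog_runs[where c = c]])
       apply (simp_all add: Cons.prems split del: if_split)
    apply (intro straight_line)
    apply (rule runs_conseq[OF Cons.IH[where b = "if passes test c then b else 0" and
            vs = "Num (nat (- ?c)) # Num (nat ?c) # vs"]])
    by (auto simp: Cons.prems frame_def split: if_splits)
qed

subsection \<open>Histories\<close>

text \<open>
  A history lists the configurations of a computation, the latest first. Each comes with the symbol of
  the second tape that was read on entering it.
\<close>

type_synonym 'o history = "(config \<times> 'o) list"

abbreviation (input) conf :: "'o history \<Rightarrow> config" where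
  "conf h \<equiv> fst (hd h)"

fun hist_val :: "('o \<Rightarrow> nat) \<Rightarrow> 'o history \<Rightarrow> val" where
  "hist_val code [] = Raw 0"
| "hist_val code ((c, out) # h) =
     Branch (nums (encode c)) (Branch (Raw (code out)) (hist_val code h))"

abbreviation layer_val :: "('o \<Rightarrow> nat) \<Rightarrow> 'o history list \<Rightarrow> val" where
  "layer_val code hs \<equiv> vlist (map (hist_val code) hs)"

definition proper :: "nat \<Rightarrow> 'o history \<Rightarrow> bool" where
  "proper k h \<longleftrightarrow> h \<noteq> [] \<and> length (snd (conf h)) = k"

lemma hist_val_proper:
  assumes "proper k h"
  obtains w where "hist_val code h = Branch (nums (encode (conf h))) w"
  using assms by (cases h) (auto simp: proper_def)

definition "lookup_body =
  Seq (head Item Scan) (Seq (head Lhs Item) (Seq (move Rhs Cand) (Seq (set_raw Same 1)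
  (Seq same_loop (Seq (IfNZ (reg Same) (move Found Item) Skip) (tail Scan Scan))))))"

definition "lookup_prog = Seq (move Scan New) (Seq (set_raw Found 0) (WhileNZ (reg Scan) lookup_body))"

abbreviation "lookup_vars \<equiv> {Scan, Found, Lhs, Rhs, Same, Item, First, Second}"

lemma lookup_prog_runs:
  assumes "\<sigma> New = layer_val code hs" "\<forall>h\<in>set hs. proper k h" "\<sigma> Cand = nums (encode c)"
    "length (snd c) = k"
  shows "runs lookup_prog \<sigma> (\<lambda>t \<sigma>'. t \<le> (40 * k + 50) * (length hs + 1) \<and>
    frame lookup_vars \<sigma> \<sigma>' \<and>
    (\<sigma>' Found = Raw 0 \<and> c \<notin> conf ` set hs \<or>
     (\<exists>h\<in>set hs. conf h = c \<and> \<sigma>' Found = hist_val code h)))"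
proof -
  \<comment> \<open>Distinct histories may have the same configuration, so the invariant cannot name
    the history that is found.\<close>
  define I where "I = (\<lambda>before \<sigma>'. frame lookup_vars \<sigma> \<sigma>' \<and>
    (\<sigma>' Found = Raw 0 \<and> (\<forall>h\<in>set hs. hist_val code h \<in> set before \<longrightarrow> conf h \<noteq> c) \<or>
     (\<exists>h\<in>set hs. conf h = c \<and> \<sigma>' Found = hist_val code h)))"
  have body: "runs lookup_body \<sigma>' (\<lambda>t \<sigma>''. t \<le> 40 * k + 40 \<and> I (before @ [v]) \<sigma>'' \<and> \<sigma>'' Scan = vlist after)"
    if split: "map (hist_val code) hs = before @ v # after" and I: "I before \<sigma>'"
      and scan: "\<sigma>' Scan = Branch v (vlist after)" for before v after \<sigma>'
  proof -
    from split have "v \<in> set (map (hist_val code) hs)" by simp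
    then obtain h where h: "h \<in> set hs" "v = hist_val code h" by auto
    have hk: "length (snd (conf h)) = k" using assms(2) h(1) by (auto simp: proper_def)
    obtain w where w: "hist_val code h = Branch (nums (encode (conf h))) w"
      using assms(2) h(1) hist_val_proper by metis
    have cand: "\<sigma>' Cand = nums (encode c)" using I assms(3) by (simp add: I_def frame_def)
    have I': "I (before @ [v]) \<tau>"
      if "\<tau> Found = (if conf h = c then v else \<sigma>' Found)" "frame lookup_vars \<sigma>' \<tau>" for \<tau>
    proof -
      have fr: "frame lookup_vars \<sigma> \<tau>"
        using I that(2) unfolding I_def by (auto intro: frame_trans)
      show ?thesis
      proof (cases "conf h = c")
        case True
        then show ?thesis using fr that(1) h unfolding I_def by auto
      next
        case False
        have "conf h' \<noteq> c" if "h' \<in> set hs" "hist_val code h' = v" for h'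
        proof -
          have "nums (encode (conf h')) = nums (encode (conf h))"
            using that h assms(2) hist_val_proper w by (metis val.inject(3))
          moreover have "nums xs = nums ys \<Longrightarrow> xs = ys" for xs ys
            by (induction xs arbitrary: ys) (case_tac ys; simp)+
          ultimately have "conf h' = conf h" using encode_inject by blast
          with False show ?thesis by simp
        qed
        with False fr that(1) I show ?thesis unfolding I_def by auto
      qed
    qed
    show ?thesis
      unfolding lookup_body_def
      apply (intro straight_line)
      using scan h w apply simp_all
      apply (rule runs_conseq[OF same_loop_runs[where as = "encode (conf h)" and bs = "encode c" and s = 1]])
          apply (simp_all add: cand length_encode hk assms(4) encode_inject split del: if_split)
      apply (intro straight_line)
         apply (simp_all add: frame_def)
       apply (rule I'[unfolded h(2) w]; auto simp: frame_def split: if_splits)+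
      done
  qed
  show ?thesis
    unfolding lookup_prog_def
    apply (intro straight_line)
    apply (rule runs_conseq[OF runs_foreach[where vs = "map (hist_val code) hs" and I = I and c = "40 * k + 40"]])
    apply (rule body)
    apply (simp_all add: assms(1))
    apply (simp add: I_def frame_def)
    by (auto simp: I_def algebra_simps)
qed

definition "apply_ops_prog tests ops q =
  Seq (counters_prog tests ops) (Seq (set_raw Cand 0)
  (Seq reverse_loop (Seq (set_num First q) (new_branch Cand First Cand))))"

definition "candidate_prog p tests ops q =
  Seq (head Cfg Node) (Seq (head First Cfg) (Seq (tail Cfg Cfg) (Seq (set_num Second p)
  (Seq (if_same First Second (set_raw Ok 1) (set_raw Ok 0)) (Seq (set_num Zero 0)
  (Seq (set_raw Tmp 0) (apply_ops_prog tests ops q)))))))"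

abbreviation "candidate_vars \<equiv> {Cfg, First, Second, Ok, Zero, Tmp, Cand}"

lemma candidate_prog_runs:
  assumes "\<sigma> Node = Branch (nums (encode (s, cs))) w"
    "length tests = length cs" "length cs = length ops"
  shows "runs (candidate_prog p tests ops q) \<sigma> (\<lambda>t \<sigma>'. t \<le> 80 * length cs + 60 \<and>
    \<sigma>' Cand = nums (encode (q, map2 apply_op ops cs)) \<and>
    \<sigma>' Ok = Raw (if s = p \<and> list_all2 passes tests cs then 1 else 0) \<and>
    frame candidate_vars \<sigma> \<sigma>')"
proof -
  note rev = reverse_loop_runs[where ws = "[]" and
      vs = "rev (map Num (encode_counters (map2 apply_op ops cs)))"]
  have len: "length (encode_counters (map2 apply_op ops cs)) = 2 * length cs"
    using assms(3) by (simp add: length_encode_counters)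
  have rest: "runs (apply_ops_prog tests ops q) \<tau>
    (\<lambda>t \<sigma>'. t \<le> 80 * length cs + 30 \<and>
    \<sigma>' Cand = nums (encode (q, map2 apply_op ops cs)) \<and>
    \<sigma>' Ok = Raw (if list_all2 passes tests cs then b else 0) \<and>
    frame candidate_vars \<tau> \<sigma>')"
    if "\<tau> Ok = Raw b" "\<tau> Cfg = nums (encode_counters cs)" "\<tau> Zero = Num 0" "\<tau> Tmp = Raw 0" for \<tau> b
    unfolding apply_ops_prog_def
    apply (intro straight_line)
    apply (rule runs_conseq[OF counters_prog_runs[where vs = "[]" and b = b, OF assms(2,3)]])
        apply (simp_all add: that split del: if_split)
    apply (intro straight_line)
    apply (rule runs_conseq[OF rev])
      apply (simp_all split del: if_split)
    apply (intro straight_line)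
    by (auto simp: frame_def len split del: if_split)
  show ?thesis
    unfolding candidate_prog_def
    apply (intro straight_line; (simp add: assms(1) split del: if_split)?)
    subgoal by (rule runs_conseq[OF rest[where b = 1]]) (auto simp: frame_def)
    subgoal by (rule runs_conseq[OF rest[where b = 0]]) (auto simp: frame_def split: if_splits)
    done
qed

text \<open>
  Only one history is kept for each configuration: any of them will do, and without
  this the layers could grow exponentially.
\<close>

definition add_history :: "config \<Rightarrow> 'o \<Rightarrow> 'o history \<Rightarrow> 'o history list \<Rightarrow> 'o history list" where
  "add_history c out h hs = (if c \<in> conf ` set hs then hs else ((c, out) # h) # hs)"

definition "add_prog code out = Seq lookup_prog (IfNZ (reg Found) Skip
  (Seq (set_raw Letter (code out)) (Seq (new_branch First Letter Node)
  (Seq (new_branch First Cand First) (new_branch New First New)))))"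

lemma add_prog_runs:
  assumes "\<sigma> New = layer_val code hs" "\<forall>h\<in>set hs. proper k h" "\<sigma> Cand = nums (encode c)"
    "length (snd c) = k" "\<sigma> Node = hist_val code h"
  shows "runs (add_prog code out) \<sigma> (\<lambda>t \<sigma>'. t \<le> (40 * k + 80) * (length hs + 1) \<and>
    \<sigma>' New = layer_val code (add_history c out h hs) \<and>
    frame (lookup_vars \<union> {New, Letter}) \<sigma> \<sigma>')"
proof -
  have nz: "nonzero (hist_val code h)" if "h \<in> set hs" for h
    using assms(2) that by (metis hist_val_proper nonzero.simps(3))
  obtain x cs where c: "c = (x, cs)" by (cases c)
  show ?thesis
    unfolding add_prog_def
    apply (rule runs_Seq)
    apply (rule runs_conseq[OF lookup_prog_runs[OF assms(1-4)]])
    apply (intro straight_line)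
    subgoal using nz assms(1) by (auto simp: frame_def add_history_def algebra_simps)
    subgoal using nz assms by (auto simp: frame_def add_history_def algebra_simps c)
    done
qed

section \<open>Layers of configurations\<close>

fun fire :: "'a transition \<Rightarrow> config \<Rightarrow> config option" where
  "fire (p, a, tests, ops, q) (s, cs) =
     (if s = p \<and> list_all2 passes tests cs then Some (q, map2 apply_op ops cs) else None)"

abbreviation (input) label :: "'a transition \<Rightarrow> 'a option" where
  "label \<tau> \<equiv> fst (snd \<tau>)"

definition enabled :: "'o \<Rightarrow> ('o \<times> 'o) transition \<Rightarrow> bool" where
  "enabled a \<tau> \<longleftrightarrow> (case label \<tau> of None \<Rightarrow> True | Some (x, y) \<Rightarrow> x = a)"

definition out :: "('l option \<times> 'l option) transition \<Rightarrow> 'l option" where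
  "out \<tau> = (case label \<tau> of None \<Rightarrow> None | Some (x, y) \<Rightarrow> y)"

text \<open>
  \<open>extend_by\<close> performs one move from one history, \<open>extend_layer\<close> all moves from one history, and \<open>expand\<close>
  all moves from all histories of a layer. The symbol \<open>a\<close> is the current symbol of the first tape, which \<open>\<epsilon>\<close>-moves
  ignore.
\<close>

definition extend_by where
  "extend_by a h \<tau> hs = (case if enabled a \<tau> then fire \<tau> (conf h) else None of
     None \<Rightarrow> hs | Some c \<Rightarrow> add_history c (out \<tau>) h hs)"

definition extend_layer where
  "extend_layer a ts h hs = fold (extend_by a h) ts hs"

definition expand where
  "expand a ts old = fold (extend_layer a ts) old []"

lemma ca_step_fire: "ca_step M c a c' \<longleftrightarrow> (\<exists>\<tau>\<in>ca_trans M. label \<tau> = a \<and> fire \<tau> c = Some c')"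
proof
  assume "ca_step M c a c'"
  then show "\<exists>\<tau>\<in>ca_trans M. label \<tau> = a \<and> fire \<tau> c = Some c'"
  proof cases
    case (1 p tests ops q cs)
    then show ?thesis by (intro bexI[of _ "(p, a, tests, ops, q)"]) auto
  qed
next
  assume "\<exists>\<tau>\<in>ca_trans M. label \<tau> = a \<and> fire \<tau> c = Some c'"
  then show "ca_step M c a c'"
    by (cases c) (auto intro!: ca_step.intros split: if_splits)
qed

lemma extend_by_confs:
  "conf ` set (extend_by a h \<tau> hs) = conf ` set hs \<union> {c. enabled a \<tau> \<and> fire \<tau> (conf h) = Some c}"
  by (auto simp: extend_by_def add_history_def split: option.splits if_splits)

lemma extend_layer_confs:
  "conf ` set (extend_layer a ts h hs) =
     conf ` set hs \<union> {c. \<exists>\<tau>\<in>set ts. enabled a \<tau> \<and> fire \<tau> (conf h) = Some c}"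
  unfolding extend_layer_def
proof (induction ts arbitrary: hs)
  case (Cons \<tau> ts)
  show ?case by (simp add: Cons.IH extend_by_confs) auto
qed simp

text \<open>
  Dropping repetitions loses no configuration, since a history is dropped only if its configuration is
  present already.
\<close>

lemma expand_confs:
  "conf ` set (expand a ts old) =
     {c. \<exists>h\<in>set old. \<exists>\<tau>\<in>set ts. enabled a \<tau> \<and> fire \<tau> (conf h) = Some c}"
proof -
  have "conf ` set (fold (extend_layer a ts) old hs) =
     conf ` set hs \<union> {c. \<exists>h\<in>set old. \<exists>\<tau>\<in>set ts. enabled a \<tau> \<and> fire \<tau> (conf h) = Some c}" for hs
  proof (induction old arbitrary: hs)
    case (Cons h old)
    show ?case by (simp add: Cons.IH extend_layer_confs) auto
  qed simp
  then show ?thesis unfolding expand_def by simp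
qed

lemma extend_by_cases:
  assumes "h' \<in> set (extend_by a h \<tau> hs)"
  obtains "h' \<in> set hs"
  | c where "enabled a \<tau>" "fire \<tau> (conf h) = Some c" "h' = (c, out \<tau>) # h"
  using assms by (auto simp: extend_by_def add_history_def split: option.splits if_splits)

lemma extend_layer_cases:
  assumes "h' \<in> set (extend_layer a ts h hs)"
  obtains "h' \<in> set hs"
  | \<tau> c where "\<tau> \<in> set ts" "enabled a \<tau>" "fire \<tau> (conf h) = Some c" "h' = (c, out \<tau>) # h"
proof -
  have "h' \<in> set hs \<or> (\<exists>\<tau>\<in>set ts. \<exists>c. enabled a \<tau> \<and> fire \<tau> (conf h) = Some c \<and> h' = (c, out \<tau>) # h)"
    using assms unfolding extend_layer_def
  proof (induction ts arbitrary: hs)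
    case (Cons \<tau> ts)
    from Cons.prems have "h' \<in> set (fold (extend_by a h) ts (extend_by a h \<tau> hs))" by simp
    from Cons.IH[OF this] show ?case by (auto elim: extend_by_cases)
  qed simp
  then show ?thesis using that by blast
qed

lemma expand_cases:
  assumes "h' \<in> set (expand a ts old)"
  obtains h \<tau> c where "h \<in> set old" "\<tau> \<in> set ts" "enabled a \<tau>" "fire \<tau> (conf h) = Some c"
    "h' = (c, out \<tau>) # h"
proof -
  have "h' \<in> set hs \<or> (\<exists>h\<in>set old. \<exists>\<tau>\<in>set ts. \<exists>c. enabled a \<tau> \<and> fire \<tau> (conf h) = Some c \<and>
      h' = (c, out \<tau>) # h)" if "h' \<in> set (fold (extend_layer a ts) old hs)" for hs
    using that
  proof (induction old arbitrary: hs)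
    case (Cons h old)
    from Cons.prems have "h' \<in> set (fold (extend_layer a ts) old (extend_layer a ts h hs))" by simp
    from Cons.IH[OF this] show ?case
    proof (elim disjE)
      assume "h' \<in> set (extend_layer a ts h hs)"
      then show ?thesis
      proof (cases rule: extend_layer_cases)
        case (2 \<tau> c)
        then have "\<exists>\<tau>\<in>set ts. \<exists>c. enabled a \<tau> \<and> fire \<tau> (conf h) = Some c \<and> h' = (c, out \<tau>) # h"
          by blast
        then show ?thesis unfolding list.set(2) bex_simps by blast
      qed blast
    next
      assume "\<exists>h\<in>set old. \<exists>\<tau>\<in>set ts. \<exists>c. enabled a \<tau> \<and> fire \<tau> (conf h) = Some c \<and>
        h' = (c, out \<tau>) # h"
      then show ?thesis unfolding list.set(2) bex_simps by blast
    qed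
  qed simp
  from this[of "[]"] show ?thesis using assms that unfolding expand_def by auto
qed

lemma distinct_extend_by: "distinct (map conf hs) \<Longrightarrow> distinct (map conf (extend_by a h \<tau> hs))"
  by (auto simp: extend_by_def add_history_def split: option.splits)

lemma distinct_extend: "distinct (map conf hs) \<Longrightarrow> distinct (map conf (extend_layer a ts h hs))"
  unfolding extend_layer_def by (induction ts arbitrary: hs) (simp_all add: distinct_extend_by)

lemma distinct_expand: "distinct (map conf (expand a ts old))"
proof -
  have "distinct (map conf hs) \<Longrightarrow> distinct (map conf (fold (extend_layer a ts) old hs))" for hs
    by (induction old arbitrary: hs) (simp_all add: distinct_extend)
  then show ?thesis unfolding expand_def by simp
qed

lemma length_extend_by: "length hs \<le> length (extend_by a h \<tau> hs)"
  by (auto simp: extend_by_def add_history_def split: option.splits)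

lemma length_extend: "length hs \<le> length (extend_layer a ts h hs)"
  unfolding extend_layer_def
proof (induction ts arbitrary: hs)
  case (Cons \<tau> ts)
  show ?case using le_trans[OF length_extend_by Cons.IH] by simp
qed simp

lemma length_fold_extend: "length hs \<le> length (fold (extend_layer a ts) old hs)"
proof (induction old arbitrary: hs)
  case (Cons h old)
  show ?case using le_trans[OF length_extend Cons.IH] by simp
qed simp

abbreviation somes :: "'a option list \<Rightarrow> 'a list" where
  "somes \<equiv> List.map_filter id"

lemma somes_append: "somes (xs @ ys) = somes xs @ somes ys"
  by (simp add: List.map_filter_def)

lemma somes_simps: "somes [] = []" "somes (None # xs) = somes xs" "somes (Some x # xs) = x # somes xs"
  by (simp_all add: List.map_filter_def)

lemma somes_map_Some: "somes (map Some xs) = xs"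
  by (induction xs) (simp_all add: somes_simps)

lemma somes_replicate_None: "somes (replicate n None) = []"
  by (induction n) (simp_all add: somes_simps)

lemma ca_path_Nil_iff: "ca_path M c [] d \<longleftrightarrow> d = c"
  by (auto intro: ca_path_Nil elim: ca_path.cases)

lemma ca_path_Cons_iff: "ca_path M c (a # as) d \<longleftrightarrow> (\<exists>e. ca_step M c a e \<and> ca_path M e as d)"
proof
  assume "ca_path M c (a # as) d"
  then show "\<exists>e. ca_step M c a e \<and> ca_path M e as d" by cases blast
next
  assume "\<exists>e. ca_step M c a e \<and> ca_path M e as d"
  then show "ca_path M c (a # as) d" by (blast intro: ca_path_Cons)
qed

lemma ca_path_append:
  "ca_path M c (as @ bs) d \<longleftrightarrow> (\<exists>e. ca_path M c as e \<and> ca_path M e bs d)"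
proof (induction as arbitrary: c)
  case Nil
  show ?case unfolding ca_path_Nil_iff append_Nil by blast
next
  case (Cons a as)
  show ?case unfolding append_Cons ca_path_Cons_iff Cons.IH by blast
qed

lemma ca_path_snoc:
  "ca_path M c (as @ [a]) d \<longleftrightarrow> (\<exists>e. ca_path M c as e \<and> ca_step M e a d)"
  unfolding ca_path_append ca_path_Cons_iff ca_path_Nil_iff by blast

text \<open>
  The first tape of every convolution with \<open>u\<close>.
\<close>

definition pad :: "'l list \<Rightarrow> nat \<Rightarrow> 'l option" where
  "pad u j = (if j < length u then Some (u ! j) else None)"

lemma map_pad:
  assumes "length u \<le> n"
  shows "map (pad u) [0..<n] = map Some u @ replicate (n - length u) None"
  using assms by (intro nth_equalityI) (auto simp: pad_def nth_append)

lemma somes_pad: "length u \<le> n \<Longrightarrow> somes (map (pad u) [0..<n]) = u"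
  by (simp add: map_pad somes_append somes_map_Some somes_replicate_None)

lemma map_fst_conv: "map fst (conv u v) = map (pad u) [0..<max (length u) (length v)]"
  by (simp add: conv_def pad_def comp_def)

lemma map_snd_conv: "map snd (conv u v) = map (pad v) [0..<max (length u) (length v)]"
  by (simp add: conv_def pad_def comp_def)

text \<open>
  Separates the \<open>\<epsilon>\<close>-moves made since the last letter was read; the completeness proof counts these as rounds.
\<close>

lemma split_trailing_None:
  obtains bs m where "as = bs @ replicate m None" "bs \<noteq> [] \<Longrightarrow> last bs \<noteq> None"
proof
  let ?m = "length (takeWhile (\<lambda>z. z = None) (rev as))"
  let ?bs = "rev (dropWhile (\<lambda>z. z = None) (rev as))"
  have "replicate ?m None = takeWhile (\<lambda>z. z = None) (rev as)"
    by (rule replicate_length_same) (auto dest: set_takeWhileD)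
  moreover have "rev (rev as) = rev (takeWhile (\<lambda>z. z = None) (rev as) @ dropWhile (\<lambda>z. z = None) (rev as))"
    unfolding takeWhile_dropWhile_id ..
  ultimately show "as = ?bs @ replicate ?m None"
    by (metis rev_append rev_replicate rev_rev_ident)
  show "last ?bs \<noteq> None" if "?bs \<noteq> []"
  proof -
    have "dropWhile (\<lambda>z. z = None) (rev as) \<noteq> []" using that by simp
    from hd_dropWhile[OF this] show ?thesis by (simp add: last_rev)
  qed
qed

lemma abs_apply_op: "\<bar>apply_op op x\<bar> \<le> \<bar>x\<bar> + 1"
proof (cases op)
  case Keep then show ?thesis unfolding Keep apply_op.simps by linarith
next
  case Incr then show ?thesis unfolding Incr apply_op.simps by linarith
next
  case Decr then show ?thesis unfolding Decr apply_op.simps by linarith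
next
  case Reset then show ?thesis unfolding Reset apply_op.simps by linarith
qed

locale automaton_search =
  fixes k B :: nat and M :: "('l option \<times> 'l option) counter_automaton" and \<Lambda> :: "'l set"
    and code :: "'l option \<Rightarrow> nat"
  assumes automaton: "is_counter_automaton k (padded \<Lambda> \<times> padded \<Lambda>) M"
    and epsilon_bound:
      "ca_path M (ca_init k M) as c \<Longrightarrow> ca_path M c (replicate m None) c' \<Longrightarrow> m \<le> B"
    and inj_code: "inj_on code (padded \<Lambda>)" and code_None: "code None = 0"
begin

definition transitions where "transitions = (SOME ts. set ts = ca_trans M)"
definition states where "states = (SOME ss. set ss = ca_states M)"
definition accepting where "accepting = (SOME fs. set fs = ca_accept M)"

text \<open>
  Staying counts as an \<open>\<epsilon>\<close>-move of the search, so that \<open>B\<close> rounds cover every number of proper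
  \<open>\<epsilon>\<close>-moves up to \<open>B\<close>.
\<close>

definition stay :: "nat \<Rightarrow> ('l option \<times> 'l option) transition" where
  "stay s = (s, None, replicate k No_Test, replicate k Keep, s)"

definition epsilon_ts where
  "epsilon_ts = filter (\<lambda>\<tau>. label \<tau> = None) transitions @ map stay states"
definition letter_ts where
  "letter_ts = filter (\<lambda>\<tau>. label \<tau> \<noteq> None) transitions"

lemma set_transitions: "set transitions = ca_trans M"
  using automaton unfolding transitions_def is_counter_automaton_def
  by (metis (mono_tags, lifting) finite_list someI_ex)

lemma set_states: "set states = ca_states M"
  using automaton unfolding states_def is_counter_automaton_def
  by (metis (mono_tags, lifting) finite_list someI_ex)

lemma set_accepting: "set accepting = ca_accept M"
  using automaton unfolding accepting_def is_counter_automaton_def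
  by (metis (mono_tags, lifting) finite_list finite_subset someI_ex)

definition admissible :: "('l option \<times> 'l option) transition \<Rightarrow> bool" where
  "admissible \<tau> \<longleftrightarrow> (case \<tau> of (p, a, tests, ops, q) \<Rightarrow>
     q \<in> ca_states M \<and> set_option a \<subseteq> padded \<Lambda> \<times> padded \<Lambda> \<and> length tests = k \<and> length ops = k)"

lemma admissible_transition:
  assumes "\<tau> \<in> ca_trans M"
  shows "admissible \<tau>"
proof -
  have "case \<tau> of (p, a, tests, ops, q) \<Rightarrow> p \<in> ca_states M \<and> q \<in> ca_states M \<and>
      set_option a \<subseteq> padded \<Lambda> \<times> padded \<Lambda> \<and> length tests = k \<and> length ops = k"
  proof -
    from automaton have "\<forall>\<tau>\<in>ca_trans M. case \<tau> of (p, a, tests, ops, q) \<Rightarrow>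
        p \<in> ca_states M \<and> q \<in> ca_states M \<and>
        set_option a \<subseteq> padded \<Lambda> \<times> padded \<Lambda> \<and> length tests = k \<and> length ops = k"
      unfolding is_counter_automaton_def by (elim conjE)
    from bspec[OF this assms] show ?thesis .
  qed
  then show ?thesis unfolding admissible_def split_def by (elim conjE) (intro conjI)
qed

lemma admissible_epsilon_ts:
  assumes "\<tau> \<in> set epsilon_ts"
  shows "admissible \<tau>"
proof -
  consider "\<tau> \<in> ca_trans M" | s where "s \<in> ca_states M" "\<tau> = stay s"
    using assms unfolding epsilon_ts_def set_append set_map set_filter set_transitions set_states
    by blast
  then show ?thesis
  proof cases
    case 1
    then show ?thesis by (rule admissible_transition)
  next
    case 2
    then show ?thesis by (simp add: admissible_def stay_def)
  qed
qed

lemma admissible_letter_ts: "\<tau> \<in> set letter_ts \<Longrightarrow> admissible \<tau>"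
  unfolding letter_ts_def set_filter set_transitions by (blast intro: admissible_transition)

definition rounds where
  "rounds a i hs = (expand a epsilon_ts ^^ i) hs"

definition root :: "'l option history" where
  "root = [(ca_init k M, None)]"

fun layer :: "'l list \<Rightarrow> nat \<Rightarrow> 'l option history list" where
  "layer u 0 = rounds None B [root]"
| "layer u (Suc j) = rounds (pad u j) B (expand (pad u j) letter_ts (layer u j))"

text \<open>
  The invariant of a history that arises by \<open>s\<close> moves. Each move changes a counter by at most one or
  resets it, which gives the bound \<open>s\<close>.
\<close>

definition good :: "nat \<Rightarrow> 'l option history \<Rightarrow> bool" where
  "good s h \<longleftrightarrow> length h = Suc s \<and> length (snd (conf h)) = k \<and> fst (conf h) \<in> ca_states M \<and>
     (\<forall>x\<in>set (snd (conf h)). \<bar>x\<bar> \<le> int s) \<and> (\<forall>(c, l)\<in>set h. l \<in> padded \<Lambda>)"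

lemma goodD:
  assumes "good s h"
  shows "length h = Suc s" "length (snd (conf h)) = k" "fst (conf h) \<in> ca_states M"
    "\<forall>x\<in>set (snd (conf h)). \<bar>x\<bar> \<le> int s" "\<forall>(c, l)\<in>set h. l \<in> padded \<Lambda>"
  using assms by (simp_all add: good_def)

lemma good_proper: "good s h \<Longrightarrow> proper k h"
  by (auto simp: good_def proper_def)

lemma good_root: "good 0 root"
proof -
  have "ca_start M \<in> ca_states M" using automaton by (simp add: is_counter_automaton_def)
  then show ?thesis by (simp add: good_def root_def ca_init_def padded_def)
qed

lemma good_step:
  assumes "good s h" "admissible \<tau>" "fire \<tau> (conf h) = Some c"
  shows "good (Suc s) ((c, out \<tau>) # h)"
proof -
  obtain p a tests ops q where \<tau>: "\<tau> = (p, a, tests, ops, q)" by (cases \<tau>)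
  obtain r cs where h: "conf h = (r, cs)" by (cases "conf h")
  have adm: "q \<in> ca_states M" "set_option a \<subseteq> padded \<Lambda> \<times> padded \<Lambda>" "length ops = k"
    using assms(2) by (simp_all add: \<tau> admissible_def)
  have "fire (p, a, tests, ops, q) (r, cs) = Some c" using assms(3) unfolding \<tau> h .
  then have c: "c = (q, map2 apply_op ops cs)" by (simp split: if_splits)
  have cs: "length cs = k" and bound: "\<And>x. x \<in> set cs \<Longrightarrow> \<bar>x\<bar> \<le> int s"
    using goodD(2,4)[OF assms(1)] unfolding h snd_conv by simp_all
  have "\<bar>y\<bar> \<le> int (Suc s)" if y: "y \<in> set (map2 apply_op ops cs)" for y
  proof -
    obtain z where z: "y = (case z of (op, x) \<Rightarrow> apply_op op x)" "z \<in> set (zip ops cs)"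
      using y unfolding set_map by blast
    obtain op x where opx: "z = (op, x)" by (cases z)
    note x = z(1)[unfolded opx prod.case] set_zip_rightD[OF z(2)[unfolded opx]]
    have "\<bar>y\<bar> \<le> \<bar>x\<bar> + 1" unfolding x(1) by (rule abs_apply_op)
    also have "\<dots> \<le> int s + 1" using bound[OF x(2)] by (rule add_right_mono)
    finally show ?thesis by (simp only: of_nat_Suc add.commute)
  qed
  moreover have "out \<tau> \<in> padded \<Lambda>"
  proof (cases a)
    case None
    then show ?thesis by (simp add: \<tau> out_def padded_def)
  next
    case (Some xy)
    then have "snd xy \<in> padded \<Lambda>" using adm(2) by auto
    then show ?thesis using Some by (simp add: \<tau> out_def split_def)
  qed
  moreover note goodD(1,5)[OF assms(1)]
  moreover have "length (map2 apply_op ops cs) = k" using adm(3) cs by simp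
  ultimately show ?thesis
    unfolding good_def c list.sel fst_conv snd_conv list.set(2) using adm(1) by (simp del: set_map set_zip)
qed

lemma good_expand:
  assumes "\<forall>h\<in>set hs. good s h" "\<forall>\<tau>\<in>set ts. admissible \<tau>"
  shows "\<forall>h\<in>set (expand a ts hs). good (Suc s) h"
proof
  fix h' assume "h' \<in> set (expand a ts hs)"
  then obtain h \<tau> c where h: "h \<in> set hs" "\<tau> \<in> set ts" "fire \<tau> (conf h) = Some c"
    "h' = (c, out \<tau>) # h"
    by (rule expand_cases)
  show "good (Suc s) h'"
    unfolding h(4) using bspec[OF assms(1) h(1)] bspec[OF assms(2) h(2)] h(3) by (rule good_step)
qed

lemma good_expand_epsilon:
  "\<forall>h\<in>set hs. good s h \<Longrightarrow> \<forall>h\<in>set (expand a epsilon_ts hs). good (Suc s) h"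
  by (rule good_expand) (blast intro: admissible_epsilon_ts)+

lemma good_expand_letter:
  "\<forall>h\<in>set hs. good s h \<Longrightarrow> \<forall>h\<in>set (expand a letter_ts hs). good (Suc s) h"
  by (rule good_expand) (blast intro: admissible_letter_ts)+

lemma rounds_Suc: "rounds a (Suc i) hs = expand a epsilon_ts (rounds a i hs)"
  by (simp add: rounds_def)

lemma rounds_0: "rounds a 0 hs = hs"
  by (simp add: rounds_def)

lemma good_rounds:
  assumes "\<forall>h\<in>set hs. good s h"
  shows "\<forall>h\<in>set (rounds a i hs). good (s + i) h"
proof (induction i)
  case 0
  show ?case using assms by (simp add: rounds_0)
next
  case (Suc i)
  show ?case unfolding rounds_Suc add_Suc_right by (rule good_expand_epsilon[OF Suc])
qed

text \<open>
  The number of moves behind every history of layer \<open>j\<close>, with \<open>B\<close> moves before the first letter.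
\<close>

definition stage :: "nat \<Rightarrow> nat" where "stage j = j * (B + 1) + B"

lemma good_layer: "\<forall>h\<in>set (layer u j). good (stage j) h"
proof (induction j)
  case 0
  have "\<forall>h\<in>set [root]. good 0 h" using good_root by simp
  from good_rounds[OF this] show ?case by (simp add: stage_def)
next
  case (Suc j)
  have "Suc (stage j) + B = stage (Suc j)" by (simp add: stage_def)
  with good_rounds[OF good_expand_letter[OF Suc]] show ?case by (metis layer.simps(2))
qed

text \<open>
  The number of configurations whose \<open>k\<close> counters all lie between \<open>-s\<close> and \<open>s\<close>.
\<close>

definition width :: "nat \<Rightarrow> nat" where "width s = card (ca_states M) * (2 * s + 1) ^ k"

lemma width_mono: "s \<le> s' \<Longrightarrow> width s \<le> width s'"
  unfolding width_def by (intro mult_left_mono power_mono) auto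

lemma length_le_width:
  assumes "\<forall>h\<in>set hs. good s h" "distinct (map conf hs)"
  shows "length hs \<le> width s"
proof -
  let ?I = "{- int s..int s}"
  let ?D = "{cs. set cs \<subseteq> ?I \<and> length cs = k}"
  have "conf h \<in> ca_states M \<times> ?D" if "h \<in> set hs" for h
  proof -
    have g: "fst (conf h) \<in> ca_states M" "length (snd (conf h)) = k"
      "\<forall>x\<in>set (snd (conf h)). \<bar>x\<bar> \<le> int s"
      using goodD[OF bspec[OF assms(1) that]] by simp_all
    have "set (snd (conf h)) \<subseteq> ?I"
    proof
      fix x assume "x \<in> set (snd (conf h))"
      from bspec[OF g(3) this] show "x \<in> ?I" unfolding atLeastAtMost_iff by linarith
    qed
    with g(1,2) show ?thesis unfolding mem_Times_iff by blast
  qed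
  then have "set (map conf hs) \<subseteq> ca_states M \<times> ?D" unfolding set_map by blast
  moreover have "finite (ca_states M)" using automaton unfolding is_counter_automaton_def by blast
  then have "finite (ca_states M \<times> ?D)"
    by (intro finite_cartesian_product finite_lists_length_eq finite_atLeastAtMost_int)
  ultimately have "card (set (map conf hs)) \<le> card (ca_states M \<times> ?D)" by (intro card_mono)
  moreover have "card ?I = nat (int (2 * s + 1))" unfolding card_atLeastAtMost_int
    by (rule arg_cong[where f = nat]) simp
  then have "card ?I = 2 * s + 1" unfolding nat_int .
  then have "card (ca_states M \<times> ?D) = width s"
    by (simp only: card_cartesian_product card_lists_length_eq[OF finite_atLeastAtMost_int] width_def)
  moreover have "card (set (map conf hs)) = length hs"
    using distinct_card[OF assms(2)] by (simp only: length_map)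
  ultimately show ?thesis by (simp only:)
qed

lemma distinct_rounds: "distinct (map conf hs) \<Longrightarrow> distinct (map conf (rounds a i hs))"
  unfolding rounds_def by (cases i) (simp_all add: distinct_expand)

lemma distinct_layer: "distinct (map conf (layer u j))"
  by (cases j) (simp_all add: distinct_rounds distinct_expand)

text \<open>
  The history \<open>h\<close> describes an actual computation that has read \<open>j\<close> letters: the first tape shows \<open>u\<close>, the second
  one shows the symbols recorded in \<open>h\<close>.
\<close>

definition sound :: "'l list \<Rightarrow> nat \<Rightarrow> 'l option history \<Rightarrow> bool" where
  "sound u j h \<longleftrightarrow> (\<exists>as. ca_path M (ca_init k M) as (conf h) \<and>
     map fst (somes as) = map (pad u) [0..<j] \<and>
     somes (map snd (somes as)) = somes (rev (map snd h)))"

lemma fire_stay: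
  assumes "length (snd c) = k"
  shows "fire (stay s) c = (if fst c = s then Some c else None)"
proof -
  have "list_all2 passes (replicate k No_Test) cs" "map2 apply_op (replicate k Keep) cs = cs"
    if "length cs = k" for cs
    using that by (auto simp: list_all2_conv_all_nth intro!: nth_equalityI)
  with assms show ?thesis by (cases c) (simp add: stay_def)
qed

lemma sound_epsilon:
  assumes "sound u j h" "good s h" "\<tau> \<in> set epsilon_ts" "fire \<tau> (conf h) = Some c"
  shows "sound u j ((c, out \<tau>) # h)"
proof -
  obtain as where as: "ca_path M (ca_init k M) as (conf h)"
    "map fst (somes as) = map (pad u) [0..<j]" "somes (map snd (somes as)) = somes (rev (map snd h))"
    using assms(1) unfolding sound_def by blast
  consider "\<tau> \<in> ca_trans M" "label \<tau> = None" | r where "\<tau> = stay r"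
    using assms(3) by (auto simp: epsilon_ts_def set_transitions)
  then show ?thesis
  proof cases
    case 1
    then have "ca_step M (conf h) None c" using assms(4) by (auto simp: ca_step_fire)
    then have "ca_path M (ca_init k M) (as @ [None]) c" using as(1) unfolding ca_path_snoc by blast
    then show ?thesis unfolding sound_def using as(2,3) 1(2)
      by (intro exI[of _ "as @ [None]"]) (simp add: somes_append somes_simps out_def)
  next
    case 2
    then have "c = conf h" using assms(2,4) fire_stay by (auto simp: good_def split: if_splits)
    then show ?thesis unfolding sound_def using as 2
      by (intro exI[of _ as]) (simp add: somes_append somes_simps out_def stay_def)
  qed
qed

lemma sound_letter:
  assumes "sound u j h" "\<tau> \<in> set letter_ts" "enabled (pad u j) \<tau>" "fire \<tau> (conf h) = Some c"
  shows "sound u (Suc j) ((c, out \<tau>) # h)"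
proof -
  obtain as where as: "ca_path M (ca_init k M) as (conf h)"
    "map fst (somes as) = map (pad u) [0..<j]" "somes (map snd (somes as)) = somes (rev (map snd h))"
    using assms(1) unfolding sound_def by blast
  obtain x y where xy: "label \<tau> = Some (x, y)" "x = pad u j" "out \<tau> = y" "\<tau> \<in> ca_trans M"
    using assms(2,3) by (auto simp: letter_ts_def enabled_def out_def set_transitions)
  then have "ca_step M (conf h) (Some (x, y)) c" using assms(4) by (auto simp: ca_step_fire)
  then have "ca_path M (ca_init k M) (as @ [Some (x, y)]) c" using as(1) unfolding ca_path_snoc by blast
  then show ?thesis unfolding sound_def using as(2,3) xy
    by (intro exI[of _ "as @ [Some (x, y)]"]) (simp add: somes_append somes_simps)
qed

lemma sound_rounds:
  assumes "\<forall>h\<in>set hs. sound u j h \<and> good s h"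
  shows "\<forall>h\<in>set (rounds a i hs). sound u j h"
proof (induction i)
  case 0
  show ?case using assms by (simp add: rounds_0)
next
  case (Suc i)
  have good: "\<forall>h\<in>set (rounds a i hs). good (s + i) h" using assms by (intro good_rounds) blast
  show ?case
  proof
    fix h' assume "h' \<in> set (rounds a (Suc i) hs)"
    then obtain h \<tau> c where h: "h \<in> set (rounds a i hs)" "\<tau> \<in> set epsilon_ts"
      "fire \<tau> (conf h) = Some c" "h' = (c, out \<tau>) # h"
      unfolding rounds_Suc by (rule expand_cases)
    show "sound u j h'"
      unfolding h(4) using bspec[OF Suc h(1)] bspec[OF good h(1)] h(2,3) by (rule sound_epsilon)
  qed
qed

text \<open>
  Histories are only ever extended by a move of the automaton or by staying, and both preserve soundness.
\<close>

lemma layer_sound: "\<forall>h\<in>set (layer u j). sound u j h"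
proof (induction j)
  case 0
  have "sound u 0 root"
    unfolding sound_def
    by (intro exI[of _ "[]"]) (simp add: root_def ca_path_Nil somes_simps)
  then have "\<forall>h\<in>set [root]. sound u 0 h \<and> good 0 h" using good_root by simp
  from sound_rounds[OF this] show ?case by simp
next
  case (Suc j)
  let ?hs = "expand (pad u j) letter_ts (layer u j)"
  have "\<forall>h\<in>set ?hs. sound u (Suc j) h"
  proof
    fix h' assume "h' \<in> set ?hs"
    then show "sound u (Suc j) h'"
      by (cases rule: expand_cases) (use Suc sound_letter in blast)
  qed
  moreover have "\<forall>h\<in>set ?hs. good (Suc (stage j)) h"
    by (rule good_expand_letter[OF good_layer])
  ultimately have "\<forall>h\<in>set ?hs. sound u (Suc j) h \<and> good (Suc (stage j)) h" by blast
  from sound_rounds[OF this] show ?case by simp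
qed

text \<open>
  A layer splits into its letter round, which yields \<open>start_of_layer\<close>, and \<open>B\<close> rounds of \<open>\<epsilon>\<close>-moves. For layer \<open>0\<close>
  there is no letter round, and the padding symbol serves as current symbol.
\<close>

definition start_of_layer where
  "start_of_layer u j = (case j of 0 \<Rightarrow> [root] | Suc i \<Rightarrow> expand (pad u i) letter_ts (layer u i))"

definition symbol_of_layer where
  "symbol_of_layer u j = (case j of 0 \<Rightarrow> None | Suc i \<Rightarrow> pad u i)"

lemma layer_eq: "layer u j = rounds (symbol_of_layer u j) B (start_of_layer u j)"
  by (cases j) (simp_all add: start_of_layer_def symbol_of_layer_def)

definition start_stage where "start_stage j = j * (B + 1)"

lemma good_start: "\<forall>h\<in>set (start_of_layer u j). good (start_stage j) h"
proof (cases j)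
  case 0
  then show ?thesis using good_root by (simp add: start_of_layer_def start_stage_def)
next
  case (Suc i)
  have "Suc (stage i) = start_stage j" by (simp add: Suc stage_def start_stage_def)
  then show ?thesis
    using good_expand_letter[OF good_layer, of "pad u i" u i] by (simp add: Suc start_of_layer_def)
qed

text \<open>
  Thanks to staying moves no configuration is lost in an \<open>\<epsilon>\<close>-round.
\<close>

lemma rounds_mono:
  assumes "\<forall>h\<in>set hs. good s h" "i \<le> i'"
  shows "conf ` set (rounds a i hs) \<subseteq> conf ` set (rounds a i' hs)"
  using assms(2)
proof (induction rule: dec_induct)
  case (step n)
  have "conf ` set (rounds a n hs) \<subseteq> conf ` set (expand a epsilon_ts (rounds a n hs))"
  proof
    fix c assume "c \<in> conf ` set (rounds a n hs)"
    then obtain h where h: "h \<in> set (rounds a n hs)" "c = conf h" by auto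
    then have "good (s + n) h" using good_rounds[OF assms(1)] by blast
    then have "fire (stay (fst c)) c = Some c" "fst c \<in> ca_states M"
      using h(2) fire_stay by (auto simp: good_def)
    moreover have "enabled a (stay (fst c))" by (simp add: enabled_def stay_def)
    ultimately show "c \<in> conf ` set (expand a epsilon_ts (rounds a n hs))"
      unfolding expand_confs using h by (auto simp: epsilon_ts_def set_states intro!: bexI)
  qed
  then show ?case using step.IH by (auto simp: rounds_def)
qed auto

text \<open>
  Induction on the length of the computation. If it ends with an \<open>\<epsilon>\<close>-move, that move is made in the
  latest round. If it ends with a letter, the computation before it ends in at most \<open>B\<close> \<open>\<epsilon>\<close>-moves,
  so it leads into the preceding layer, from which the letter round continues.
\<close>

lemma round_complete:
  assumes "ca_path M (ca_init k M) (as @ replicate m None) c" "as \<noteq> [] \<Longrightarrow> last as \<noteq> None"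
    "map fst (somes as) = map (pad u) [0..<j]"
  shows "c \<in> conf ` set (rounds (symbol_of_layer u j) m (start_of_layer u j))"
  using assms
proof (induction "length as + m" arbitrary: as m c j)
  case 0
  then have "c = ca_init k M" by (auto elim: ca_path.cases)
  moreover have "j = 0" using 0 by (simp add: somes_simps)
  ultimately show ?case using 0 by (simp add: rounds_def start_of_layer_def root_def)
next
  case (Suc n)
  show ?case
  proof (cases m)
    case (Suc m')
    then have "ca_path M (ca_init k M) ((as @ replicate m' None) @ [None]) c"
      using Suc.prems(1) by (simp add: replicate_append_same)
    then obtain c' where c': "ca_path M (ca_init k M) (as @ replicate m' None) c'" "ca_step M c' None c"
      unfolding ca_path_snoc by blast
    let ?hs = "rounds (symbol_of_layer u j) m' (start_of_layer u j)"
    have "c' \<in> conf ` set ?hs"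
      using Suc.hyps(1)[of as m'] c'(1) Suc.prems Suc.hyps(2) Suc by simp
    then obtain h where h: "h \<in> set ?hs" "c' = conf h" by blast
    obtain \<tau> where \<tau>: "\<tau> \<in> ca_trans M" "label \<tau> = None" "fire \<tau> c' = Some c"
      using c'(2) unfolding ca_step_fire by blast
    then have "\<tau> \<in> set epsilon_ts" by (simp add: epsilon_ts_def set_transitions)
    moreover have "enabled (symbol_of_layer u j) \<tau>" using \<tau>(2) by (simp add: enabled_def)
    ultimately have "c \<in> conf ` set (expand (symbol_of_layer u j) epsilon_ts ?hs)"
      unfolding expand_confs using h \<tau>(3) by blast
    then show ?thesis by (simp add: Suc rounds_def)
  next
    case 0
    then obtain as' a where as: "as = as' @ [a]" using Suc.hyps(2) by (cases as rule: rev_cases) auto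
    then obtain x y where a: "a = Some (x, y)" using Suc.prems(2) by auto
    obtain c' where c': "ca_path M (ca_init k M) as' c'" "ca_step M c' (Some (x, y)) c"
      using Suc.prems(1) by (auto simp: as a 0 ca_path_snoc)
    have "j \<noteq> 0"
    proof
      assume "j = 0"
      then show False using Suc.prems(3) by (simp add: as a somes_append somes_simps)
    qed
    then obtain i where j: "j = Suc i" by (cases j) auto
    have x: "map fst (somes as') = map (pad u) [0..<i]" "x = pad u i"
      using Suc.prems(3) by (auto simp: as a somes_append somes_simps j)
    obtain bs m' where as': "as' = bs @ replicate m' None" and last: "bs \<noteq> [] \<Longrightarrow> last bs \<noteq> None"
      using split_trailing_None[of as'] by metis
    have "somes as' = somes bs" by (simp add: as' somes_append somes_replicate_None)
    then have "c' \<in> conf ` set (rounds (symbol_of_layer u i) m' (start_of_layer u i))"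
      using Suc.hyps(1)[of bs m' c' i] Suc.hyps(2) last c'(1) x(1) as as' 0 by simp
    moreover have "m' \<le> B"
      using c'(1) epsilon_bound unfolding as' ca_path_append by blast
    ultimately have "c' \<in> conf ` set (layer u i)"
      unfolding layer_eq using rounds_mono[OF good_start] by blast
    then obtain h where h: "h \<in> set (layer u i)" "c' = conf h" by blast
    obtain \<tau> where \<tau>: "\<tau> \<in> ca_trans M" "label \<tau> = Some (x, y)" "fire \<tau> c' = Some c"
      using c'(2) unfolding ca_step_fire by blast
    then have "\<tau> \<in> set letter_ts" by (simp add: letter_ts_def set_transitions)
    moreover have "enabled (pad u i) \<tau>" using \<tau>(2) x(2) by (simp add: enabled_def)
    ultimately have "c \<in> conf ` set (expand (pad u i) letter_ts (layer u i))"
      unfolding expand_confs using h \<tau>(3) by blast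
    then have "c \<in> conf ` set (start_of_layer u j)"
      by (simp add: start_of_layer_def j)
    then show ?thesis by (simp add: 0 rounds_def)
  qed
qed

lemma layer_complete:
  assumes "ca_path M (ca_init k M) as c" "map fst (somes as) = map (pad u) [0..<j]"
  shows "c \<in> conf ` set (layer u j)"
proof -
  obtain bs m where as: "as = bs @ replicate m None" and last: "bs \<noteq> [] \<Longrightarrow> last bs \<noteq> None"
    using split_trailing_None[of as] by metis
  have "c \<in> conf ` set (rounds (symbol_of_layer u j) m (start_of_layer u j))"
    using assms last unfolding as
    by (intro round_complete) (simp_all add: somes_append somes_replicate_None)
  moreover have "m \<le> B"
    using assms(1) epsilon_bound unfolding as ca_path_append by blast
  ultimately show ?thesis
    unfolding layer_eq using rounds_mono[OF good_start] by blast
qed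

definition finals :: "config set" where
  "finals = ca_accept M \<times> {replicate k 0}"

lemma final_layer:
  assumes "conv u v \<in> ca_language k M"
  shows "\<exists>h\<in>set (layer u (max (length u) (length v))). conf h \<in> finals"
proof -
  obtain as f where as: "conv u v = somes as" "f \<in> ca_accept M"
    "ca_path M (ca_init k M) as (f, replicate k 0)"
    using assms unfolding ca_language_def by auto
  then have "(f, replicate k 0) \<in> conf ` set (layer u (max (length u) (length v)))"
    by (intro layer_complete) (simp_all flip: map_fst_conv)
  moreover have "(f, replicate k 0) \<in> finals" using as(2) by (simp add: finals_def)
  ultimately show ?thesis by (metis (no_types, lifting) imageE)
qed

definition trace :: "'l option history \<Rightarrow> 'l list" where
  "trace h = somes (rev (map snd h))"

text \<open>
  An accepted input is some \<open>conv u' v'\<close>. Deleting the padding from the first tape recovers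
  both \<open>u'\<close> and, as all of \<open>u\<close> has been read, \<open>u\<close>; so the two agree. Deleting it from the second tape
  recovers \<open>v'\<close>, which is what the history recorded.
\<close>

lemma final_trace:
  assumes "h \<in> set (layer u j)" "conf h \<in> finals" "length u \<le> j"
    "ca_language k M \<subseteq> {conv u v |u v. P u v}"
  shows "P u (trace h)"
proof -
  have "sound u j h" using layer_sound assms(1) by blast
  then obtain as where as: "ca_path M (ca_init k M) as (conf h)"
    "map fst (somes as) = map (pad u) [0..<j]" "somes (map snd (somes as)) = trace h"
    unfolding sound_def trace_def by blast
  obtain f where "conf h = (f, replicate k 0)" "f \<in> ca_accept M"
    using assms(2) by (auto simp: finals_def)
  then have "somes as \<in> ca_language k M" using as(1) unfolding ca_language_def by auto
  then obtain u' v' where uv: "somes as = conv u' v'" "P u' v'" using assms(4) by auto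
  let ?n = "max (length u') (length v')"
  \<comment> \<open>Both \<open>u\<close> and \<open>u'\<close> are what the first tape spells without padding.\<close>
  have "u = somes (map fst (somes as))" using as(2) somes_pad assms(3) by metis
  also have "\<dots> = u'" unfolding uv(1) map_fst_conv by (rule somes_pad) simp
  finally have "u = u'" .
  moreover have "v' = trace h"
    using as(3) somes_pad[of v' ?n] unfolding uv(1) map_snd_conv by simp
  ultimately show ?thesis using uv(2) by simp
qed

end

section \<open>Programs for the search\<close>

abbreviation "work_vars \<equiv> {Cfg, First, Second, Ok, Zero, Tmp, Cand, Scan, Found, Lhs, Rhs, Same,
  Item, New, Letter}"

context automaton_search
begin

fun fire_prog :: "('l option \<times> 'l option) transition \<Rightarrow> ram" where
  "fire_prog (p, a, tests, ops, q) = Seq (candidate_prog p tests ops q)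
     (IfNZ (reg Ok) (add_prog code (out (p, a, tests, ops, q))) Skip)"

lemma fire_prog_runs:
  assumes "admissible \<tau>" "\<forall>h\<in>set hs. proper k h" "proper k h"
    "\<sigma> Node = hist_val code h" "\<sigma> New = layer_val code hs"
  shows "runs (fire_prog \<tau>) \<sigma> (\<lambda>t \<sigma>'. t \<le> (120 * k + 150) * (length hs + 1) \<and>
    \<sigma>' New = layer_val code (case fire \<tau> (conf h) of None \<Rightarrow> hs
      | Some c \<Rightarrow> add_history c (out \<tau>) h hs) \<and> frame work_vars \<sigma> \<sigma>')"
proof -
  obtain p a tests ops q where \<tau>: "\<tau> = (p, a, tests, ops, q)" by (cases \<tau>)
  obtain s cs where c: "conf h = (s, cs)" by (cases "conf h")
  have len: "length cs = k" using assms(3) c by (simp add: proper_def)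
  have len': "length tests = length cs" "length cs = length ops"
    using assms(1) len by (simp_all add: admissible_def \<tau>)
  obtain w where w: "hist_val code h = Branch (nums (encode (s, cs))) w"
    using hist_val_proper[OF assms(3)] c by metis
  have node: "\<sigma> Node = Branch (nums (encode (s, cs))) w" using assms(4) w by simp
  let ?c = "(q, map2 apply_op ops cs)"
  have fire: "fire \<tau> (conf h) = (if s = p \<and> list_all2 passes tests cs then Some ?c else None)"
    by (simp add: \<tau> c)
  have lenc: "length (snd ?c) = k" using len' len by simp
  have time: "80 * k + 70 \<le> (80 * k + 70) * (length hs + 1)" by simp
  have add: "runs (add_prog code (out \<tau>)) \<sigma>' (\<lambda>t \<sigma>''. t \<le> (40 * k + 80) * (length hs + 1) \<and>
      \<sigma>'' New = layer_val code (add_history ?c (out \<tau>) h hs) \<and>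
      frame (lookup_vars \<union> {New, Letter}) \<sigma>' \<sigma>'')"
    if "\<sigma>' Cand = nums (encode ?c)" "frame candidate_vars \<sigma> \<sigma>'" for \<sigma>'
    using assms(2,4,5) that lenc by (intro add_prog_runs) (simp_all add: frame_def)
  show ?thesis
    unfolding \<tau> fire_prog.simps
    unfolding \<tau>[symmetric]
  proof (rule runs_Seq, rule runs_conseq[OF candidate_prog_runs[where \<sigma> = \<sigma> and s = s and cs = cs and w = w, OF node len']])
    fix t \<sigma>' assume post: "t \<le> 80 * length cs + 60 \<and> \<sigma>' Cand = nums (encode ?c) \<and>
      \<sigma>' Ok = Raw (if s = p \<and> list_all2 passes tests cs then 1 else 0) \<and>
      frame candidate_vars \<sigma> \<sigma>'"
    let ?Q = "\<lambda>t' \<sigma>''. t + t' \<le> (120 * k + 150) * (length hs + 1) \<and>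
      \<sigma>'' New = layer_val code (case fire \<tau> (conf h) of None \<Rightarrow> hs
        | Some c \<Rightarrow> add_history c (out \<tau>) h hs) \<and> frame work_vars \<sigma> \<sigma>''"
    have t: "t \<le> 80 * k + 60" using post len by simp
    show "runs (IfNZ (reg Ok) (add_prog code (out \<tau>)) Skip) \<sigma>' ?Q"
    proof (rule runs_If)
      assume "nonzero (\<sigma>' Ok)"
      then have f: "fire \<tau> (conf h) = Some ?c" using post fire by (simp split: if_splits)
      show "runs (add_prog code (out \<tau>)) \<sigma>' (\<lambda>t. ?Q (1 + t))"
      proof (rule runs_conseq[OF add])
        fix t' \<sigma>'' assume *: "t' \<le> (40 * k + 80) * (length hs + 1) \<and>
          \<sigma>'' New = layer_val code (add_history ?c (out \<tau>) h hs) \<and>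
          frame (lookup_vars \<union> {New, Letter}) \<sigma>' \<sigma>''"
        have "t + (1 + t') \<le> (80 * k + 70) * (length hs + 1) + (40 * k + 80) * (length hs + 1)"
          using t * time by linarith
        also have "\<dots> = (120 * k + 150) * (length hs + 1)" by (simp add: distrib_right)
        finally show "?Q (1 + t') \<sigma>''" using * f post by (simp add: frame_def)
      qed (use post in auto)
    next
      assume "\<not> nonzero (\<sigma>' Ok)"
      then have f: "fire \<tau> (conf h) = None" using post fire by (simp split: if_splits)
      have "t + (1 + 1) \<le> (80 * k + 70) * (length hs + 1)" using t time by linarith
      also have "\<dots> \<le> (120 * k + 150) * (length hs + 1)" by (intro mult_right_mono) auto
      finally show "runs Skip \<sigma>' (\<lambda>t. ?Q (1 + t))"
        using f post assms(5) by (intro runs_Skip) (simp add: frame_def)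
    qed
  qed
qed

text \<open>
  The time for comparing the current symbol with the one that the move expects; an \<open>\<epsilon>\<close>-move does not compare.
\<close>

definition guard_cost :: "('l option \<times> 'l option) transition \<Rightarrow> nat" where
  "guard_cost \<tau> = (case label \<tau> of None \<Rightarrow> 0 | Some (x, y) \<Rightarrow> 2 * code x + 3)"

definition transition_prog :: "('l option \<times> 'l option) transition \<Rightarrow> ram" where
  "transition_prog \<tau> = (case label \<tau> of None \<Rightarrow> fire_prog \<tau>
     | Some (x, y) \<Rightarrow> if_raw Sym (code x) (fire_prog \<tau>) Skip)"

definition transition_cost :: nat where
  "transition_cost = 120 * k + 150 + sum_list (map guard_cost letter_ts)"

text \<open>
  Bundles admissibility with one cost bound that is shared by all moves.
\<close>

definition usable :: "('l option \<times> 'l option) transition \<Rightarrow> bool" where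
  "usable \<tau> \<longleftrightarrow> admissible \<tau> \<and> 120 * k + 150 + guard_cost \<tau> \<le> transition_cost"

lemma usable_epsilon_ts: "\<forall>\<tau>\<in>set epsilon_ts. usable \<tau>"
proof
  fix \<tau> assume \<tau>: "\<tau> \<in> set epsilon_ts"
  then have "label \<tau> = None" by (auto simp: epsilon_ts_def stay_def)
  then show "usable \<tau>" using admissible_epsilon_ts[OF \<tau>]
    by (simp add: usable_def guard_cost_def transition_cost_def)
qed

lemma usable_letter_ts: "\<forall>\<tau>\<in>set letter_ts. usable \<tau>"
proof
  fix \<tau> assume \<tau>: "\<tau> \<in> set letter_ts"
  then have "guard_cost \<tau> \<le> sum_list (map guard_cost letter_ts)" by (simp add: member_le_sum_list)
  then show "usable \<tau>" using admissible_letter_ts[OF \<tau>]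
    by (simp add: usable_def transition_cost_def)
qed

lemma transition_prog_runs:
  assumes "usable \<tau>" "\<forall>h\<in>set hs. proper k h" "proper k h"
    "\<sigma> Node = hist_val code h" "\<sigma> New = layer_val code hs" "\<sigma> Sym = Raw (code a)" "a \<in> padded \<Lambda>"
  shows "runs (transition_prog \<tau>) \<sigma> (\<lambda>t \<sigma>'. t \<le> transition_cost * (length hs + 1) \<and>
    \<sigma>' New = layer_val code (extend_by a h \<tau> hs) \<and> frame work_vars \<sigma> \<sigma>')"
proof -
  have adm: "admissible \<tau>" using assms(1) by (simp add: usable_def)
  have "(120 * k + 150 + guard_cost \<tau>) * (length hs + 1) \<le> transition_cost * (length hs + 1)"
    using assms(1) by (intro mult_right_mono) (simp_all add: usable_def)
  moreover have "guard_cost \<tau> \<le> guard_cost \<tau> * (length hs + 1)" by simp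
  ultimately have time: "(120 * k + 150) * (length hs + 1) + guard_cost \<tau> \<le> transition_cost * (length hs + 1)"
    unfolding add_mult_distrib[of _ "guard_cost \<tau>"] by linarith
  note fire = fire_prog_runs[OF adm assms(2-5)]
  show ?thesis
  proof (cases "label \<tau>")
    case None
    then have "extend_by a h \<tau> hs = (case fire \<tau> (conf h) of None \<Rightarrow> hs
        | Some c \<Rightarrow> add_history c (out \<tau>) h hs)"
      by (simp add: extend_by_def enabled_def)
    then show ?thesis
      unfolding transition_prog_def None option.case
      using time by (intro runs_conseq[OF fire]) (simp add: guard_cost_def None)
  next
    case (Some xy)
    obtain x y where xy: "xy = (x, y)" by (cases xy)
    have "x \<in> padded \<Lambda>" using adm Some by (auto simp: admissible_def xy)
    then have eq: "code a = code x \<longleftrightarrow> a = x" using inj_code assms(7) by (auto dest: inj_onD)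
    have gc: "guard_cost \<tau> = 2 * code x + 3" by (simp add: guard_cost_def Some xy)
    show ?thesis
      unfolding transition_prog_def Some xy option.case prod.case
    proof (rule runs_if_raw)
      show "is_Raw (\<sigma> Sym)" using assms(6) by simp
    next
      assume "\<sigma> Sym = Raw (code x)"
      then have "a = x" using assms(6) eq by simp
      then have ext: "extend_by a h \<tau> hs = (case fire \<tau> (conf h) of None \<Rightarrow> hs
          | Some c \<Rightarrow> add_history c (out \<tau>) h hs)"
        by (simp add: extend_by_def enabled_def Some xy)
      show "runs (fire_prog \<tau>) \<sigma> (\<lambda>t \<sigma>'. \<forall>d\<le>2 * code x + 2.
          d + t \<le> transition_cost * (length hs + 1) \<and>
          \<sigma>' New = layer_val code (extend_by a h \<tau> hs) \<and> frame work_vars \<sigma> \<sigma>')"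
        unfolding ext using time gc by (intro runs_conseq[OF fire]) auto
    next
      assume "\<sigma> Sym \<noteq> Raw (code x)"
      then have "a \<noteq> x" using assms(6) by auto
      then have "extend_by a h \<tau> hs = hs" by (simp add: extend_by_def enabled_def Some xy)
      then show "runs Skip \<sigma> (\<lambda>t \<sigma>'. \<forall>d\<le>2 * code x + 2.
          d + t \<le> transition_cost * (length hs + 1) \<and>
          \<sigma>' New = layer_val code (extend_by a h \<tau> hs) \<and> frame work_vars \<sigma> \<sigma>')"
        using time gc assms(5) by (intro runs_Skip) (auto simp: frame_refl)
    qed
  qed
qed

definition extend_layer_prog :: "('l option \<times> 'l option) transition list \<Rightarrow> ram" where
  "extend_layer_prog ts = foldr (\<lambda>\<tau>. Seq (transition_prog \<tau>)) ts Skip"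

lemma proper_extend_by:
  assumes "\<forall>h\<in>set hs. proper k h" "proper k h" "admissible \<tau>"
  shows "\<forall>h\<in>set (extend_by a h \<tau> hs). proper k h"
proof
  fix h' assume "h' \<in> set (extend_by a h \<tau> hs)"
  then show "proper k h'"
  proof (cases rule: extend_by_cases)
    case 1
    then show ?thesis using assms(1) by blast
  next
    case (2 c)
    have "length (snd c) = k"
      using 2(2) assms(2,3) by (cases \<tau>; cases "conf h") (auto simp: admissible_def proper_def split: if_splits)
    then show ?thesis by (simp add: 2(3) proper_def)
  qed
qed

lemma proper_extend:
  assumes "\<forall>h\<in>set hs. proper k h" "proper k h" "\<forall>\<tau>\<in>set ts. admissible \<tau>"
  shows "\<forall>h\<in>set (extend_layer a ts h hs). proper k h"
  using assms unfolding extend_layer_def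
proof (induction ts arbitrary: hs)
  case (Cons \<tau> ts)
  then have "\<forall>h\<in>set (extend_by a h \<tau> hs). proper k h" by (intro proper_extend_by) simp_all
  from Cons.IH[OF this] Cons.prems show ?case by simp
qed simp

lemma extend_layer_prog_runs:
  assumes "\<forall>\<tau>\<in>set ts. usable \<tau>" "\<forall>h\<in>set hs. proper k h" "proper k h"
    "\<sigma> Node = hist_val code h" "\<sigma> New = layer_val code hs" "\<sigma> Sym = Raw (code a)" "a \<in> padded \<Lambda>"
    "length (extend_layer a ts h hs) \<le> W"
  shows "runs (extend_layer_prog ts) \<sigma> (\<lambda>t \<sigma>'. t \<le> length ts * (transition_cost * (W + 1)) + 1 \<and>
    \<sigma>' New = layer_val code (extend_layer a ts h hs) \<and> frame work_vars \<sigma> \<sigma>')"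
  using assms
proof (induction ts arbitrary: hs \<sigma>)
  case Nil
  then show ?case by (simp add: extend_layer_prog_def extend_layer_def runs_Skip frame_refl)
next
  case (Cons \<tau> ts)
  let ?hs = "extend_by a h \<tau> hs"
  have ext: "extend_layer a (\<tau> # ts) h hs = extend_layer a ts h ?hs" by (simp add: extend_layer_def)
  have prog: "extend_layer_prog (\<tau> # ts) = Seq (transition_prog \<tau>) (extend_layer_prog ts)"
    by (simp add: extend_layer_prog_def)
  have adm: "usable \<tau>" "admissible \<tau>" using Cons.prems(1) by (simp_all add: usable_def)
  have "length hs \<le> length ?hs" by (rule length_extend_by)
  also have "\<dots> \<le> length (extend_layer a ts h ?hs)" by (rule length_extend)
  finally have "length hs \<le> W" using Cons.prems(8) unfolding ext by simp
  then have time: "transition_cost * (length hs + 1) \<le> transition_cost * (W + 1)"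
    by (intro mult_left_mono) auto
  show ?case
    unfolding prog ext
  proof (rule runs_Seq, rule runs_conseq[OF transition_prog_runs[OF adm(1) Cons.prems(2-7)]])
    fix t \<sigma>' assume *: "t \<le> transition_cost * (length hs + 1) \<and>
      \<sigma>' New = layer_val code ?hs \<and> frame work_vars \<sigma> \<sigma>'"
    show "runs (extend_layer_prog ts) \<sigma>' (\<lambda>t' \<sigma>''. t + t' \<le> length (\<tau> # ts) * (transition_cost * (W + 1)) + 1 \<and>
        \<sigma>'' New = layer_val code (extend_layer a ts h ?hs) \<and> frame work_vars \<sigma> \<sigma>'')"
    proof (rule runs_conseq[OF Cons.IH[of ?hs \<sigma>']])
      fix t' \<sigma>'' assume **: "t' \<le> length ts * (transition_cost * (W + 1)) + 1 \<and>
        \<sigma>'' New = layer_val code (extend_layer a ts h ?hs) \<and> frame work_vars \<sigma>' \<sigma>''"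
      have "t + t' \<le> transition_cost * (W + 1) + (length ts * (transition_cost * (W + 1)) + 1)"
        using * ** time by linarith
      then have "t + t' \<le> length (\<tau> # ts) * (transition_cost * (W + 1)) + 1" by simp
      then show "t + t' \<le> length (\<tau> # ts) * (transition_cost * (W + 1)) + 1 \<and>
        \<sigma>'' New = layer_val code (extend_layer a ts h ?hs) \<and> frame work_vars \<sigma> \<sigma>''"
        using * ** by (simp add: frame_def)
    next
      show "\<forall>h\<in>set ?hs. proper k h" by (rule proper_extend_by[OF Cons.prems(2,3) adm(2)])
      show "length (extend_layer a ts h ?hs) \<le> W" using Cons.prems(8) unfolding ext .
    qed (use * Cons.prems in \<open>simp_all add: frame_def\<close>)
  qed
qed

definition expand_loop :: "('l option \<times> 'l option) transition list \<Rightarrow> ram" where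
  "expand_loop ts = WhileNZ (reg Old) (Seq (head Node Old) (Seq (extend_layer_prog ts) (tail Old Old)))"

definition expand_prog :: "('l option \<times> 'l option) transition list \<Rightarrow> ram" where
  "expand_prog ts = Seq (move Old New) (Seq (set_raw New 0) (expand_loop ts))"

abbreviation "expand_vars \<equiv> insert Old (insert Node work_vars)"

lemma expand_loop_runs:
  assumes "\<forall>\<tau>\<in>set ts. usable \<tau>" "\<forall>h\<in>set old. proper k h" "\<forall>h\<in>set hs. proper k h"
    "\<sigma> Old = layer_val code old" "\<sigma> New = layer_val code hs" "\<sigma> Sym = Raw (code a)" "a \<in> padded \<Lambda>"
    "length (fold (extend_layer a ts) old hs) \<le> W"
  shows "runs (expand_loop ts) \<sigma> (\<lambda>t \<sigma>'.
    t \<le> length old * (length ts * (transition_cost * (W + 1)) + 7) + 1 \<and>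
    \<sigma>' New = layer_val code (fold (extend_layer a ts) old hs) \<and> frame expand_vars \<sigma> \<sigma>')"
  using assms
proof (induction old arbitrary: hs \<sigma>)
  case Nil
  then show ?case unfolding expand_loop_def by (intro runs_While_zero) (simp_all add: frame_refl)
next
  case (Cons h old)
  let ?hs = "extend_layer a ts h hs"
  have W: "length ?hs \<le> W"
    using Cons.prems(8) le_trans[OF length_fold_extend] by simp
  have adm: "\<forall>\<tau>\<in>set ts. admissible \<tau>" using Cons.prems(1) by (simp add: usable_def)
  let ?\<sigma> = "\<sigma>(Node := hist_val code h)"
  have h: "proper k h" using Cons.prems(2) by simp
  show ?case
    unfolding expand_loop_def
  proof (rule runs_While_nonzero)
    show "nonzero (\<sigma> Old)" using Cons.prems(4) by simp
    let ?T = "length (h # old) * (length ts * (transition_cost * (W + 1)) + 7) + 1"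
    let ?Q = "\<lambda>t \<sigma>'. t \<le> ?T \<and> \<sigma>' New = layer_val code (fold (extend_layer a ts) (h # old) hs) \<and>
      frame expand_vars \<sigma> \<sigma>'"
    have "runs (extend_layer_prog ts) ?\<sigma> (\<lambda>t \<sigma>'. t \<le> length ts * (transition_cost * (W + 1)) + 1 \<and>
        \<sigma>' New = layer_val code ?hs \<and> frame work_vars ?\<sigma> \<sigma>')"
      using Cons.prems W h by (intro extend_layer_prog_runs) simp_all
    then have "runs (extend_layer_prog ts) ?\<sigma> (\<lambda>t \<sigma>'. runs (tail Old Old) \<sigma>' (\<lambda>t' \<sigma>''.
        runs (expand_loop ts) \<sigma>'' (\<lambda>t''. ?Q (1 + (1 + (t + t')) + t''))))"
    proof (rule runs_conseq)
      fix t \<sigma>' assume *: "t \<le> length ts * (transition_cost * (W + 1)) + 1 \<and>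
        \<sigma>' New = layer_val code ?hs \<and> frame work_vars ?\<sigma> \<sigma>'"
      then have old: "\<sigma>' Old = Branch (hist_val code h) (layer_val code old)" "\<sigma>' Sym = Raw (code a)"
        using Cons.prems(4,6) by (simp_all add: frame_def)
      let ?\<sigma>' = "\<sigma>'(Old := layer_val code old)"
      have "runs (expand_loop ts) ?\<sigma>' (\<lambda>t' \<sigma>''.
          t' \<le> length old * (length ts * (transition_cost * (W + 1)) + 7) + 1 \<and>
          \<sigma>'' New = layer_val code (fold (extend_layer a ts) old ?hs) \<and> frame expand_vars ?\<sigma>' \<sigma>'')"
        using Cons.prems * old proper_extend[OF Cons.prems(3) h adm] by (intro Cons.IH) simp_all
      then have "runs (expand_loop ts) ?\<sigma>' (\<lambda>t''. ?Q (1 + (1 + (t + 4)) + t''))"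
      proof (rule runs_conseq)
        fix t'' \<sigma>'' assume "t'' \<le> length old * (length ts * (transition_cost * (W + 1)) + 7) + 1 \<and>
          \<sigma>'' New = layer_val code (fold (extend_layer a ts) old ?hs) \<and> frame expand_vars ?\<sigma>' \<sigma>''"
        with * show "?Q (1 + (1 + (t + 4)) + t'') \<sigma>''" by (simp add: frame_def)
      qed
      then show "runs (tail Old Old) \<sigma>' (\<lambda>t' \<sigma>''.
          runs (expand_loop ts) \<sigma>'' (\<lambda>t''. ?Q (1 + (1 + (t + t')) + t'')))"
        using old by (intro runs_tail) simp_all
    qed
    then show "runs (Seq (head Node Old) (Seq (extend_layer_prog ts) (tail Old Old))) \<sigma>
      (\<lambda>t \<sigma>'. runs (WhileNZ (reg Old) (Seq (head Node Old) (Seq (extend_layer_prog ts) (tail Old Old)))) \<sigma>'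
        (\<lambda>t'. ?Q (1 + t + t')))"
      unfolding expand_loop_def[symmetric]
      using Cons.prems(4) by (intro runs_Seq runs_head) simp_all
  qed
qed

definition expand_cost :: nat where
  "expand_cost = (length epsilon_ts + length letter_ts) * transition_cost + 10"

text \<open>
  Each of at most \<open>W\<close> old configurations has boundedly many successors, and each of these is compared
  with at most \<open>W\<close> new configurations. This quadratic cost dominates the running time of the algorithm.
\<close>

lemma expand_prog_runs:
  assumes "ts = epsilon_ts \<or> ts = letter_ts" "\<forall>h\<in>set old. proper k h"
    "\<sigma> New = layer_val code old" "\<sigma> Sym = Raw (code a)" "a \<in> padded \<Lambda>"
    "length old \<le> W" "length (expand a ts old) \<le> W"
  shows "runs (expand_prog ts) \<sigma> (\<lambda>t \<sigma>'. t \<le> expand_cost * (W + 1)\<^sup>2 \<and>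
    \<sigma>' New = layer_val code (expand a ts old) \<and> frame expand_vars \<sigma> \<sigma>')"
proof -
  have us: "\<forall>\<tau>\<in>set ts. usable \<tau>" using assms(1) usable_epsilon_ts usable_letter_ts by blast
  let ?\<sigma> = "\<sigma>(Old := \<sigma> New, New := Raw 0)"
  let ?n = "length epsilon_ts + length letter_ts"
  have loop: "runs (expand_loop ts) ?\<sigma> (\<lambda>t \<sigma>'.
      t \<le> length old * (length ts * (transition_cost * (W + 1)) + 7) + 1 \<and>
      \<sigma>' New = layer_val code (fold (extend_layer a ts) old []) \<and> frame expand_vars ?\<sigma> \<sigma>')"
    using us assms unfolding expand_def by (intro expand_loop_runs) simp_all
  have n: "length ts \<le> ?n" using assms(1) by auto
  have "length old * (length ts * (transition_cost * (W + 1)) + 7) + 3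
      \<le> (W + 1) * (?n * (transition_cost * (W + 1)) + 7) + 3"
    using n assms(6) by (intro add_right_mono mult_mono) auto
  also have "\<dots> \<le> (W + 1) * (?n * (transition_cost * (W + 1)) + 10 * (W + 1))"
    by (simp add: algebra_simps)
  also have "\<dots> = expand_cost * (W + 1)\<^sup>2"
    by (simp add: expand_cost_def power2_eq_square algebra_simps)
  finally have time: "length old * (length ts * (transition_cost * (W + 1)) + 7) + 3 \<le> expand_cost * (W + 1)\<^sup>2" .
  have "runs (expand_loop ts) ?\<sigma> (\<lambda>t \<sigma>'. 1 + (1 + t) \<le> expand_cost * (W + 1)\<^sup>2 \<and>
      \<sigma>' New = layer_val code (expand a ts old) \<and> frame expand_vars \<sigma> \<sigma>')"
    unfolding expand_def
  proof (rule runs_conseq[OF loop])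
    fix t \<sigma>' assume *: "t \<le> length old * (length ts * (transition_cost * (W + 1)) + 7) + 1 \<and>
      \<sigma>' New = layer_val code (fold (extend_layer a ts) old []) \<and> frame expand_vars ?\<sigma> \<sigma>'"
    then have "1 + (1 + t) \<le> expand_cost * (W + 1)\<^sup>2" using time by linarith
    with * show "1 + (1 + t) \<le> expand_cost * (W + 1)\<^sup>2 \<and>
      \<sigma>' New = layer_val code (fold (extend_layer a ts) old []) \<and> frame expand_vars \<sigma> \<sigma>'"
      by (simp add: frame_def)
  qed
  then show ?thesis unfolding expand_prog_def by (intro runs_Seq runs_move runs_set_raw) simp
qed

definition rounds_prog :: "nat \<Rightarrow> ram" where
  "rounds_prog i = (Seq (expand_prog epsilon_ts) ^^ i) Skip"

lemma rounds_prog_runs: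
  assumes "\<forall>h\<in>set hs. good s h" "\<sigma> New = layer_val code hs" "\<sigma> Sym = Raw (code a)"
    "a \<in> padded \<Lambda>" "distinct (map conf hs)" "width (s + i) \<le> W"
  shows "runs (rounds_prog i) \<sigma> (\<lambda>t \<sigma>'. t \<le> i * (expand_cost * (W + 1)\<^sup>2) + 1 \<and>
    \<sigma>' New = layer_val code (rounds a i hs) \<and> frame expand_vars \<sigma> \<sigma>')"
  using assms
proof (induction i arbitrary: hs s \<sigma>)
  case 0
  then show ?case by (simp add: rounds_prog_def rounds_0 runs_Skip frame_refl)
next
  case (Suc i)
  let ?hs = "expand a epsilon_ts hs"
  have prog: "rounds_prog (Suc i) = Seq (expand_prog epsilon_ts) (rounds_prog i)"
    by (simp add: rounds_prog_def)
  have rounds: "rounds a (Suc i) hs = rounds a i ?hs"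
    by (simp add: rounds_def funpow_Suc_right del: funpow.simps)
  have good: "\<forall>h\<in>set ?hs. good (Suc s) h" by (rule good_expand_epsilon[OF Suc.prems(1)])
  have "length hs \<le> width s" by (rule length_le_width[OF Suc.prems(1,5)])
  also have "\<dots> \<le> width (s + Suc i)" by (rule width_mono) simp
  finally have W: "length hs \<le> W" using Suc.prems(6) by simp
  have "length ?hs \<le> width (Suc s)" by (rule length_le_width[OF good distinct_expand])
  also have "\<dots> \<le> width (s + Suc i)" by (rule width_mono) simp
  finally have W': "length ?hs \<le> W" using Suc.prems(6) by simp
  have "\<forall>h\<in>set hs. proper k h" using Suc.prems(1) good_proper by blast
  then have exp: "runs (expand_prog epsilon_ts) \<sigma> (\<lambda>t \<sigma>'. t \<le> expand_cost * (W + 1)\<^sup>2 \<and>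
      \<sigma>' New = layer_val code ?hs \<and> frame expand_vars \<sigma> \<sigma>')"
    using Suc.prems W W' by (intro expand_prog_runs) simp_all
  show ?case
    unfolding prog rounds
  proof (rule runs_Seq, rule runs_conseq[OF exp])
    fix t \<sigma>' assume *: "t \<le> expand_cost * (W + 1)\<^sup>2 \<and>
      \<sigma>' New = layer_val code ?hs \<and> frame expand_vars \<sigma> \<sigma>'"
    have "runs (rounds_prog i) \<sigma>' (\<lambda>t \<sigma>''. t \<le> i * (expand_cost * (W + 1)\<^sup>2) + 1 \<and>
        \<sigma>'' New = layer_val code (rounds a i ?hs) \<and> frame expand_vars \<sigma>' \<sigma>'')"
      using * Suc.prems good distinct_expand by (intro Suc.IH[where s = "Suc s"]) (simp_all add: frame_def)
    then show "runs (rounds_prog i) \<sigma>' (\<lambda>t' \<sigma>''. t + t' \<le> Suc i * (expand_cost * (W + 1)\<^sup>2) + 1 \<and>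
        \<sigma>'' New = layer_val code (rounds a i ?hs) \<and> frame expand_vars \<sigma> \<sigma>'')"
    proof (rule runs_conseq)
      fix t' \<sigma>'' assume "t' \<le> i * (expand_cost * (W + 1)\<^sup>2) + 1 \<and>
        \<sigma>'' New = layer_val code (rounds a i ?hs) \<and> frame expand_vars \<sigma>' \<sigma>''"
      with * show "t + t' \<le> Suc i * (expand_cost * (W + 1)\<^sup>2) + 1 \<and>
        \<sigma>'' New = layer_val code (rounds a i ?hs) \<and> frame expand_vars \<sigma> \<sigma>''"
        by (simp add: frame_def)
    qed
  qed
qed

definition round_prog :: ram where
  "round_prog = Seq (expand_prog letter_ts) (rounds_prog B)"

lemma pad_padded: "u \<in> lists \<Lambda> \<Longrightarrow> pad u j \<in> padded \<Lambda>"
  by (auto simp: pad_def padded_def)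

lemma round_prog_runs:
  assumes "\<sigma> New = layer_val code (layer u j)" "\<sigma> Sym = Raw (code (pad u j))" "u \<in> lists \<Lambda>"
    "width (stage (Suc j)) \<le> W"
  shows "runs round_prog \<sigma> (\<lambda>t \<sigma>'. t \<le> (B + 1) * (expand_cost * (W + 1)\<^sup>2) + 1 \<and>
    \<sigma>' New = layer_val code (layer u (Suc j)) \<and> frame expand_vars \<sigma> \<sigma>')"
proof -
  let ?a = "pad u j"
  let ?hs = "expand ?a letter_ts (layer u j)"
  have stage: "stage (Suc j) = Suc (stage j) + B" by (simp add: stage_def)
  have good: "\<forall>h\<in>set ?hs. good (Suc (stage j)) h" by (rule good_expand_letter[OF good_layer])
  have "length (layer u j) \<le> width (stage j)" by (rule length_le_width[OF good_layer distinct_layer])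
  also have "\<dots> \<le> width (stage (Suc j))" by (rule width_mono) (simp add: stage)
  finally have W: "length (layer u j) \<le> W" using assms(4) by simp
  have "length ?hs \<le> width (Suc (stage j))" by (rule length_le_width[OF good distinct_expand])
  also have "\<dots> \<le> width (stage (Suc j))" by (rule width_mono) (simp add: stage)
  finally have W': "length ?hs \<le> W" using assms(4) by simp
  have "\<forall>h\<in>set (layer u j). proper k h" using good_layer good_proper by blast
  then have exp: "runs (expand_prog letter_ts) \<sigma> (\<lambda>t \<sigma>'. t \<le> expand_cost * (W + 1)\<^sup>2 \<and>
      \<sigma>' New = layer_val code ?hs \<and> frame expand_vars \<sigma> \<sigma>')"
    using assms W W' pad_padded by (intro expand_prog_runs) simp_all
  show ?thesis
    unfolding round_prog_def
  proof (rule runs_Seq, rule runs_conseq[OF exp])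
    fix t \<sigma>' assume *: "t \<le> expand_cost * (W + 1)\<^sup>2 \<and>
      \<sigma>' New = layer_val code ?hs \<and> frame expand_vars \<sigma> \<sigma>'"
    have "runs (rounds_prog B) \<sigma>' (\<lambda>t \<sigma>''. t \<le> B * (expand_cost * (W + 1)\<^sup>2) + 1 \<and>
        \<sigma>'' New = layer_val code (rounds ?a B ?hs) \<and> frame expand_vars \<sigma>' \<sigma>'')"
      using * assms good distinct_expand pad_padded stage
      by (intro rounds_prog_runs[where s = "Suc (stage j)"]) (simp_all add: frame_def)
    then show "runs (rounds_prog B) \<sigma>' (\<lambda>t' \<sigma>''. t + t' \<le> (B + 1) * (expand_cost * (W + 1)\<^sup>2) + 1 \<and>
        \<sigma>'' New = layer_val code (layer u (Suc j)) \<and> frame expand_vars \<sigma> \<sigma>'')"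
    proof (rule runs_conseq)
      fix t' \<sigma>'' assume "t' \<le> B * (expand_cost * (W + 1)\<^sup>2) + 1 \<and>
        \<sigma>'' New = layer_val code (rounds ?a B ?hs) \<and> frame expand_vars \<sigma>' \<sigma>''"
      with * show "t + t' \<le> (B + 1) * (expand_cost * (W + 1)\<^sup>2) + 1 \<and>
        \<sigma>'' New = layer_val code (layer u (Suc j)) \<and> frame expand_vars \<sigma> \<sigma>''"
        by (simp add: frame_def)
    qed
  qed
qed

definition accept_prog :: "nat list \<Rightarrow> ram" where
  "accept_prog fs = foldr (\<lambda>f. Seq (Seq (build_nums (encode (f, replicate k 0)))
     (Seq lookup_prog (IfNZ (reg Found) (move Acc Found) Skip)))) fs Skip"

text \<open>
  The content of \<open>Acc\<close> after the configurations with states in \<open>F\<close> and zero counters have been looked up.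
\<close>

definition found_final :: "nat set \<Rightarrow> 'l option history list \<Rightarrow> val \<Rightarrow> bool" where
  "found_final F hs v \<longleftrightarrow> v = Raw 0 \<and> (F \<times> {replicate k 0}) \<inter> conf ` set hs = {} \<or>
     (\<exists>h\<in>set hs. conf h \<in> F \<times> {replicate k 0} \<and> v = hist_val code h)"

lemma found_final_if_final:
  assumes "found_final F hs v" "h \<in> set hs" "conf h \<in> F \<times> {replicate k 0}"
  shows "\<exists>h\<in>set hs. conf h \<in> F \<times> {replicate k 0} \<and> v = hist_val code h"
proof -
  have "conf h \<in> F \<times> {replicate k 0} \<inter> conf ` set hs" using assms(2,3) by (intro IntI imageI)
  then have "F \<times> {replicate k 0} \<inter> conf ` set hs \<noteq> {}" by (metis empty_iff)
  then show ?thesis using assms(1) unfolding found_final_def by (elim disjE conjE) simp_all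
qed

lemma accept_prog_runs:
  assumes "\<sigma> New = layer_val code hs" "\<forall>h\<in>set hs. proper k h" "found_final F hs (\<sigma> Acc)"
  shows "runs (accept_prog fs) \<sigma> (\<lambda>t \<sigma>'. t \<le> length fs * ((60 * k + 80) * (length hs + 1)) + 1 \<and>
    found_final (F \<union> set fs) hs (\<sigma>' Acc) \<and> frame (lookup_vars \<union> {Cand, Acc}) \<sigma> \<sigma>')"
  using assms
proof (induction fs arbitrary: F \<sigma>)
  case Nil
  then show ?case by (simp add: accept_prog_def runs_Skip frame_refl)
next
  case (Cons f fs)
  let ?c = "(f, replicate k 0 :: int list)"
  let ?S = "Seq (build_nums (encode ?c)) (Seq lookup_prog (IfNZ (reg Found) (move Acc Found) Skip))"
  have prog: "accept_prog (f # fs) = Seq ?S (accept_prog fs)" by (simp add: accept_prog_def)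
  have time: "60 * k + 80 = (20 * k + 30) + (40 * k + 50)" by simp
  have one: "20 * k + 30 \<le> (20 * k + 30) * (length hs + 1)" by simp
  have S: "runs ?S \<sigma> (\<lambda>t \<sigma>'. t \<le> (60 * k + 80) * (length hs + 1) \<and>
      found_final (insert f F) hs (\<sigma>' Acc) \<and> frame (lookup_vars \<union> {Cand, Acc}) \<sigma> \<sigma>')"
  proof (rule runs_Seq, rule runs_conseq[OF build_nums_runs], rule runs_Seq)
    fix t1 \<sigma>1 assume 1: "t1 \<le> 9 * length (encode ?c) + 1 \<and> \<sigma>1 Cand = nums (encode ?c) \<and>
      frame {Cand, First} \<sigma> \<sigma>1"
    have t1: "t1 \<le> 18 * k + 10" using 1 by (simp only: length_encode) simp
    have new: "\<sigma>1 New = layer_val code hs" using 1 Cons.prems(1) by (simp add: frame_def)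
    have cand: "\<sigma>1 Cand = nums (encode ?c)" using 1 by (elim conjE)
    let ?Q = "\<lambda>t \<sigma>'. t \<le> (60 * k + 80) * (length hs + 1) \<and>
      found_final (insert f F) hs (\<sigma>' Acc) \<and> frame (lookup_vars \<union> {Cand, Acc}) \<sigma> \<sigma>'"
    have "runs lookup_prog \<sigma>1 (\<lambda>t \<sigma>'. t \<le> (40 * k + 50) * (length hs + 1) \<and>
      frame lookup_vars \<sigma>1 \<sigma>' \<and> (\<sigma>' Found = Raw 0 \<and> ?c \<notin> conf ` set hs \<or>
       (\<exists>h\<in>set hs. conf h = ?c \<and> \<sigma>' Found = hist_val code h)))"
      using new Cons.prems(2) cand by (intro lookup_prog_runs) simp_all
    then show "runs lookup_prog \<sigma>1 (\<lambda>t \<sigma>'. runs (IfNZ (reg Found) (move Acc Found) Skip) \<sigma>'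
        (\<lambda>t'. ?Q (t1 + (t + t'))))"
    proof (rule runs_conseq)
      fix t2 \<sigma>2 assume 2: "t2 \<le> (40 * k + 50) * (length hs + 1) \<and>
        frame lookup_vars \<sigma>1 \<sigma>2 \<and> (\<sigma>2 Found = Raw 0 \<and> ?c \<notin> conf ` set hs \<or>
         (\<exists>h\<in>set hs. conf h = ?c \<and> \<sigma>2 Found = hist_val code h))"
      have t: "t1 + (t2 + 2) \<le> (60 * k + 80) * (length hs + 1)"
        using t1 2 one unfolding time add_mult_distrib[of "20 * k + 30"] by linarith
      have acc: "\<sigma>2 Acc = \<sigma> Acc" and fr: "frame (lookup_vars \<union> {Cand, Acc}) \<sigma> \<sigma>2"
        using 1 2 by (simp_all add: frame_def)
      show "runs (IfNZ (reg Found) (move Acc Found) Skip) \<sigma>2 (\<lambda>t'. ?Q (t1 + (t2 + t')))"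
      proof (rule runs_If)
        assume "nonzero (\<sigma>2 Found)"
        then have "\<exists>h\<in>set hs. conf h = ?c \<and> \<sigma>2 Found = hist_val code h" using 2 by auto
        then have "found_final (insert f F) hs (\<sigma>2 Found)" by (auto simp: found_final_def)
        then show "runs (move Acc Found) \<sigma>2 (\<lambda>t'. ?Q (t1 + (t2 + (1 + t'))))"
          using t fr by (intro runs_move) (simp add: frame_def)
      next
        assume z: "\<not> nonzero (\<sigma>2 Found)"
        have "hist_val code h \<noteq> \<sigma>2 Found" if h: "h \<in> set hs" for h
        proof -
          obtain w where "hist_val code h = Branch (nums (encode (conf h))) w"
            using hist_val_proper[OF bspec[OF Cons.prems(2) h]] by metis
          then show ?thesis using z by (metis nonzero.simps(3))
        qed
        then have "?c \<notin> conf ` set hs" using 2 by metis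
        then have "found_final (insert f F) hs (\<sigma>2 Acc)"
        proof -
          have ins: "insert f F \<times> {replicate k 0} = insert ?c (F \<times> {replicate k (0 :: int)})" by blast
          from Cons.prems(3) consider "\<sigma> Acc = Raw 0" "F \<times> {replicate k 0} \<inter> conf ` set hs = {}"
            | h where "h \<in> set hs" "conf h \<in> F \<times> {replicate k 0}" "\<sigma> Acc = hist_val code h"
            unfolding found_final_def by (elim disjE bexE conjE)
          then show ?thesis
          proof cases
            case 1
            then have "insert ?c (F \<times> {replicate k 0}) \<inter> conf ` set hs = {}"
              using \<open>?c \<notin> conf ` set hs\<close> by simp
            then show ?thesis unfolding found_final_def acc ins using 1(1) by (intro disjI1 conjI)
          next
            case 2
            then show ?thesis unfolding found_final_def acc ins by (intro disjI2 bexI conjI insertI2)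
          qed
        qed
        then show "runs Skip \<sigma>2 (\<lambda>t'. ?Q (t1 + (t2 + (1 + t'))))"
          using t fr by (intro runs_Skip) simp
      qed
    qed
  qed
  have F: "F \<union> set (f # fs) = insert f F \<union> set fs" by simp
  show ?case
    unfolding prog F
  proof (rule runs_Seq, rule runs_conseq[OF S])
    fix t \<sigma>' assume *: "t \<le> (60 * k + 80) * (length hs + 1) \<and>
      found_final (insert f F) hs (\<sigma>' Acc) \<and> frame (lookup_vars \<union> {Cand, Acc}) \<sigma> \<sigma>'"
    have "runs (accept_prog fs) \<sigma>' (\<lambda>t \<sigma>''. t \<le> length fs * ((60 * k + 80) * (length hs + 1)) + 1 \<and>
        found_final (insert f F \<union> set fs) hs (\<sigma>'' Acc) \<and> frame (lookup_vars \<union> {Cand, Acc}) \<sigma>' \<sigma>'')"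
      using * Cons.prems by (intro Cons.IH) (simp_all add: frame_def)
    then show "runs (accept_prog fs) \<sigma>' (\<lambda>t' \<sigma>''. t + t' \<le> length (f # fs) * ((60 * k + 80) * (length hs + 1)) + 1 \<and>
        found_final (insert f F \<union> set fs) hs (\<sigma>'' Acc) \<and> frame (lookup_vars \<union> {Cand, Acc}) \<sigma> \<sigma>'')"
    proof (rule runs_conseq)
      fix t' \<sigma>'' assume "t' \<le> length fs * ((60 * k + 80) * (length hs + 1)) + 1 \<and>
        found_final (insert f F \<union> set fs) hs (\<sigma>'' Acc) \<and> frame (lookup_vars \<union> {Cand, Acc}) \<sigma>' \<sigma>''"
      with * show "t + t' \<le> length (f # fs) * ((60 * k + 80) * (length hs + 1)) + 1 \<and>
        found_final (insert f F \<union> set fs) hs (\<sigma>'' Acc) \<and> frame (lookup_vars \<union> {Cand, Acc}) \<sigma> \<sigma>''"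
        by (simp add: frame_def)
    qed
  qed
qed

text \<open>
  Acceptance is tested only after all of \<open>u\<close> has been read. Before that, an accepted input would be the
  convolution of a proper prefix of \<open>u\<close>.
\<close>

definition search_body :: ram where
  "search_body = IfNZ (reg Rest)
     (Seq (head Sym Rest) (Seq (tail Rest Rest) round_prog))
     (Seq (accept_prog accepting)
       (IfNZ (reg Acc) (set_raw Flag 0) (Seq (set_raw Sym 0) round_prog)))"

abbreviation "search_vars \<equiv> expand_vars \<union> {Sym, Rest, Acc, Flag}"

definition round_cost :: "nat \<Rightarrow> nat" where
  "round_cost W = (B + 1) * (expand_cost * (W + 1)\<^sup>2) +
     length accepting * ((60 * k + 80) * (W + 1)) + 20"

abbreviation tape_tree :: "'l list \<Rightarrow> val" where
  "tape_tree \<equiv> word_tree (\<lambda>b. code (Some b))"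

text \<open>
  \<open>J\<close> is the first layer at which the loop can stop. All layers before it have at most \<open>W\<close> members as well, so
  one bound for the cost of a round serves all iterations.
\<close>

lemma search_loop_runs:
  assumes "u \<in> lists \<Lambda>" "length u \<le> J" "\<exists>h\<in>set (layer u J). conf h \<in> finals"
    "\<And>j. length u \<le> j \<Longrightarrow> j < J \<Longrightarrow> \<forall>h\<in>set (layer u j). conf h \<notin> finals"
    "width (stage J) \<le> W"
    "j \<le> J" "\<sigma> New = layer_val code (layer u j)" "\<sigma> Rest = tape_tree (drop j u)"
    "\<sigma> Flag = Raw 1" "\<sigma> Acc = Raw 0"
  shows "runs (WhileNZ (reg Flag) search_body) \<sigma> (\<lambda>t \<sigma>'. t \<le> (J - j + 1) * round_cost W + 1 \<and>
    (\<exists>h\<in>set (layer u J). conf h \<in> finals \<and> \<sigma>' Acc = hist_val code h) \<and> frame search_vars \<sigma> \<sigma>')"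
  using assms(6-)
proof (induction "J - j" arbitrary: j \<sigma>)
  case 0
  then have j: "j = J" by simp
  have rest: "\<sigma> Rest = Raw 0" using 0(4) assms(2) by (simp add: j word_tree_def)
  have "length (layer u J) \<le> width (stage J)" by (rule length_le_width[OF good_layer distinct_layer])
  then have W: "length (layer u J) \<le> W" using assms(5) by simp
  have proper: "\<forall>h\<in>set (layer u J). proper k h" using good_layer good_proper by blast
  have "runs (accept_prog accepting) \<sigma> (\<lambda>t \<sigma>'.
      t \<le> length accepting * ((60 * k + 80) * (length (layer u J) + 1)) + 1 \<and>
      found_final ({} \<union> set accepting) (layer u J) (\<sigma>' Acc) \<and> frame (lookup_vars \<union> {Cand, Acc}) \<sigma> \<sigma>')"
    using 0 proper by (intro accept_prog_runs) (simp_all add: j found_final_def)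
  then have "runs (accept_prog accepting) \<sigma> (\<lambda>t \<sigma>'.
      runs (IfNZ (reg Acc) (set_raw Flag 0) (Seq (set_raw Sym 0) round_prog)) \<sigma>' (\<lambda>t' \<sigma>''.
      runs (WhileNZ (reg Flag) search_body) \<sigma>'' (\<lambda>t'' \<sigma>'. 1 + (1 + (t + t')) + t'' \<le> (J - j + 1) * round_cost W + 1 \<and>
    (\<exists>h\<in>set (layer u J). conf h \<in> finals \<and> \<sigma>' Acc = hist_val code h) \<and> frame search_vars \<sigma> \<sigma>')))"
  proof (rule runs_conseq)
    fix t \<sigma>' assume *: "t \<le> length accepting * ((60 * k + 80) * (length (layer u J) + 1)) + 1 \<and>
      found_final ({} \<union> set accepting) (layer u J) (\<sigma>' Acc) \<and> frame (lookup_vars \<union> {Cand, Acc}) \<sigma> \<sigma>'"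
    have "length accepting * ((60 * k + 80) * (length (layer u J) + 1)) \<le>
        length accepting * ((60 * k + 80) * (W + 1))"
      using W by (intro mult_left_mono) auto
    then have t: "t + 4 \<le> round_cost W" using * unfolding round_cost_def by linarith
    have "found_final (ca_accept M) (layer u J) (\<sigma>' Acc)" using * by (simp add: set_accepting)
    moreover obtain h0 where "h0 \<in> set (layer u J)" "conf h0 \<in> finals" using assms(3) by (rule bexE)
    ultimately obtain h where h: "h \<in> set (layer u J)" "conf h \<in> finals" "\<sigma>' Acc = hist_val code h"
      unfolding finals_def using found_final_if_final by metis
    obtain w where w: "hist_val code h = Branch (nums (encode (conf h))) w"
      using hist_val_proper[OF bspec[OF proper h(1)]] by metis
    let ?Q = "\<lambda>t'' \<sigma>'. t'' \<le> (J - j + 1) * round_cost W + 1 \<and>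
      (\<exists>h\<in>set (layer u J). conf h \<in> finals \<and> \<sigma>' Acc = hist_val code h) \<and> frame search_vars \<sigma> \<sigma>'"
    have "?Q (1 + (1 + (t + (1 + 1))) + 1) (\<sigma>'(Flag := Raw 0))"
      using * t h by (auto simp: j frame_def)
    then have "runs (WhileNZ (reg Flag) search_body) (\<sigma>'(Flag := Raw 0)) (\<lambda>t''. ?Q (1 + (1 + (t + (1 + 1))) + t''))"
      by (intro runs_While_zero) simp_all
    then have "runs (set_raw Flag 0) \<sigma>' (\<lambda>t' \<sigma>''. runs (WhileNZ (reg Flag) search_body) \<sigma>''
        (\<lambda>t''. ?Q (1 + (1 + (t + (1 + t'))) + t'')))"
      by (rule runs_set_raw)
    then show "runs (IfNZ (reg Acc) (set_raw Flag 0) (Seq (set_raw Sym 0) round_prog)) \<sigma>' (\<lambda>t' \<sigma>''.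
      runs (WhileNZ (reg Flag) search_body) \<sigma>'' (\<lambda>t''. ?Q (1 + (1 + (t + t')) + t'')))"
      using h(3) w by (intro runs_If) simp_all
  qed
  then show ?case
    using 0(5) rest
    by (intro runs_While_nonzero) (auto simp: search_body_def intro!: runs_If runs_Seq)
next
  case (Suc n)
  then have j: "j < J" "n = J - Suc j" by simp_all
  let ?Q = "\<lambda>t'' \<sigma>'. t'' \<le> (J - j + 1) * round_cost W + 1 \<and>
      (\<exists>h\<in>set (layer u J). conf h \<in> finals \<and> \<sigma>' Acc = hist_val code h) \<and> frame search_vars \<sigma> \<sigma>'"
  have JJ: "J - j + 1 = (J - Suc j + 1) + 1" using j(1) by simp
  have "length (layer u j) \<le> width (stage j)" by (rule length_le_width[OF good_layer distinct_layer])
  also have "\<dots> \<le> width (stage J)" using j(1)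
    by (intro width_mono) (simp add: stage_def add_mono mult_right_mono)
  finally have W: "length (layer u j) \<le> W" using assms(5) by simp
  have "width (stage (Suc j)) \<le> width (stage J)" using j(1)
    by (intro width_mono) (metis Suc_leI add_le_mono1 mult_le_mono1 stage_def)
  then have W': "width (stage (Suc j)) \<le> W" using assms(5) by simp
  have go: "runs round_prog \<tau> (\<lambda>t \<sigma>'. runs (WhileNZ (reg Flag) search_body) \<sigma>' (\<lambda>t'. ?Q (d + t + t')))"
    if "\<tau> New = layer_val code (layer u j)" "\<tau> Sym = Raw (code (pad u j))"
      "\<tau> Rest = tape_tree (drop (Suc j) u)" "\<tau> Flag = Raw 1" "\<tau> Acc = Raw 0"
      "frame search_vars \<sigma> \<tau>" "d \<le> length accepting * ((60 * k + 80) * (W + 1)) + 18" for \<tau> d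
  proof (rule runs_conseq[OF round_prog_runs[OF that(1,2) assms(1) W']])
    fix t \<sigma>' assume *: "t \<le> (B + 1) * (expand_cost * (W + 1)\<^sup>2) + 1 \<and>
      \<sigma>' New = layer_val code (layer u (Suc j)) \<and> frame expand_vars \<tau> \<sigma>'"
    have t: "d + t \<le> round_cost W" using * that(7) unfolding round_cost_def by linarith
    have "runs (WhileNZ (reg Flag) search_body) \<sigma>' (\<lambda>t \<sigma>''. t \<le> (J - Suc j + 1) * round_cost W + 1 \<and>
      (\<exists>h\<in>set (layer u J). conf h \<in> finals \<and> \<sigma>'' Acc = hist_val code h) \<and> frame search_vars \<sigma>' \<sigma>'')"
      using * that j by (intro Suc.hyps(1)) (simp_all add: frame_def)
    then show "runs (WhileNZ (reg Flag) search_body) \<sigma>' (\<lambda>t'. ?Q (d + t + t'))"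
    proof (rule runs_conseq)
      fix t' \<sigma>'' assume **: "t' \<le> (J - Suc j + 1) * round_cost W + 1 \<and>
        (\<exists>h\<in>set (layer u J). conf h \<in> finals \<and> \<sigma>'' Acc = hist_val code h) \<and> frame search_vars \<sigma>' \<sigma>''"
      have "d + t + t' \<le> round_cost W + ((J - Suc j + 1) * round_cost W + 1)"
        using t ** by (intro add_mono) auto
      also have "\<dots> = (J - j + 1) * round_cost W + 1" unfolding JJ add_mult_distrib[of _ 1] by simp
      finally have "d + t + t' \<le> (J - j + 1) * round_cost W + 1" .
      with * ** that(6) show "?Q (d + t + t') \<sigma>''" by (simp add: frame_def)
    qed
  qed
  have "runs search_body \<sigma> (\<lambda>t \<sigma>'. runs (WhileNZ (reg Flag) search_body) \<sigma>' (\<lambda>t'. ?Q (1 + t + t')))"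
  proof (cases "j < length u")
    case True
    then have drop: "drop j u = u ! j # drop (Suc j) u" by (simp add: Cons_nth_drop_Suc)
    have rest: "\<sigma> Rest = Branch (Raw (code (pad u j))) (tape_tree (drop (Suc j) u))"
      using Suc.prems(3) True unfolding drop by (simp add: word_tree_def pad_def)
    let ?\<tau> = "\<sigma>(Sym := Raw (code (pad u j)), Rest := tape_tree (drop (Suc j) u))"
    have "runs round_prog ?\<tau> (\<lambda>t \<sigma>'. runs (WhileNZ (reg Flag) search_body) \<sigma>' (\<lambda>t'. ?Q (7 + t + t')))"
      using Suc.prems by (intro go) (simp_all add: frame_def)
    then have "runs round_prog ?\<tau> (\<lambda>t \<sigma>'. runs (WhileNZ (reg Flag) search_body) \<sigma>'
        (\<lambda>t'. ?Q (1 + (1 + (1 + (4 + t))) + t')))"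
      by (simp add: numeral_eq_Suc)
    then show ?thesis
      unfolding search_body_def using rest
      by (intro runs_If runs_Seq runs_head runs_tail) simp_all
  next
    case False
    then have rest: "\<sigma> Rest = Raw 0" and pad: "pad u j = None" and drop: "drop (Suc j) u = []"
      using Suc.prems(3) by (simp_all add: word_tree_def pad_def)
    have proper: "\<forall>h\<in>set (layer u j). proper k h" using good_layer good_proper by blast
    have acc: "runs (accept_prog accepting) \<sigma> (\<lambda>t \<sigma>'.
        t \<le> length accepting * ((60 * k + 80) * (length (layer u j) + 1)) + 1 \<and>
        found_final ({} \<union> set accepting) (layer u j) (\<sigma>' Acc) \<and> frame (lookup_vars \<union> {Cand, Acc}) \<sigma> \<sigma>')"
      using Suc.prems proper by (intro accept_prog_runs) (simp_all add: found_final_def)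
    have "runs (accept_prog accepting) \<sigma> (\<lambda>t \<sigma>'.
      runs (IfNZ (reg Acc) (set_raw Flag 0) (Seq (set_raw Sym 0) round_prog)) \<sigma>' (\<lambda>t' \<sigma>''.
      runs (WhileNZ (reg Flag) search_body) \<sigma>'' (\<lambda>t''. ?Q (1 + (1 + (t + t')) + t''))))"
    proof (rule runs_conseq[OF acc])
      fix t \<sigma>' assume *: "t \<le> length accepting * ((60 * k + 80) * (length (layer u j) + 1)) + 1 \<and>
        found_final ({} \<union> set accepting) (layer u j) (\<sigma>' Acc) \<and> frame (lookup_vars \<union> {Cand, Acc}) \<sigma> \<sigma>'"
      have "length accepting * ((60 * k + 80) * (length (layer u j) + 1)) \<le>
          length accepting * ((60 * k + 80) * (W + 1))"
        using W by (intro mult_left_mono) auto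
      then have t: "t + 4 \<le> length accepting * ((60 * k + 80) * (W + 1)) + 18" using * by linarith
      have "found_final (ca_accept M) (layer u j) (\<sigma>' Acc)" using * by (simp add: set_accepting)
      moreover have "\<forall>h\<in>set (layer u j). conf h \<notin> finals" using False j(1) by (intro assms(4)) simp_all
      ultimately have none: "\<sigma>' Acc = Raw 0"
        unfolding found_final_def finals_def
        by (elim disjE conjE bexE) (assumption, drule (1) bspec, erule (1) notE)
      let ?\<tau> = "\<sigma>'(Sym := Raw 0)"
      have "runs round_prog ?\<tau> (\<lambda>t' \<sigma>'. runs (WhileNZ (reg Flag) search_body) \<sigma>'
          (\<lambda>t''. ?Q ((t + 4) + t' + t'')))"
        using Suc.prems * t none pad drop
        by (intro go) (simp_all add: frame_def code_None word_tree_def rest)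
      then have "runs round_prog ?\<tau> (\<lambda>t' \<sigma>'. runs (WhileNZ (reg Flag) search_body) \<sigma>'
          (\<lambda>t''. ?Q (1 + (1 + (t + (1 + (1 + t')))) + t'')))"
        by (simp add: numeral_eq_Suc)
      then show "runs (IfNZ (reg Acc) (set_raw Flag 0) (Seq (set_raw Sym 0) round_prog)) \<sigma>' (\<lambda>t' \<sigma>''.
        runs (WhileNZ (reg Flag) search_body) \<sigma>'' (\<lambda>t''. ?Q (1 + (1 + (t + t')) + t'')))"
        using none by (intro runs_If runs_Seq runs_set_raw) simp_all
    qed
    then show ?thesis
      unfolding search_body_def using rest by (intro runs_If runs_Seq) simp_all
  qed
  then show ?case using Suc.prems(4) by (intro runs_While_nonzero) simp_all
qed

definition backtrace_loop :: ram where
  "backtrace_loop = WhileNZ (reg Acc) (Seq (tail First Acc) (Seq (head Letter First)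
     (Seq (IfNZ (reg Letter) (new_branch Word Letter Word) Skip) (tail Acc First))))"

text \<open>
  Histories start with the latest configuration, so pushing the recorded letters one by one restores their
  order. Padding symbols and \<open>\<epsilon>\<close>-moves are recorded as code \<open>0\<close> and are skipped.
\<close>

lemma backtrace_loop_runs:
  assumes "\<forall>(c, l)\<in>set h. l \<in> padded \<Lambda>" "\<sigma> Acc = hist_val code h" "\<sigma> Word = tape_tree u"
  shows "runs backtrace_loop \<sigma> (\<lambda>t \<sigma>'. t \<le> 30 * length h + 1 \<and>
    \<sigma>' Word = tape_tree (trace h @ u) \<and> frame {Acc, First, Letter, Word} \<sigma> \<sigma>')"
  using assms
proof (induction h arbitrary: \<sigma> u)
  case Nil
  then show ?case unfolding backtrace_loop_def
    by (intro runs_While_zero) (simp_all add: frame_refl trace_def somes_simps)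
next
  case (Cons cl h)
  obtain c l where cl: "cl = (c, l)" by (cases cl)
  have l: "l \<in> padded \<Lambda>" "None \<in> padded \<Lambda>" and h: "\<forall>(c, l)\<in>set h. l \<in> padded \<Lambda>"
    using Cons.prems(1) by (auto simp: cl padded_def)
  have zero: "code l = 0 \<longleftrightarrow> l = None" using inj_code l code_None by (metis inj_onD)
  define u' where "u' = (case l of None \<Rightarrow> u | Some b \<Rightarrow> b # u)"
  have trace: "trace (cl # h) @ u = trace h @ u'"
    by (cases l) (simp_all add: trace_def cl u'_def somes_append somes_simps)
  have acc: "\<sigma> Acc = Branch (nums (encode c)) (Branch (Raw (code l)) (hist_val code h))"
    using Cons.prems(2) by (simp add: cl)
  show ?case
    unfolding trace backtrace_loop_def
    apply (rule runs_While_nonzero)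
     apply (simp add: acc)
    unfolding backtrace_loop_def[symmetric]
    apply (intro straight_line)
         apply (simp_all add: acc)
    subgoal
      apply (rule runs_conseq[OF Cons.IH[where u = u', OF h]])
      using zero Cons.prems(3) by (auto simp: frame_def u'_def word_tree_def split: option.splits)
    subgoal
      apply (rule runs_conseq[OF Cons.IH[where u = u', OF h]])
      using zero Cons.prems(3) by (auto simp: frame_def u'_def word_tree_def split: option.splits)
    done
qed

definition setup_prog :: ram where
  "setup_prog = Seq (build_nums (encode (ca_init k M))) (Seq (set_raw Letter 0) (Seq (set_raw Acc 0)
     (Seq (new_branch First Letter Acc) (Seq (new_branch First Cand First) (Seq (set_raw New 0)
     (Seq (new_branch New First New) (Seq (set_raw Sym 0) (Seq (move Rest Word) (Seq (set_raw Flag 1)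
     (rounds_prog B))))))))))"

definition search_prog :: ram where
  "search_prog = Seq setup_prog (Seq (WhileNZ (reg Flag) search_body)
     (Seq (set_raw Word 0) backtrace_loop))"

lemma setup_prog_runs:
  assumes "width (stage 0) \<le> W"
  shows "runs setup_prog \<sigma> (\<lambda>t \<sigma>'. t \<le> 18 * k + 50 + B * (expand_cost * (W + 1)\<^sup>2) \<and>
    \<sigma>' New = layer_val code (layer u 0) \<and> \<sigma>' Rest = \<sigma> Word \<and> \<sigma>' Flag = Raw 1 \<and>
    \<sigma>' Acc = Raw 0 \<and> frame search_vars \<sigma> \<sigma>')"
proof -
  have rounds: "runs (rounds_prog B) \<tau> (\<lambda>t \<sigma>'. t \<le> B * (expand_cost * (W + 1)\<^sup>2) + 1 \<and>
      \<sigma>' New = layer_val code (layer u 0) \<and> frame expand_vars \<tau> \<sigma>')"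
    if "\<tau> New = layer_val code [root]" "\<tau> Sym = Raw 0" for \<tau>
    unfolding layer.simps
  proof (rule rounds_prog_runs[where s = 0 and hs = "[root]" and a = None])
    show "width (0 + B) \<le> W" using assms by (simp add: stage_def)
  qed (use that good_root in \<open>simp_all add: code_None padded_def\<close>)
  have root: "layer_val code [root] = Branch (Branch (nums (encode (ca_init k M)))
      (Branch (Raw 0) (Raw 0))) (Raw 0)"
    by (simp add: root_def code_None)
  have len: "length (encode (ca_init k M)) = 2 * k + 1" by (simp only: length_encode ca_init_def snd_conv length_replicate)
  show ?thesis
    unfolding setup_prog_def
  proof (rule runs_Seq, rule runs_conseq[OF build_nums_runs])
    fix t \<sigma>' assume *: "t \<le> 9 * length (encode (ca_init k M)) + 1 \<and>
      \<sigma>' Cand = nums (encode (ca_init k M)) \<and> frame {Cand, First} \<sigma> \<sigma>'"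
    have t: "t \<le> 18 * k + 10" using * unfolding len by simp
    have cand: "\<sigma>' Cand = nums (encode (ca_init k M))" using * by (elim conjE)
    show "runs (Seq (set_raw Letter 0) (Seq (set_raw Acc 0)
     (Seq (new_branch First Letter Acc) (Seq (new_branch First Cand First) (Seq (set_raw New 0)
     (Seq (new_branch New First New) (Seq (set_raw Sym 0) (Seq (move Rest Word) (Seq (set_raw Flag 1)
     (rounds_prog B)))))))))) \<sigma>' (\<lambda>t' \<sigma>'. t + t' \<le> 18 * k + 50 + B * (expand_cost * (W + 1)\<^sup>2) \<and>
      \<sigma>' New = layer_val code (layer u 0) \<and> \<sigma>' Rest = \<sigma> Word \<and> \<sigma>' Flag = Raw 1 \<and>
      \<sigma>' Acc = Raw 0 \<and> frame search_vars \<sigma> \<sigma>')"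
      apply (intro straight_line)
      apply (simp add: cand del: layer.simps vlist.simps list.map)
      apply (rule runs_conseq[OF rounds])
      subgoal by (simp add: root_def code_None)
      subgoal by simp
      subgoal using * t by (simp add: frame_def del: layer.simps)
      done
  qed
qed

definition search_cost :: "nat \<Rightarrow> nat" where
  "search_cost N = (N + 1) * round_cost (width (stage N)) +
     B * (expand_cost * (width (stage N) + 1)\<^sup>2) + 30 * (stage N + 1) + 18 * k + 100"

text \<open>
  The given \<open>v\<close> serves only to guarantee success within \<open>N\<close> letters, since its convolution with \<open>u\<close> leads to an
  accepting configuration. The search may stop earlier and with another second tape.
\<close>

lemma search_prog_runs:
  assumes "u \<in> lists \<Lambda>" "\<sigma> Word = tape_tree u" "conv u v \<in> ca_language k M"
    "ca_language k M \<subseteq> {conv u v |u v. P u v}" "max (length u) (length v) \<le> N"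
  shows "runs search_prog \<sigma> (\<lambda>t \<sigma>'. t \<le> search_cost N \<and>
    (\<exists>v. P u v \<and> \<sigma>' Word = tape_tree v) \<and> \<sigma>' Inp = \<sigma> Inp)"
proof -
  let ?fin = "\<lambda>j. length u \<le> j \<and> (\<exists>h\<in>set (layer u j). conf h \<in> finals)"
  define J where "J = (LEAST j. ?fin j)"
  have fin: "?fin (max (length u) (length v))" using final_layer[OF assms(3)] by simp
  have J: "length u \<le> J" "\<exists>h\<in>set (layer u J). conf h \<in> finals"
    using LeastI[where P = ?fin, OF fin] unfolding J_def by simp_all
  have least: "\<forall>h\<in>set (layer u j). conf h \<notin> finals" if "length u \<le> j" "j < J" for j
    using not_less_Least[where P = ?fin, folded J_def, OF that(2)] that(1) by blast
  have "J \<le> max (length u) (length v)" unfolding J_def by (rule Least_le[where P = ?fin, OF fin])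
  then have JN: "J \<le> N" using assms(5) by linarith
  let ?W = "width (stage N)"
  have stages: "stage J \<le> stage N" "stage 0 \<le> stage N"
    using JN by (auto simp: stage_def intro!: mult_le_mono add_mono)
  have W: "width (stage J) \<le> ?W" "width (stage 0) \<le> ?W"
    using stages by (intro width_mono; simp)+
  have cost: "(J + 1) * round_cost ?W \<le> (N + 1) * round_cost ?W" using JN by (intro mult_right_mono) auto
  show ?thesis
    unfolding search_prog_def
  proof (rule runs_Seq, rule runs_conseq[OF setup_prog_runs[OF W(2), where u = u]])
    fix t1 \<sigma>1 assume 1: "t1 \<le> 18 * k + 50 + B * (expand_cost * (?W + 1)\<^sup>2) \<and>
      \<sigma>1 New = layer_val code (layer u 0) \<and> \<sigma>1 Rest = \<sigma> Word \<and> \<sigma>1 Flag = Raw 1 \<and>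
      \<sigma>1 Acc = Raw 0 \<and> frame search_vars \<sigma> \<sigma>1"
    let ?Q = "\<lambda>t \<sigma>'. t \<le> search_cost N \<and> (\<exists>v. P u v \<and> \<sigma>' Word = tape_tree v) \<and> \<sigma>' Inp = \<sigma> Inp"
    have "runs (WhileNZ (reg Flag) search_body) \<sigma>1 (\<lambda>t \<sigma>'. t \<le> (J - 0 + 1) * round_cost ?W + 1 \<and>
      (\<exists>h\<in>set (layer u J). conf h \<in> finals \<and> \<sigma>' Acc = hist_val code h) \<and> frame search_vars \<sigma>1 \<sigma>')"
      using 1 assms(2) by (intro search_loop_runs[OF assms(1) J least W(1)]) simp_all
    then show "runs (Seq (WhileNZ (reg Flag) search_body) (Seq (set_raw Word 0) backtrace_loop)) \<sigma>1
      (\<lambda>t. ?Q (t1 + t))"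
    proof (intro runs_Seq, elim runs_conseq)
      fix t2 \<sigma>2 assume 2: "t2 \<le> (J - 0 + 1) * round_cost ?W + 1 \<and>
        (\<exists>h\<in>set (layer u J). conf h \<in> finals \<and> \<sigma>2 Acc = hist_val code h) \<and> frame search_vars \<sigma>1 \<sigma>2"
      then obtain h where h: "h \<in> set (layer u J)" "conf h \<in> finals" "\<sigma>2 Acc = hist_val code h" by blast
      have good: "good (stage J) h" using good_layer h(1) by blast
      have P: "P u (trace h)" by (rule final_trace[OF h(1,2) J(1) assms(4)])
      let ?\<sigma> = "\<sigma>2(Word := Raw 0)"
      have "runs backtrace_loop ?\<sigma> (\<lambda>t \<sigma>'. t \<le> 30 * length h + 1 \<and>
        \<sigma>' Word = tape_tree (trace h @ []) \<and> frame {Acc, First, Letter, Word} ?\<sigma> \<sigma>')"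
        using h(3) goodD(5)[OF good] by (intro backtrace_loop_runs) (simp_all add: word_tree_def)
      then have "runs backtrace_loop ?\<sigma> (\<lambda>t. ?Q (t1 + (t2 + (1 + t))))"
      proof (rule runs_conseq)
        fix t3 \<sigma>3 assume 3: "t3 \<le> 30 * length h + 1 \<and>
          \<sigma>3 Word = tape_tree (trace h @ []) \<and> frame {Acc, First, Letter, Word} ?\<sigma> \<sigma>3"
        have sum: "t1 + (t2 + (1 + t3)) \<le> d + b + 30 * s + 18 * k + 100"
          if "t1 \<le> 18 * k + 50 + b" "t2 \<le> c + 1" "c \<le> d" "t3 \<le> 30 * l + 1" "l \<le> s" for b c d l s
          using that by linarith
        have "length h \<le> stage N + 1" using goodD(1)[OF good] stages(1) by simp
        moreover have "t2 \<le> (J + 1) * round_cost ?W + 1" using 2 by simp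
        moreover have "t1 \<le> 18 * k + 50 + B * (expand_cost * (?W + 1)\<^sup>2)" "t3 \<le> 30 * length h + 1"
          using 1 3 by blast+
        ultimately have "t1 + (t2 + (1 + t3)) \<le> search_cost N"
          unfolding search_cost_def using cost by (intro sum)
        moreover have "\<sigma>3 Inp = \<sigma> Inp" using 1 2 3 by (simp add: frame_def)
        ultimately show "?Q (t1 + (t2 + (1 + t3))) \<sigma>3" using P 3 by auto
      qed
      then show "runs (Seq (set_raw Word 0) backtrace_loop) \<sigma>2 (\<lambda>t. ?Q (t1 + (t2 + t)))"
        by (intro runs_Seq runs_set_raw)
    qed
  qed
qed

text \<open>
  There are \<open>O(N)\<close> rounds, and each is quadratic in the width \<open>O(N\<^sup>k)\<close> of a layer.
\<close>

lemma search_cost_bound: "\<exists>K. \<forall>N. search_cost N \<le> K * (N + 1) ^ (2 * k + 1)"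
proof -
  \<comment> \<open>\<open>q * (N + 1) ^ k\<close> bounds the width of a layer plus one, and \<open>R * (N + 1) ^ (2 * k)\<close> the
    cost of a round.\<close>
  define q where "q = card (ca_states M) * (2 * (B + 1)) ^ k + 1"
  define R where "R = (B + 1) * (expand_cost * q\<^sup>2) + length accepting * ((60 * k + 80) * q) + 20"
  define K where "K = R + B * (expand_cost * q\<^sup>2) + 30 * (B + 1) + 18 * k + 100"
  have "search_cost N \<le> K * (N + 1) ^ (2 * k + 1)" for N
  proof -
    let ?M = "N + 1" let ?W = "width (stage N)"
    have stage: "stage N + 1 = (B + 1) * ?M" by (simp add: stage_def)
    then have "2 * stage N + 1 \<le> 2 * (B + 1) * ?M" by linarith
    then have "(2 * stage N + 1) ^ k \<le> (2 * (B + 1)) ^ k * ?M ^ k"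
      unfolding power_mult_distrib[symmetric] by (rule power_mono) simp
    then have "?W \<le> card (ca_states M) * ((2 * (B + 1)) ^ k * ?M ^ k)"
      unfolding width_def by (rule mult_left_mono) simp
    moreover have one: "1 \<le> ?M ^ i" for i by (rule one_le_power) simp
    ultimately have W: "?W + 1 \<le> q * ?M ^ k"
      unfolding q_def add_mult_distrib mult.assoc using one[of k] by linarith
    have W2: "(?W + 1)\<^sup>2 \<le> q\<^sup>2 * ?M ^ (2 * k)"
      using power_mono[OF W, of 2] by (simp add: power_mult_distrib power_mult[symmetric] mult.commute)
    have mono: "?M ^ i \<le> ?M ^ (2 * k + 1)" if "i \<le> 2 * k + 1" for i
      by (rule power_increasing[OF that]) simp
    have "q * ?M ^ k \<le> q * ?M ^ (2 * k)" by (intro mult_left_mono power_increasing) auto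
    then have W1: "?W + 1 \<le> q * ?M ^ (2 * k)" using W by linarith
    have e: "expand_cost * (?W + 1)\<^sup>2 \<le> expand_cost * q\<^sup>2 * ?M ^ (2 * k)"
      using mult_left_mono[OF W2, of expand_cost] by (simp add: mult.assoc)
    have "round_cost ?W \<le> (B + 1) * (expand_cost * q\<^sup>2 * ?M ^ (2 * k)) +
        length accepting * ((60 * k + 80) * (q * ?M ^ (2 * k))) + 20 * ?M ^ (2 * k)"
      unfolding round_cost_def using e W1 one by (intro add_mono mult_left_mono) auto
    also have "\<dots> = R * ?M ^ (2 * k)" unfolding R_def by (simp add: algebra_simps)
    finally have "?M * round_cost ?W \<le> ?M * (R * ?M ^ (2 * k))" by (rule mult_left_mono) simp
    also have "\<dots> = R * ?M ^ (2 * k + 1)" by (simp only: power_add power_one_right ac_simps)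
    finally have r: "?M * round_cost ?W \<le> R * ?M ^ (2 * k + 1)" .
    have "B * (expand_cost * (?W + 1)\<^sup>2) \<le> B * (expand_cost * q\<^sup>2 * ?M ^ (2 * k))"
      using e by (rule mult_left_mono) simp
    also have "\<dots> \<le> B * (expand_cost * q\<^sup>2 * ?M ^ (2 * k + 1))"
      by (intro mult_left_mono mono) auto
    finally have b: "B * (expand_cost * (?W + 1)\<^sup>2) \<le> B * (expand_cost * q\<^sup>2) * ?M ^ (2 * k + 1)"
      by (simp only: mult.assoc)
    have "30 * (stage N + 1) \<le> 30 * ((B + 1) * ?M ^ (2 * k + 1))"
      unfolding stage using mono[of 1] by (intro mult_left_mono) auto
    then have s: "30 * (stage N + 1) \<le> 30 * (B + 1) * ?M ^ (2 * k + 1)" by (simp only: mult.assoc)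
    have "18 * k + 100 \<le> (18 * k + 100) * ?M ^ (2 * k + 1)" using one[of "2 * k + 1"] by simp
    with r b s show ?thesis
      unfolding search_cost_def K_def add_mult_distrib by linarith
  qed
  then show ?thesis by blast
qed

end

section \<open>The algorithm\<close>

text \<open>
  Right multiplication by \<open>x\<close> on normal forms. The search returns a second tape \<open>v'\<close> such that \<open>v'\<close> represents
  the product, and the normal form of a group element is unique.
\<close>

lemma multiplication_program:
  fixes cB :: "'l \<Rightarrow> nat"
  assumes "mult_language G L bar x \<in> counter_languages k (padded \<Lambda> \<times> padded \<Lambda>)"
    and "L \<subseteq> lists \<Lambda>" "inj_on bar L" "letter_code \<Lambda> cB"
  shows "\<exists>P K. \<forall>\<sigma> u v N. u \<in> L \<longrightarrow> v \<in> L \<longrightarrow> bar v = bar u \<otimes>\<^bsub>G\<^esub> x \<longrightarrow>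
    length u \<le> N \<longrightarrow> length v \<le> N \<longrightarrow> \<sigma> Word = word_tree cB u \<longrightarrow>
    runs P \<sigma> (\<lambda>t \<sigma>'. t \<le> K * (N + 1) ^ (2 * k + 1) \<and> \<sigma>' Word = word_tree cB v)"
proof -
  obtain M where M: "mult_language G L bar x = ca_language k M"
    "is_counter_automaton k (padded \<Lambda> \<times> padded \<Lambda>) M" "quasi_realtime k M"
    using assms(1) unfolding counter_languages_def by blast
  obtain B where B: "\<And>as c m c'. ca_path M (ca_init k M) as c \<Longrightarrow> ca_path M c (replicate m None) c' \<Longrightarrow> m \<le> B"
    using M(3) unfolding quasi_realtime_def by blast
  define code where "code = case_option 0 cB"
  have inj: "inj_on code (padded \<Lambda>)"
  proof -
    have "inj_on code (Some ` \<Lambda>)"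
      using assms(4) by (intro inj_onI) (auto simp: code_def letter_code_def dest: inj_onD)
    moreover have "code None \<notin> code ` Some ` \<Lambda>"
      using assms(4) by (simp add: code_def letter_code_def image_image)
    ultimately show ?thesis unfolding padded_def by (intro inj_on_insert[THEN iffD2]) auto
  qed
  interpret automaton_search k B M \<Lambda> code
    by unfold_locales (fact M(2), fact B, fact inj, simp add: code_def)
  have tree: "tape_tree u = word_tree cB u" for u
    unfolding word_tree_def by (simp add: code_def)
  obtain K where K: "\<And>N. search_cost N \<le> K * (N + 1) ^ (2 * k + 1)"
    using search_cost_bound by blast
  let ?P = "\<lambda>u v. u \<in> L \<and> v \<in> L \<and> bar v = bar u \<otimes>\<^bsub>G\<^esub> x"
  have lang: "ca_language k M = {conv u v |u v. ?P u v}"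
    using M(1) by (simp add: mult_language_def)
  have "runs search_prog \<sigma> (\<lambda>t \<sigma>'. t \<le> K * (N + 1) ^ (2 * k + 1) \<and> \<sigma>' Word = word_tree cB v)"
    if "u \<in> L" "v \<in> L" "bar v = bar u \<otimes>\<^bsub>G\<^esub> x" "length u \<le> N" "length v \<le> N"
      "\<sigma> Word = word_tree cB u" for \<sigma> u v N
  proof (rule runs_conseq[OF search_prog_runs[where u = u and v = v and P = ?P and N = N]])
    show "u \<in> lists \<Lambda>" using that(1) assms(2) by blast
    show "conv u v \<in> ca_language k M" unfolding lang using that(1-3) by blast
    fix t \<sigma>' assume *: "t \<le> search_cost N \<and> (\<exists>v. ?P u v \<and> \<sigma>' Word = tape_tree v) \<and> \<sigma>' Inp = \<sigma> Inp"
    then obtain v' where v': "?P u v'" "\<sigma>' Word = tape_tree v'" by blast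
    then have "v' = v" using that(2,3) inj_onD[OF assms(3)] by metis
    moreover have "t \<le> K * (N + 1) ^ (2 * k + 1)" using * K[of N] by linarith
    ultimately show "t \<le> K * (N + 1) ^ (2 * k + 1) \<and> \<sigma>' Word = word_tree cB v"
      using v'(2) tree by simp
  qed (use that tree lang in simp_all)
  then show ?thesis by blast
qed

text \<open>
  Every generator has its own automaton, hence its own program.
\<close>

definition dispatch_prog :: "('g \<Rightarrow> nat) \<Rightarrow> ('g \<Rightarrow> ram) \<Rightarrow> 'g list \<Rightarrow> ram" where
  "dispatch_prog cA P xs = foldr (\<lambda>x. if_raw Inp (cA x) (P x)) xs Skip"

lemma dispatch_prog_runs:
  assumes "x \<in> set xs" "inj_on cA (set xs)" "\<sigma> Inp = Raw (cA x)"
    "runs (P x) \<sigma> (\<lambda>t \<sigma>'. t \<le> T \<and> Q \<sigma>')"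
  shows "runs (dispatch_prog cA P xs) \<sigma>
    (\<lambda>t \<sigma>'. t \<le> T + sum_list (map (\<lambda>x. 2 * cA x + 2) xs) \<and> Q \<sigma>')"
  using assms(1,2)
proof (induction xs)
  case (Cons y ys)
  let ?S = "sum_list (map (\<lambda>x. 2 * cA x + 2) ys)"
  have "runs (if_raw Inp (cA y) (P y) (dispatch_prog cA P ys)) \<sigma>
      (\<lambda>t \<sigma>'. t \<le> T + (2 * cA y + 2 + ?S) \<and> Q \<sigma>')"
  proof (rule runs_if_raw)
    show "is_Raw (\<sigma> Inp)" using assms(3) by simp
  next
    assume "\<sigma> Inp = Raw (cA y)"
    then have "cA x = cA y" using assms(3) by simp
    then have "x = y" using inj_onD[OF Cons.prems(2)] Cons.prems(1) by simp
    with assms(4) have "runs (P y) \<sigma> (\<lambda>t \<sigma>'. t \<le> T \<and> Q \<sigma>')" by simp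
    then show "runs (P y) \<sigma> (\<lambda>t \<sigma>'. \<forall>d\<le>2 * cA y + 2. d + t \<le> T + (2 * cA y + 2 + ?S) \<and> Q \<sigma>')"
      by (rule runs_conseq) auto
  next
    assume "\<sigma> Inp \<noteq> Raw (cA y)"
    then have "x \<in> set ys" using Cons.prems(1) assms(3) by auto
    then have "runs (dispatch_prog cA P ys) \<sigma> (\<lambda>t \<sigma>'. t \<le> T + ?S \<and> Q \<sigma>')"
      using Cons.prems(2) by (intro Cons.IH) (auto intro: inj_on_subset)
    then show "runs (dispatch_prog cA P ys) \<sigma>
        (\<lambda>t \<sigma>'. \<forall>d\<le>2 * cA y + 2. d + t \<le> T + (2 * cA y + 2 + ?S) \<and> Q \<sigma>')"
      by (rule runs_conseq) auto
  qed
  then show ?case by (simp add: dispatch_prog_def)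
qed simp

fun build_word :: "nat list \<Rightarrow> ram" where
  "build_word [] = set_raw Word 0"
| "build_word (n # ns) = Seq (build_word ns) (Seq (set_raw First n) (new_branch Word First Word))"

lemma build_word_runs:
  "runs (build_word ns) \<sigma> (\<lambda>t \<sigma>'. t \<le> 9 * length ns + 1 \<and> \<sigma>' Word = vlist (map Raw ns))"
proof (induction ns arbitrary: \<sigma>)
  case Nil
  show ?case by (auto intro!: straight_line)
next
  case (Cons n ns)
  show ?case
    unfolding build_word.simps
    apply (rule runs_Seq)
    apply (rule runs_conseq[OF Cons.IH])
    apply (intro straight_line)
    by auto
qed

definition print_loop :: ram where
  "print_loop = WhileNZ (reg Word) (Seq (head First Word) (Seq (Print (reg First)) (tail Word Word)))"

lemma print_loop_runs:
  assumes "\<sigma> Word = vlist (map Raw ns)"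
  shows "runs_io print_loop \<sigma> i os (\<lambda>t \<sigma>' i' os'. t \<le> 7 * length ns + 1 \<and> os' = os @ ns)"
  using assms
proof (induction ns arbitrary: \<sigma> os)
  case Nil
  then show ?case unfolding print_loop_def by (intro runs_io_While_zero) simp_all
next
  case (Cons n ns)
  let ?\<sigma>1 = "\<sigma>(First := Raw n)" let ?\<sigma>2 = "\<sigma>(First := Raw n, Word := vlist (map Raw ns))"
  let ?Q = "\<lambda>t (\<sigma>' :: store) (i' :: nat list) os'. t \<le> 7 * length (n # ns) + 1 \<and> os' = os @ n # ns"
  have loop: "runs_io print_loop ?\<sigma>2 i (os @ [n]) (\<lambda>t. ?Q (1 + (1 + (1 + 4)) + t))"
    by (rule runs_io_conseq[OF Cons.IH]) auto
  have "runs (tail Word Word) ?\<sigma>1 (\<lambda>t \<sigma>'. t = 4 \<and> \<sigma>' = ?\<sigma>2)"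
    using Cons.prems by (intro runs_tail) simp_all
  then have "runs_io (tail Word Word) ?\<sigma>1 i (os @ [n])
      (\<lambda>t \<sigma>' i' os'. runs_io print_loop \<sigma>' i' os' (\<lambda>t'. ?Q (1 + (1 + (1 + t)) + t')))"
    using loop by (elim runs_io_lift) simp
  then have p: "runs_io (Seq (Print (reg First)) (tail Word Word)) ?\<sigma>1 i os
      (\<lambda>t \<sigma>' i' os'. runs_io print_loop \<sigma>' i' os' (\<lambda>t'. ?Q (1 + (1 + t) + t')))"
    by (intro runs_io_Seq runs_io_Print) simp_all
  have "runs (head First Word) \<sigma> (\<lambda>t \<sigma>'. t = 1 \<and> \<sigma>' = ?\<sigma>1)"
    using Cons.prems by (intro runs_head) simp_all
  then have "runs_io (head First Word) \<sigma> i os (\<lambda>t \<sigma>' i' os'.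
      runs_io (Seq (Print (reg First)) (tail Word Word)) \<sigma>' i' os' (\<lambda>t' \<sigma>' i' os'.
      runs_io print_loop \<sigma>' i' os' (\<lambda>t''. ?Q (1 + (t + t') + t''))))"
    using p by (elim runs_io_lift) simp
  then show ?case
    using Cons.prems unfolding print_loop_def
    by (intro runs_io_While_nonzero runs_io_Seq) simp_all
qed

lemma word_val_snoc:
  assumes "group G" "set w \<subseteq> carrier G" "x \<in> carrier G"
  shows "word_val G w \<in> carrier G" "word_val G (w @ [x]) = word_val G w \<otimes>\<^bsub>G\<^esub> x"
proof -
  interpret group G by fact
  have "word_val G w \<in> carrier G \<and> word_val G (w @ [x]) = word_val G w \<otimes>\<^bsub>G\<^esub> x"
    using assms(2)
  proof (induction w)
    case Nil
    then show ?case using assms(3) by (simp add: word_val_def)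
  next
    case (Cons y w)
    then show ?case using assms(3) by (simp add: word_val_def m_assoc)
  qed
  then show "word_val G w \<in> carrier G" "word_val G (w @ [x]) = word_val G w \<otimes>\<^bsub>G\<^esub> x" by auto
qed

definition first_code :: "nat list \<Rightarrow> nat" where
  "first_code i = (case i of [] \<Rightarrow> 0 | a # _ \<Rightarrow> a)"

definition main_loop :: "ram \<Rightarrow> ram" where
  "main_loop P = WhileNZ (reg Inp) (Seq P (Read (reg Inp)))"

text \<open>
  While the loop runs, \<open>Word\<close> holds the normal form of the prefix read so far, and the next input letter is already in
  \<open>Inp\<close>; the code \<open>0\<close> there signals the end of the input.
\<close>

lemma main_loop_runs:
  assumes step: "\<And>\<sigma> before x after u. w = before @ x # after \<Longrightarrow> u \<in> L \<Longrightarrow>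
      bar u = word_val G before \<Longrightarrow> \<sigma> Word = word_tree cB u \<Longrightarrow> \<sigma> Inp = Raw (cA x) \<Longrightarrow>
      runs P \<sigma> (\<lambda>t \<sigma>'. t \<le> T \<and> (\<exists>v\<in>L. bar v = word_val G (before @ [x]) \<and> \<sigma>' Word = word_tree cB v))"
    and "\<And>x. x \<in> set w \<Longrightarrow> cA x \<noteq> 0"
    and "w = before @ after" "u \<in> L" "bar u = word_val G before" "\<sigma> Word = word_tree cB u"
    "\<sigma> Inp = Raw (first_code (map cA after))"
  shows "runs_io (main_loop P) \<sigma> (tl (map cA after)) os (\<lambda>t \<sigma>' i' os'. t \<le> length after * (T + 2) + 1 \<and>
    os' = os \<and> (\<exists>v\<in>L. bar v = word_val G w \<and> \<sigma>' Word = word_tree cB v))"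
  using assms(3-)
proof (induction after arbitrary: before u \<sigma>)
  case Nil
  then show ?case unfolding main_loop_def
    by (intro runs_io_While_zero) (auto simp: first_code_def)
next
  case (Cons x after)
  let ?Q = "\<lambda>t \<sigma>' (i' :: nat list) os'. t \<le> length (x # after) * (T + 2) + 1 \<and>
    os' = os \<and> (\<exists>v\<in>L. bar v = word_val G w \<and> \<sigma>' Word = word_tree cB v)"
  have inp: "\<sigma> Inp = Raw (cA x)" using Cons.prems(5) by (simp add: first_code_def)
  have nz: "nonzero (\<sigma> Inp)" using inp assms(2)[of x] Cons.prems(1) by simp
  have "runs_io P \<sigma> (map cA after) os (\<lambda>t \<sigma>' i' os'. runs_io (Read (reg Inp)) \<sigma>' i' os'
      (\<lambda>t' \<sigma>' i' os'. runs_io (main_loop P) \<sigma>' i' os' (\<lambda>t''. ?Q (1 + (t + t') + t''))))"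
  proof (rule runs_io_lift[OF step[OF Cons.prems(1-4) inp]])
    fix t \<sigma>' assume *: "t \<le> T \<and> (\<exists>v\<in>L. bar v = word_val G (before @ [x]) \<and> \<sigma>' Word = word_tree cB v)"
    then obtain v where v: "v \<in> L" "bar v = word_val G (before @ [x])" "\<sigma>' Word = word_tree cB v"
      by blast
    let ?\<sigma> = "\<sigma>'(Inp := Raw (first_code (map cA after)))"
    have "runs_io (main_loop P) ?\<sigma> (tl (map cA after)) os (\<lambda>t \<sigma>' i' os'. t \<le> length after * (T + 2) + 1 \<and>
      os' = os \<and> (\<exists>v\<in>L. bar v = word_val G w \<and> \<sigma>' Word = word_tree cB v))"
      using Cons.prems(1) v by (intro Cons.IH[of "before @ [x]" v]) simp_all
    then have "runs_io (main_loop P) ?\<sigma> (tl (map cA after)) os (\<lambda>t''. ?Q (1 + (t + 1) + t''))"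
      by (rule runs_io_conseq) (use * in auto)
    then show "runs_io (Read (reg Inp)) \<sigma>' (map cA after) os
      (\<lambda>t' \<sigma>' i' os'. runs_io (main_loop P) \<sigma>' i' os' (\<lambda>t''. ?Q (1 + (t + t') + t'')))"
      by (intro runs_io_Read) (simp add: first_code_def)
  qed
  then have "runs_io (Seq P (Read (reg Inp))) \<sigma> (map cA after) os
      (\<lambda>t \<sigma>' i' os'. runs_io (main_loop P) \<sigma>' i' os' (\<lambda>t''. ?Q (1 + t + t'')))"
    by (rule runs_io_Seq)
  with nz show ?case unfolding main_loop_def by (simp add: runs_io_While_nonzero)
qed

text \<open>
  A word for a group element bounds its norm from above, so quasigeodesicity bounds normal forms by the length
  of any such word.
\<close>

lemma normal_form_length:
  assumes "quasigeodesic G X L bar"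
  shows "\<exists>d. \<forall>u\<in>L. \<forall>w\<in>lists X. bar u = word_val G w \<longrightarrow> length u \<le> d * (length w + 1)"
proof -
  obtain D :: real where D: "\<And>u. u \<in> L \<Longrightarrow> real (length u) \<le> D * (real (word_norm G X (bar u)) + 1)"
    using assms unfolding quasigeodesic_def by blast
  have "length u \<le> nat \<lceil>D\<rceil> * (length w + 1)" if "u \<in> L" "w \<in> lists X" "bar u = word_val G w" for u w
  proof -
    have "word_norm G X (bar u) \<le> length w"
      unfolding word_norm_def by (rule Least_le) (use that in auto)
    then have n: "real (word_norm G X (bar u)) + 1 \<le> real (length w + 1)" by simp
    have "real (length u) \<le> D * (real (word_norm G X (bar u)) + 1)" by (rule D[OF that(1)])
    also have "\<dots> \<le> real (nat \<lceil>D\<rceil>) * (real (word_norm G X (bar u)) + 1)"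
      by (intro mult_right_mono) linarith+
    also have "\<dots> \<le> real (nat \<lceil>D\<rceil>) * real (length w + 1)" using n by (rule mult_left_mono) simp
    finally show ?thesis unfolding of_nat_mult[symmetric] of_nat_le_iff .
  qed
  then show ?thesis by blast
qed

text \<open>
  \<open>n + 1 \<le> 2 n\<close> for \<open>n \<ge> 1\<close>.
\<close>

lemma shifted_power_bigo: "(\<lambda>n. real (C * (n + 1) ^ r)) \<in> O(\<lambda>n. real n ^ r)"
proof (rule bigoI)
  show "eventually (\<lambda>n. norm (real (C * (n + 1) ^ r)) \<le> real (C * 2 ^ r) * norm (real n ^ r)) at_top"
    using eventually_ge_at_top[of 1]
  proof eventually_elim
    case (elim n)
    have "C * (n + 1) ^ r \<le> C * (2 * n) ^ r" using elim by (intro mult_left_mono power_mono) auto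
    then have "real (C * (n + 1) ^ r) \<le> real (C * (2 * n) ^ r)" by (rule of_nat_mono)
    then show ?case by (simp add: power_mult_distrib mult.assoc)
  qed
qed

theorem theorem3p1:
  fixes G :: "('g, 'b) monoid_scheme" and X :: "'g set" and \<Lambda> :: "'l set"
    and L :: "'l list set" and bar :: "'l list \<Rightarrow> 'g" and k :: nat
    and p :: "'g list" and q :: "'l list"
  assumes "k \<ge> 1"
    and "group G"
    and "finite X" and "symmetric_generating_set G X"
    and "finite \<Lambda>"
    and "counter_graph_automatic k G X \<Lambda> L bar"
    and "quasigeodesic G X L bar"
    and "p \<in> lists X" and "q \<in> L" and "word_val G p = bar q"
  shows "computable_in_time X \<Lambda> (\<lambda>w u. u \<in> L \<and> bar u = word_val G w)
           (\<lambda>n. real n ^ (2 * k + 2))"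
  unfolding computable_in_time_def
proof (intro allI impI)
  fix cA :: "'g \<Rightarrow> nat" and cB :: "'l \<Rightarrow> nat"
  assume cA: "letter_code X cA" and cB: "letter_code \<Lambda> cB"
  have X: "X \<subseteq> carrier G" using assms(4) by (simp add: symmetric_generating_set_def)
  have L: "L \<subseteq> lists \<Lambda>" "bij_betw bar L (carrier G)"
    and mult: "\<And>x. x \<in> X \<Longrightarrow> mult_language G L bar x \<in> counter_languages k (padded \<Lambda> \<times> padded \<Lambda>)"
    using assms(6) unfolding counter_graph_automatic_def normal_form_def by blast+
  have inj: "inj_on bar L" by (rule bij_betw_imp_inj_on[OF L(2)])
  have onto: "\<exists>u\<in>L. bar u = g" if "g \<in> carrier G" for g
    using that bij_betw_imp_surj_on[OF L(2)] by (metis imageE)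
  have "\<forall>x\<in>X. \<exists>P K. \<forall>\<sigma> u v N. u \<in> L \<longrightarrow> v \<in> L \<longrightarrow> bar v = bar u \<otimes>\<^bsub>G\<^esub> x \<longrightarrow>
    length u \<le> N \<longrightarrow> length v \<le> N \<longrightarrow> \<sigma> Word = word_tree cB u \<longrightarrow>
    runs P \<sigma> (\<lambda>t \<sigma>'. t \<le> K * (N + 1) ^ (2 * k + 1) \<and> \<sigma>' Word = word_tree cB v)"
    using multiplication_program[OF mult L(1) inj cB] by blast
  then obtain P K where PK: "\<And>x \<sigma> u v N. x \<in> X \<Longrightarrow> u \<in> L \<Longrightarrow> v \<in> L \<Longrightarrow> bar v = bar u \<otimes>\<^bsub>G\<^esub> x \<Longrightarrow>
    length u \<le> N \<Longrightarrow> length v \<le> N \<Longrightarrow> \<sigma> Word = word_tree cB u \<Longrightarrow>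
    runs (P x) \<sigma> (\<lambda>t \<sigma>'. t \<le> K x * (N + 1) ^ (2 * k + 1) \<and> \<sigma>' Word = word_tree cB v)"
    by metis
  define Kmax where "Kmax = sum K X"
  have Kmax: "K x \<le> Kmax" if "x \<in> X" for x
    unfolding Kmax_def using assms(3) that by (intro member_le_sum) auto
  obtain xs where xs: "set xs = X" using finite_list[OF assms(3)] by blast
  \<comment> \<open>The computation starts with the normal form of the identity, which is part of the program.\<close>
  obtain e where e: "e \<in> L" "bar e = \<one>\<^bsub>G\<^esub>"
    using onto group.is_monoid[OF assms(2)] monoid.one_closed by metis
  obtain d where d: "\<And>u w. u \<in> L \<Longrightarrow> w \<in> lists X \<Longrightarrow> bar u = word_val G w \<Longrightarrow> length u \<le> d * (length w + 1)"
    using normal_form_length[OF assms(7)] by blast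
  define D where "D = sum_list (map (\<lambda>x. 2 * cA x + 2) xs)"
  define step_prog where "step_prog = dispatch_prog cA P xs"
  define prog where "prog = Seq initialize (Seq (build_word (map cB e)) (Seq (Read (reg Inp))
    (Seq (main_loop step_prog) print_loop)))"
  \<comment> \<open>The summands pay, in this order, for the searches, dispatching, the loop, printing, and building
    the normal form of the identity.\<close>
  define C where "C = Kmax * (d + 1) ^ (2 * k + 1) + D + 2 + 7 * d + 9 * length e + 10"
  define T where "T n = C * (n + 1) ^ (2 * k + 2)" for n
  have main: "\<exists>u\<in>lists \<Lambda>. (u \<in> L \<and> bar u = word_val G w) \<and>
      (\<exists>t m i. t \<le> T (length w) \<and> ram_exec prog (\<lambda>_. 0, map cA w, []) t (m, i, map cB u))"
    if w: "w \<in> lists X" for w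
  proof -
    define n where "n = length w"
    \<comment> \<open>A bound for the normal forms of all prefixes of \<open>w\<close>; \<open>S\<close> below bounds the time per letter.\<close>
    define N where "N = d * (n + 1)"
    define S where "S = Kmax * (N + 1) ^ (2 * k + 1) + D"
    have short: "length u \<le> N" if "u \<in> L" "bar u = word_val G before" "w = before @ after" for u before after
    proof -
      have "length u \<le> d * (length before + 1)" using that w by (intro d) auto
      also have "\<dots> \<le> N" unfolding N_def n_def that(3) by (intro mult_left_mono) auto
      finally show ?thesis .
    qed
    have step: "runs step_prog \<sigma> (\<lambda>t \<sigma>'. t \<le> S \<and>
        (\<exists>v\<in>L. bar v = word_val G (before @ [x]) \<and> \<sigma>' Word = word_tree cB v))"
      if split: "w = before @ x # after" and u: "u \<in> L" "bar u = word_val G before"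
        and \<sigma>: "\<sigma> Word = word_tree cB u" "\<sigma> Inp = Raw (cA x)" for \<sigma> before x after u
    proof -
      have x: "x \<in> X" and before: "set before \<subseteq> X" using w split by auto
      then have "word_val G before \<in> carrier G" and snoc: "word_val G (before @ [x]) = word_val G before \<otimes>\<^bsub>G\<^esub> x"
        using word_val_snoc[OF assms(2)] X by blast+
      then have "word_val G (before @ [x]) \<in> carrier G"
        using x X group.is_monoid[OF assms(2)] monoid.m_closed by (metis subsetD)
      then obtain v where v: "v \<in> L" "bar v = word_val G (before @ [x])" using onto by blast
      have len: "length u \<le> N" "length v \<le> N"
        using short[OF u split] short[of v "before @ [x]" after] v split by simp_all
      have "bar v = bar u \<otimes>\<^bsub>G\<^esub> x" using v(2) snoc u(2) by simp
      from PK[where x = x and u = u and v = v and N = N and \<sigma> = \<sigma>, OF x u(1) v(1) this len \<sigma>(1)]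
      have "runs (P x) \<sigma> (\<lambda>t \<sigma>'. t \<le> Kmax * (N + 1) ^ (2 * k + 1) \<and> \<sigma>' Word = word_tree cB v)"
      proof (rule runs_conseq)
        fix t \<sigma>' assume "t \<le> K x * (N + 1) ^ (2 * k + 1) \<and> \<sigma>' Word = word_tree cB v"
        moreover have "K x * (N + 1) ^ (2 * k + 1) \<le> Kmax * (N + 1) ^ (2 * k + 1)"
          using Kmax[OF x] by (rule mult_right_mono) simp
        ultimately show "t \<le> Kmax * (N + 1) ^ (2 * k + 1) \<and> \<sigma>' Word = word_tree cB v" by linarith
      qed
      then have "runs (dispatch_prog cA P xs) \<sigma> (\<lambda>t \<sigma>'. t \<le> S \<and> \<sigma>' Word = word_tree cB v)"
        unfolding S_def D_def using cA x xs \<sigma>(2)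
        by (intro dispatch_prog_runs) (simp_all add: letter_code_def)
      then show ?thesis unfolding step_prog_def
        by (rule runs_conseq) (use v in blast)
    qed
    have nz: "cA x \<noteq> 0" if "x \<in> set w" for x
      using cA that w unfolding letter_code_def by force
    let ?Q = "\<lambda>t (\<sigma> :: store) (i :: nat list) os. t + 2 \<le> T n \<and> (\<exists>v\<in>L. bar v = word_val G w \<and> os = map cB v)"
    have time: "9 * length e + 1 + (1 + ((n * (S + 2) + 1) + (7 * N + 1))) + 2 \<le> T n"
    proof -
      let ?M = "n + 1"
      have one: "1 \<le> ?M ^ i" for i by (rule one_le_power) simp
      have mono: "?M \<le> ?M ^ (2 * k + 2)" using power_increasing[of 1 "2 * k + 2" ?M] by simp
      have "N + 1 \<le> (d + 1) * ?M" by (simp add: N_def)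
      then have "(N + 1) ^ (2 * k + 1) \<le> (d + 1) ^ (2 * k + 1) * ?M ^ (2 * k + 1)"
        unfolding power_mult_distrib[symmetric] by (rule power_mono) simp
      then have "?M * (Kmax * (N + 1) ^ (2 * k + 1)) \<le> ?M * (Kmax * ((d + 1) ^ (2 * k + 1) * ?M ^ (2 * k + 1)))"
        by (intro mult_left_mono) auto
      also have "\<dots> = Kmax * (d + 1) ^ (2 * k + 1) * ?M ^ (2 * k + 2)"
      proof -
        have "?M ^ (2 * k + 2) = ?M * ?M ^ (2 * k + 1)" by simp
        then show ?thesis by (simp only: ac_simps)
      qed
      finally have a: "?M * (Kmax * (N + 1) ^ (2 * k + 1)) \<le> Kmax * (d + 1) ^ (2 * k + 1) * ?M ^ (2 * k + 2)" .
      have b: "?M * (D + 2) \<le> (D + 2) * ?M ^ (2 * k + 2)"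
        using mono mult_right_mono[OF mono, of "D + 2"] by (simp only: mult.commute) 
      have c: "7 * N \<le> 7 * d * ?M ^ (2 * k + 2)" unfolding N_def using mono
        by (metis mult.assoc mult_le_mono2)
      have f: "9 * length e + 10 \<le> (9 * length e + 10) * ?M ^ (2 * k + 2)" using one[of "2 * k + 2"] by simp
      have "n * (S + 2) \<le> ?M * (Kmax * (N + 1) ^ (2 * k + 1)) + ?M * (D + 2)"
        unfolding S_def by (simp add: algebra_simps)
      with a b have g: "n * (S + 2) \<le> Kmax * (d + 1) ^ (2 * k + 1) * ?M ^ (2 * k + 2) + (D + 2) * ?M ^ (2 * k + 2)"
        by linarith
      have "T n = Kmax * (d + 1) ^ (2 * k + 1) * ?M ^ (2 * k + 2) + (D + 2) * ?M ^ (2 * k + 2) +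
          7 * d * ?M ^ (2 * k + 2) + (9 * length e + 10) * ?M ^ (2 * k + 2)"
        unfolding T_def C_def by (simp only: add_mult_distrib add.assoc)
      with g c f show ?thesis by linarith
    qed
    have loop: "runs_io (main_loop step_prog) \<sigma> (tl (map cA w)) [] (\<lambda>t \<sigma> i os.
        runs_io print_loop \<sigma> i os (\<lambda>t'. ?Q (t0 + (1 + (t + t')))))"
      if "\<sigma> Word = word_tree cB e" "\<sigma> Inp = Raw (first_code (map cA w))" "t0 \<le> 9 * length e + 1" for \<sigma> t0
    proof (rule runs_io_conseq[OF main_loop_runs[where w = w and before = "[]" and after = w and u = e
            and G = G and bar = bar and cA = cA and cB = cB and P = step_prog, OF step nz]])
      fix t \<sigma>' i' and os' :: "nat list" assume *: "t \<le> length w * (S + 2) + 1 \<and> os' = [] \<and>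
        (\<exists>v\<in>L. bar v = word_val G w \<and> \<sigma>' Word = word_tree cB v)"
      then obtain v where v: "v \<in> L" "bar v = word_val G w" "\<sigma>' Word = word_tree cB v" by blast
      have "length v \<le> N" using short[of v w "[]"] v by simp
      have "runs_io print_loop \<sigma>' i' os' (\<lambda>t \<sigma>'' i'' os''. t \<le> 7 * length (map cB v) + 1 \<and> os'' = os' @ map cB v)"
        using v(3) by (intro print_loop_runs) (simp add: word_tree_def comp_def)
      then show "runs_io print_loop \<sigma>' i' os' (\<lambda>t'. ?Q (t0 + (1 + (t + t'))))"
      proof (rule runs_io_conseq)
        fix t' \<sigma>'' i'' os'' assume **: "t' \<le> 7 * length (map cB v) + 1 \<and> os'' = os' @ map cB v"
        have "t' \<le> 7 * N + 1" using ** \<open>length v \<le> N\<close> by simp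
        moreover have "t \<le> n * (S + 2) + 1" using * by (simp add: n_def)
        ultimately have "t0 + (1 + (t + t')) + 2 \<le> 9 * length e + 1 + (1 + ((n * (S + 2) + 1) + (7 * N + 1))) + 2"
          using that(3) by (intro add_mono) auto
        then have "t0 + (1 + (t + t')) + 2 \<le> T n" using time by (rule le_trans)
        with * ** v show "?Q (t0 + (1 + (t + t'))) \<sigma>'' i'' os''" by auto
      qed
    qed (use that e in \<open>simp_all add: word_val_def\<close>)
    have rest: "runs_io (Seq (build_word (map cB e)) (Seq (Read (reg Inp))
        (Seq (main_loop step_prog) print_loop))) (\<lambda>_. Raw 0) (map cA w) [] ?Q"
    proof (rule runs_io_Seq, rule runs_io_lift[OF build_word_runs])
      fix t0 \<sigma> assume *: "t0 \<le> 9 * length (map cB e) + 1 \<and> \<sigma> Word = vlist (map Raw (map cB e))"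
      let ?\<sigma> = "\<sigma>(Inp := Raw (first_code (map cA w)))"
      have "runs_io (main_loop step_prog) ?\<sigma> (tl (map cA w)) [] (\<lambda>t \<sigma> i os.
          runs_io print_loop \<sigma> i os (\<lambda>t'. ?Q (t0 + (1 + (t + t')))))"
        using * by (intro loop) (simp_all add: word_tree_def comp_def)
      then have "runs_io (Seq (main_loop step_prog) print_loop) ?\<sigma> (tl (map cA w)) [] (\<lambda>t. ?Q (t0 + (1 + t)))"
        by (rule runs_io_Seq)
      then show "runs_io (Seq (Read (reg Inp)) (Seq (main_loop step_prog) print_loop)) \<sigma> (map cA w) []
          (\<lambda>t. ?Q (t0 + t))"
        unfolding first_code_def by - (rule runs_io_Seq, rule runs_io_Read)
    qed
    obtain m where m: "ram_exec initialize (\<lambda>_. 0, map cA w, []) 2 (m, map cA w, [])" "represents m (\<lambda>_. Raw 0)"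
      using exec_initialize by blast
    then obtain t m' \<sigma>' i' os' where t: "ram_exec (Seq (build_word (map cB e)) (Seq (Read (reg Inp))
        (Seq (main_loop step_prog) print_loop))) (m, map cA w, []) t (m', i', os')" "?Q t \<sigma>' i' os'"
      using rest unfolding runs_io_def by blast
    then obtain v where v: "v \<in> L" "bar v = word_val G w" "os' = map cB v" by blast
    have "ram_exec prog (\<lambda>_. 0, map cA w, []) (2 + t) (m', i', map cB v)"
      unfolding prog_def using exec_Seq[OF m(1) t(1)] v(3) by simp
    moreover have "2 + t \<le> T (length w)" using t(2) by (simp add: n_def)
    ultimately show ?thesis using v L(1) by blast
  qed
  have "(\<lambda>n. real (T n)) \<in> O(\<lambda>n. real n ^ (2 * k + 2))"
    unfolding T_def by (rule shifted_power_bigo)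
  with main show "\<exists>P T. (\<lambda>n. real (T n)) \<in> O(\<lambda>n. real n ^ (2 * k + 2)) \<and>
      (\<forall>w\<in>lists X. \<exists>u\<in>lists \<Lambda>. (u \<in> L \<and> bar u = word_val G w) \<and>
        (\<exists>t m i. t \<le> T (length w) \<and> ram_exec P (\<lambda>_. 0, map cA w, []) t (m, i, map cB u)))"
    by blast
qed

end
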